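(* Let $\Gamma$ be a metrized graph and let $\mu$ be a real-valued signed Borel measure on $\Gamma$ with $\mu(\Gamma)=1$ and $|\mu|(\Gamma)<\infty$. There exists a constant $C>0$ (depending only on $\Gamma$ and $\mu$) such that if $N\ge2$ and $x_1,\ldots,x_N\in\Gamma$, then $$\frac{1}{N(N-1)}\sum_{i\ne j}g_\mu(x_i,x_j)\ \ge\ -\frac{C}{N}.$$
   Context: The sum runs over ordered pairs $(i,j)$ with $1\le i,j\le N$, $i\neq j$. A metrized graph $\Gamma$ is a compact connected metric space such that for each $p\in\Gamma$ there are a radius $r_p>0$ and an integer $n_p\ge 1$ such that $p$ has a neighborhood isometric to the star $\{te^{2\pi i k/n_p}\in\mathbb{C}: 0\le t<r_p,\ k\in\mathbb{Z}\}$ with the path metric. $\mathrm{Vec}(p)$ is the set of $n_p$ formal unit vectors at $p$ (one for each ray of the star); $p+t\vec v$ is the point at distance $t$ from $p$ in direction $\vec v$ (small $t\ge0$), and $d_{\vec v}f(p)=\lim_{t\to0^+}(f(p+t\vec v)-f(p))/t$. Kernel $g_\mu$: $\mathrm{CPA}(\Gamma)$ is the space of continuous piecewise affine functions $f:\Gamma\to\mathbb{C}$; for such $f$, $\Delta f=-\sum_{p}\big(\sum_{\vec v\in\mathrm{Vec}(p)}d_{\vec v}f(p)\big)\delta_p$. For $\zeta,y\in\Gamma$, $x\mapsto j_\zeta(x,y)$ is the unique function in $\mathrm{CPA}(\Gamma)$ with $\Delta_x j_\zeta(x,y)=\delta_y-\delta_\zeta$ and $j_\zeta(\zeta,y)=0$;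 $j_\zeta(x,y)$ is jointly continuous in $(\zeta,x,y)$ and symmetric in $x,y$. Put $j_\mu(x,y)=\int_\Gamma j_\zeta(x,y)\,d\mu(\zeta)$; the number $c_\mu=\int_\Gamma j_\mu(x,y)\,d\mu(x)$ does not depend on $y$, and $g_\mu(x,y)=j_\mu(x,y)-c_\mu$. *)

theory Defs
  imports "HOL-Analysis.Analysis" "HOL-Library.Complex_Order"
begin

section \<open>Path metrics and metrized graphs\<close>

definition path_length :: "(real \<Rightarrow> 'a::metric_space) \<Rightarrow> ennreal" where
  "path_length \<gamma> =
     (SUP ts\<in>{ts. sorted ts \<and> set ts \<subseteq> {0..1}}.
        \<Sum>i<length ts - 1. ennreal (dist (\<gamma> (ts ! i)) (\<gamma> (ts ! Suc i))))"

definition path_metric :: "'a::metric_space set \<Rightarrow> 'a \<Rightarrow> 'a \<Rightarrow> ennreal" where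
  "path_metric S x y =
     (INF \<gamma>\<in>{\<gamma>. path \<gamma> \<and> path_image \<gamma> \<subseteq> S \<and> pathstart \<gamma> = x \<and> pathfinish \<gamma> = y}.
        path_length \<gamma>)"

definition star :: "nat \<Rightarrow> real \<Rightarrow> complex set" where
  "star n r = {of_real t * cis (2 * pi * of_int k / real n) |t k. 0 \<le> t \<and> t < r}"

text \<open>A neighbourhood of \<open>p\<close> in \<open>\<Gamma>\<close> (with the subspace metric) identified with a star;
  the centre of the star corresponds to \<open>p\<close>.\<close>

definition star_chart ::
  "'a::metric_space set \<Rightarrow> 'a \<Rightarrow> nat \<Rightarrow> real \<Rightarrow> (complex \<Rightarrow> 'a) \<Rightarrow> bool" where
  "star_chart \<Gamma> p n r \<phi> \<longleftrightarrow>
     1 \<le> n \<and> 0 < r \<and> \<phi> 0 = p \<and> \<phi> ` star n r \<subseteq> \<Gamma> \<and>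
     (\<exists>e>0. ball p e \<inter> \<Gamma> \<subseteq> \<phi> ` star n r) \<and>
     (\<forall>z\<in>star n r. \<forall>w\<in>star n r. ennreal (dist (\<phi> z) (\<phi> w)) = path_metric (star n r) z w)"

definition metrized_graph :: "'a::metric_space set \<Rightarrow> bool" where
  "metrized_graph \<Gamma> \<longleftrightarrow>
     compact \<Gamma> \<and> connected \<Gamma> \<and> (\<forall>p\<in>\<Gamma>. \<exists>n r \<phi>. star_chart \<Gamma> p n r \<phi>)"


section \<open>Directional derivatives and the Laplacian\<close>

text \<open>The formal unit vectors at \<open>p\<close> are the indices of the rays in a chosen chart at \<open>p\<close>.
  Near \<open>p\<close> two charts differ only by a permutation of the rays, so sums over all unit vectors
  do not depend on the choice.\<close>

definition chosen_chart :: "'a::metric_space set \<Rightarrow> 'a \<Rightarrow> nat \<times> real \<times> (complex \<Rightarrow> 'a)" where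
  "chosen_chart \<Gamma> p = (SOME (n, r, \<phi>). star_chart \<Gamma> p n r \<phi>)"

definition valence :: "'a::metric_space set \<Rightarrow> 'a \<Rightarrow> nat" where
  "valence \<Gamma> p = fst (chosen_chart \<Gamma> p)"

definition Vec :: "'a::metric_space set \<Rightarrow> 'a \<Rightarrow> nat set" where
  "Vec \<Gamma> p = {..<valence \<Gamma> p}"

text \<open>The point \<open>p + t v\<close>, meaningful for small \<open>t \<ge> 0\<close>.\<close>

definition move :: "'a::metric_space set \<Rightarrow> 'a \<Rightarrow> nat \<Rightarrow> real \<Rightarrow> 'a" where
  "move \<Gamma> p v t =
     snd (snd (chosen_chart \<Gamma> p)) (of_real t * cis (2 * pi * real v / real (valence \<Gamma> p)))"

definition dir_deriv :: "'a::metric_space set \<Rightarrow> 'a \<Rightarrow> nat \<Rightarrow> ('a \<Rightarrow> complex) \<Rightarrow> complex" where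
  "dir_deriv \<Gamma> p v f = Lim (at_right 0) (\<lambda>t. (f (move \<Gamma> p v t) - f p) / of_real t)"

text \<open>\<open>S\<close> is isometric to a compact interval, and \<open>f\<close> is affine in the arc length parameter.\<close>

definition affine_on_segment :: "('a::metric_space \<Rightarrow> complex) \<Rightarrow> 'a set \<Rightarrow> bool" where
  "affine_on_segment f S \<longleftrightarrow>
     (\<exists>\<gamma> L a b. 0 < L \<and> S = \<gamma> ` {0..L} \<and>
        (\<forall>s\<in>{0..L}. \<forall>t\<in>{0..L}. dist (\<gamma> s) (\<gamma> t) = \<bar>s - t\<bar>) \<and>
        (\<forall>t\<in>{0..L}. f (\<gamma> t) = a + b * of_real t))"

text \<open>Functions on \<open>\<Gamma>\<close> are total functions normalised to \<open>undefined\<close> outside \<open>\<Gamma>\<close>,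
  so that a function on \<open>\<Gamma>\<close> can be unique.\<close>

definition CPA :: "'a::metric_space set \<Rightarrow> ('a \<Rightarrow> complex) set" where
  "CPA \<Gamma> = {f \<in> extensional \<Gamma>. continuous_on \<Gamma> f \<and>
     (\<exists>F. finite F \<and> \<Union>F = \<Gamma> \<and> (\<forall>S\<in>F. affine_on_segment f S))}"

text \<open>The measure \<open>\<Delta> f\<close>, as a set function. For \<open>f\<close> in \<open>CPA \<Gamma>\<close> the sum has only finitely
  many nonzero terms.\<close>

definition laplacian :: "'a::metric_space set \<Rightarrow> ('a \<Rightarrow> complex) \<Rightarrow> 'a set \<Rightarrow> complex" where
  "laplacian \<Gamma> f A = - (\<Sum>\<^sub>\<infinity>p\<in>A. \<Sum>v\<in>Vec \<Gamma> p. dir_deriv \<Gamma> p v f)"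


section \<open>Signed measures\<close>

text \<open>In this section \<open>M\<close> only serves to specify a \<open>\<sigma>\<close>-algebra.\<close>

definition signed_measure :: "'a measure \<Rightarrow> ('a set \<Rightarrow> real) \<Rightarrow> bool" where
  "signed_measure M \<mu> \<longleftrightarrow>
     \<mu> {} = 0 \<and>
     (\<forall>A. range A \<subseteq> sets M \<and> disjoint_family A \<longrightarrow> (\<lambda>n::nat. \<mu> (A n)) sums \<mu> (\<Union>n. A n))"

text \<open>The Jordan decomposition. The term \<open>ennreal (\<mu> B)\<close> is \<open>0\<close> when \<open>\<mu> B\<close> is negative,
  which does not affect the supremum because \<open>B = {}\<close> is allowed.\<close>

definition pos_variation :: "'a measure \<Rightarrow> ('a set \<Rightarrow> real) \<Rightarrow> 'a measure" where
  "pos_variation M \<mu> =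
     measure_of (space M) (sets M) (\<lambda>A. SUP B\<in>{B\<in>sets M. B \<subseteq> A}. ennreal (\<mu> B))"

definition neg_variation :: "'a measure \<Rightarrow> ('a set \<Rightarrow> real) \<Rightarrow> 'a measure" where
  "neg_variation M \<mu> = pos_variation M (\<lambda>A. - \<mu> A)"

definition total_variation :: "'a measure \<Rightarrow> ('a set \<Rightarrow> real) \<Rightarrow> 'a set \<Rightarrow> ennreal" where
  "total_variation M \<mu> A = emeasure (pos_variation M \<mu>) A + emeasure (neg_variation M \<mu>) A"

definition signed_integral :: "'a measure \<Rightarrow> ('a set \<Rightarrow> real) \<Rightarrow> ('a \<Rightarrow> complex) \<Rightarrow> complex" where
  "signed_integral M \<mu> f =
     integral\<^sup>L (pos_variation M \<mu>) f - integral\<^sup>L (neg_variation M \<mu>) f"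


section \<open>The kernels\<close>

abbreviation borel_on :: "'a::topological_space set \<Rightarrow> 'a measure" where
  "borel_on \<Gamma> \<equiv> restrict_space borel \<Gamma>"

definition j_kernel :: "'a::metric_space set \<Rightarrow> 'a \<Rightarrow> 'a \<Rightarrow> 'a \<Rightarrow> complex" where
  "j_kernel \<Gamma> \<zeta> x y =
     (THE f. f \<in> CPA \<Gamma> \<and>
        (\<forall>A\<in>sets (borel_on \<Gamma>). laplacian \<Gamma> f A = indicator A y - indicator A \<zeta>) \<and>
        f \<zeta> = 0) x"

definition j_mu :: "'a::metric_space set \<Rightarrow> ('a set \<Rightarrow> real) \<Rightarrow> 'a \<Rightarrow> 'a \<Rightarrow> complex" where
  "j_mu \<Gamma> \<mu> x y = signed_integral (borel_on \<Gamma>) \<mu> (\<lambda>\<zeta>. j_kernel \<Gamma> \<zeta> x y)"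

definition c_mu :: "'a::metric_space set \<Rightarrow> ('a set \<Rightarrow> real) \<Rightarrow> complex" where
  "c_mu \<Gamma> \<mu> = (THE c. \<forall>y\<in>\<Gamma>. signed_integral (borel_on \<Gamma>) \<mu> (\<lambda>x. j_mu \<Gamma> \<mu> x y) = c)"

definition g_mu :: "'a::metric_space set \<Rightarrow> ('a set \<Rightarrow> real) \<Rightarrow> 'a \<Rightarrow> 'a \<Rightarrow> complex" where
  "g_mu \<Gamma> \<mu> x y = j_mu \<Gamma> \<mu> x y - c_mu \<Gamma> \<mu>"

text \<open>The kernels are complex-valued by definition, although they turn out to be real.
  Inequalities between complex numbers refer to the order of \<^theory>\<open>HOL-Library.Complex_Order\<close>:
  \<open>a \<le> b\<close> means that \<open>b - a\<close> is a nonnegative real number.\<close>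

end

theory Submission
  imports Defs
begin

text \<open>
  The reason for the bound is that the energy \<open>\<integral>\<integral> g d\<nu> d\<nu>\<close> of \<open>g = g_mu \<Gamma> \<mu>\<close> is nonnegative for every
  \<open>\<nu>\<close>. For \<open>\<nu> = \<delta>(x 1) + \<dots> + \<delta>(x N)\<close> this says that the sum of \<open>g (x i) (x j)\<close> over all pairs
  is at least \<open>0\<close>. The pairs with \<open>i \<noteq> j\<close> miss only the \<open>N\<close> diagonal terms, which are at most a
  constant \<open>B\<close> each by continuity; so their sum is at least \<open>- N B\<close>, and
  \<open>B / (N - 1) \<le> 2 B / N\<close>.

  To see that the energy is nonnegative, let \<open>K\<close> be a continuous symmetric positive semidefinite
  green_kernel on \<open>\<Gamma>\<close> such that the Laplacian of \<open>K(-, y)\<close> is \<open>\<delta>\<^sub>y - \<sigma>\<close> with one measure \<open>\<sigma>\<close> for all \<open>y\<close>.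
  Comparing Laplacians and values at \<open>\<zeta>\<close> gives
  \<open>j\<^sub>\<zeta>(x, y) = K(x, y) - K(x, \<zeta>) - K(y, \<zeta>) + K(\<zeta>, \<zeta>)\<close> (\<open>j_kernel_eq_green_kernel\<close>).
  Integrating in \<open>\<zeta>\<close> and using \<open>\<mu>(\<Gamma>) = 1\<close> gives, with the potential
  \<open>potential(x) = \<integral> K(x, \<zeta>) d\<mu>(\<zeta>)\<close>, the formula
  \<open>g(x, y) = K(x, y) - potential(x) - potential(y) + \<integral> potential d\<mu>\<close> (\<open>g_mu_eq\<close>), in which the independence of \<open>c_mu\<close> from
  \<open>y\<close> is visible without an exchange of integrals. Summed over the pairs of points this is the
  energy of the signed measure \<open>\<nu> - N \<mu>\<close> with respect to \<open>K\<close>. It is nonnegative because the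
  energies of finite combinations of point masses are, and \<open>\<mu>\<close> can be approximated by such
  combinations uniformly on an equicontinuous family (\<open>energy_nonneg\<close>).

  The green_kernel \<open>K\<close> is written down explicitly. The graph is cut at a finite set \<open>V\<close> into finitely many
  edges, each isometric to an interval (\<open>edge_decomposition_exists\<close>). The Laplace matrix of
  the resulting weighted graph, plus \<open>1/|V|\<close> times the all-ones matrix, is positive definite because
  \<open>\<Gamma>\<close> is connected; let \<open>G\<close> be its inverse. Then \<open>K\<close> is the interpolation of \<open>G\<close>, affine on each edge
  in each variable, plus the covariance \<open>min s t - s t / L\<close> of a Brownian bridge whenever both points
  lie on the same edge. The first summand has the right Laplacian when \<open>y \<in> V\<close>, the second one
  corrects it for \<open>y\<close> inside an edge, and both are positive semidefinite. Here \<open>\<sigma>\<close> is the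
  uniform distribution on \<open>V\<close>.

  Directional derivatives, which are defined through an unspecified choice of charts, are avoided
  throughout: near \<open>p\<close> the point at distance \<open>s\<close> in each direction is exactly one point of the sphere
  of radius \<open>s\<close>, so the sum of the directional derivatives of a piecewise affine \<open>f\<close> at \<open>p\<close> is
  \<open>1/s\<close> times the sum of \<open>f x - f p\<close> over that sphere (\<open>outflow_eq_sphere_sum\<close>). This sum is
  computed on the edges. Uniqueness of \<open>j\<^sub>\<zeta>\<close> is the maximum principle (\<open>harmonic_constant\<close>).
\<close>

section \<open>The path metric of a star\<close>

lemma path_length_le_Lipschitz:
  assumes "0 \<le> L" and lip: "\<And>s t. s \<in> {0..1} \<Longrightarrow> t \<in> {0..1} \<Longrightarrow> dist (\<gamma> s) (\<gamma> t) \<le> L * \<bar>s - t\<bar>"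
  shows "path_length \<gamma> \<le> ennreal L"
  unfolding path_length_def
proof (rule SUP_least)
  fix ts :: "real list" assume "ts \<in> {ts. sorted ts \<and> set ts \<subseteq> {0..1}}"
  then have srt: "sorted ts" and sub: "set ts \<subseteq> {0..1}" by auto
  have mem: "ts ! i \<in> {0..1}" if "i < length ts" for i
    using sub that nth_mem by blast
  have "(\<Sum>i<length ts - 1. ennreal (dist (\<gamma> (ts ! i)) (\<gamma> (ts ! Suc i))))
      = ennreal (\<Sum>i<length ts - 1. dist (\<gamma> (ts ! i)) (\<gamma> (ts ! Suc i)))"
    by (simp add: sum_ennreal)
  also have "\<dots> \<le> ennreal L"
  proof (rule ennreal_leI)
    have "(\<Sum>i<length ts - 1. dist (\<gamma> (ts ! i)) (\<gamma> (ts ! Suc i)))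
        \<le> (\<Sum>i<length ts - 1. L * (ts ! Suc i - ts ! i))"
    proof (rule sum_mono)
      fix i assume i: "i \<in> {..<length ts - 1}"
      then have "ts ! i \<le> ts ! Suc i" using srt by (simp add: sorted_iff_nth_mono)
      moreover have "dist (\<gamma> (ts ! i)) (\<gamma> (ts ! Suc i)) \<le> L * \<bar>ts ! i - ts ! Suc i\<bar>"
        using i by (intro lip mem) auto
      ultimately show "dist (\<gamma> (ts ! i)) (\<gamma> (ts ! Suc i)) \<le> L * (ts ! Suc i - ts ! i)"
        by simp
    qed
    also have "\<dots> = L * (ts ! (length ts - 1) - ts ! 0)"
      by (simp add: sum_distrib_left[symmetric] sum_lessThan_telescope)
    also have "\<dots> \<le> L"
    proof (cases "ts = []")
      case False
      then have "ts ! (length ts - 1) - ts ! 0 \<le> 1"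
        using mem[of 0] mem[of "length ts - 1"] by auto
      then show ?thesis using \<open>0 \<le> L\<close> by (simp add: mult_left_le)
    qed (use \<open>0 \<le> L\<close> in simp)
    finally show "(\<Sum>i<length ts - 1. dist (\<gamma> (ts ! i)) (\<gamma> (ts ! Suc i))) \<le> L" .
  qed
  finally show "(\<Sum>i<length ts - 1. ennreal (dist (\<gamma> (ts ! i)) (\<gamma> (ts ! Suc i)))) \<le> ennreal L" .
qed

text \<open>Used with a time \<open>u\<close> at which the path passes the centre of a star.\<close>
lemma path_length_ge_via:
  assumes "u \<in> {0..1}"
  shows "ennreal (dist (\<gamma> 0) (\<gamma> u) + dist (\<gamma> u) (\<gamma> 1)) \<le> path_length \<gamma>"
  unfolding path_length_def
  by (rule SUP_upper2[of "[0, u, 1]"])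
     (use assms in \<open>auto simp: numeral_2_eq_2 ennreal_plus\<close>)

definition ray :: "nat \<Rightarrow> nat \<Rightarrow> real \<Rightarrow> complex" where
  "ray n v t = of_real t * cis (2 * pi * real v / real n)"

lemma norm_ray [simp]: "norm (ray n v t) = \<bar>t\<bar>"
  by (simp add: ray_def norm_mult)

lemma dist_ray_same [simp]: "dist (ray n v s) (ray n v t) = \<bar>s - t\<bar>"
  by (simp add: ray_def dist_norm left_diff_distrib[symmetric] norm_mult flip: of_real_diff)

lemma inj_on_cis_unit_roots:
  "0 < n \<Longrightarrow> inj_on (\<lambda>v. cis (2 * pi * real v / real n)) {..<n}"
  using Complex.bij_betw_roots_unity[of n] by (auto intro: bij_betw_imp_inj_on)

text \<open>The rays of a star are indexed by integers \<open>k\<close> that matter only modulo \<open>n\<close>.\<close>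
lemma star_eq_rays:
  assumes "1 \<le> n"
  shows "star n r = {ray n v t |v t. v < n \<and> 0 \<le> t \<and> t < r}"
proof (intro equalityI subsetI)
  fix z assume "z \<in> star n r"
  then obtain t k where z: "z = of_real t * cis (2 * pi * of_int k / real n)" and t: "0 \<le> t" "t < r"
    by (auto simp: star_def)
  define v where "v = nat (k mod int n)"
  have v: "v < n" "int v = k mod int n"
    using assms by (auto simp: v_def nat_less_iff)
  have "real_of_int k = real n * of_int (k div int n) + real v"
    by (metis mult_div_mod_eq of_int_add of_int_mult of_int_of_nat_eq v(2))
  then have "2 * pi * of_int k / real n = 2 * pi * real v / real n + 2 * pi * of_int (k div int n)"
    using assms by (simp add: field_simps)
  then have "cis (2 * pi * of_int k / real n) = cis (2 * pi * real v / real n)"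
    by (metis cis_mult cis_multiple_2pi Ints_of_int mult.right_neutral)
  then have "z = ray n v t" by (simp add: z ray_def)
  then show "z \<in> {ray n v t |v t. v < n \<and> 0 \<le> t \<and> t < r}" using v t by blast
next
  fix z assume "z \<in> {ray n v t |v t. v < n \<and> 0 \<le> t \<and> t < r}"
  then obtain v t where "z = ray n v t" "0 \<le> t" "t < r" by blast
  then show "z \<in> star n r"
    unfolding star_def ray_def by (smt (verit, best) mem_Collect_eq of_int_of_nat_eq)
qed

lemma star_cases:
  assumes "1 \<le> n" "z \<in> star n r"
  obtains v t where "z = ray n v t" "v < n" "0 \<le> t" "t < r"
  using assms star_eq_rays[of n r] by auto

text \<open>Away from the centre the direction \<open>sgn z\<close> takes only finitely many values on the star, so
  it is constant along a path that avoids the centre.\<close>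
lemma path_between_rays_through_centre:
  assumes "1 \<le> n" "v < n" "w < n" "v \<noteq> w" "0 < s" "0 < t"
    and "path \<gamma>" "path_image \<gamma> \<subseteq> star n r" "pathstart \<gamma> = ray n v s" "pathfinish \<gamma> = ray n w t"
  shows "0 \<in> path_image \<gamma>"
proof (rule ccontr)
  assume n0: "0 \<notin> path_image \<gamma>"
  let ?R = "(\<lambda>v. cis (2 * pi * real v / real n)) ` {..<n}"
  have sgn_ray: "sgn (ray n u q) = cis (2 * pi * real u / real n)" if "0 < q" for u q
    using that by (simp add: ray_def sgn_mult sgn_of_real)
  have "sgn z \<in> ?R" if zin: "z \<in> path_image \<gamma>" for z
  proof -
    obtain u q where z: "z = ray n u q" "u < n" "0 \<le> q"
      using star_cases[OF assms(1) subsetD[OF assms(8) zin]] by blast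
    moreover have "q \<noteq> 0" using n0 zin z by (auto simp: ray_def)
    ultimately show ?thesis using sgn_ray[of q u] by auto
  qed
  then have "finite (sgn ` path_image \<gamma>)"
    by (meson finite_imageI finite_lessThan finite_subset image_subsetI)
  moreover have "connected (sgn ` path_image \<gamma>)"
    using n0 by (intro connected_continuous_image connected_path_image assms)
      (auto simp: sgn_div_norm intro!: continuous_intros)
  ultimately obtain c where "sgn ` path_image \<gamma> \<subseteq> {c}"
    by (metis connected_finite_iff_sing subset_refl empty_subsetI)
  then have "sgn (pathstart \<gamma>) = sgn (pathfinish \<gamma>)"
    by blast
  then have "cis (2 * pi * real v / real n) = cis (2 * pi * real w / real n)"
    using assms sgn_ray by simp
  then show False
    using inj_on_cis_unit_roots[of n] assms by (auto simp: inj_on_def)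
qed

text \<open>The metric of a chart in polar coordinates. The upper bound comes from paths of constant speed.
  For the lower bound a path between different rays is cut at the centre.\<close>
lemma path_metric_star:
  assumes n: "1 \<le> n" and v: "v < n" and w: "w < n" and s: "0 \<le> s" "s < r" and t: "0 \<le> t" "t < r"
  shows "path_metric (star n r) (ray n v s) (ray n w t) = ennreal (if v = w then \<bar>s - t\<bar> else s + t)"
proof (rule antisym)
  let ?d = "if v = w then \<bar>s - t\<bar> else s + t"
  \<comment> \<open>for different rays, the path of constant speed that reaches the centre when \<open>x (s + t) = s\<close>\<close>
  define \<gamma> where "\<gamma> = (\<lambda>x. if v = w then ray n v (s + x * (t - s))
      else ray n v (max 0 (s - x * (s + t))) + ray n w (max 0 (x * (s + t) - s)))"
  have "path_metric (star n r) (ray n v s) (ray n w t) \<le> path_length \<gamma>"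
    unfolding path_metric_def
  proof (rule INF_lower, clarsimp, intro conjI)
    show "path \<gamma>" unfolding path_def \<gamma>_def ray_def
      by (cases "v = w") (auto intro!: continuous_intros)
    show "path_image \<gamma> \<subseteq> star n r"
    proof (clarsimp simp: path_image_def)
      fix x :: real assume x: "0 \<le> x" "x \<le> 1"
      consider "v = w" | "v \<noteq> w" "x * (s + t) \<le> s" | "v \<noteq> w" "x * (s + t) \<ge> s" by linarith
      then have "\<exists>u q. \<gamma> x = ray n u q \<and> u < n \<and> 0 \<le> q \<and> q < r"
      proof cases
        case 1
        have "s + x * (t - s) = (1 - x) * s + x * t" by (simp add: algebra_simps)
        moreover have "(1 - x) * s + x * t \<ge> 0" using x s t by simp
        moreover have "(1 - x) * s + x * t < r"
          using x s t by (intro convex_bound_lt) auto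
        ultimately show ?thesis using 1 v unfolding \<gamma>_def by auto
      next
        case 2
        then have "\<gamma> x = ray n v (s - x * (s + t))" by (simp add: \<gamma>_def ray_def)
        moreover have "s - x * (s + t) \<le> s" using x s t by simp
        ultimately show ?thesis using 2 s v by fastforce
      next
        case 3
        then have "\<gamma> x = ray n w (x * (s + t) - s)" by (simp add: \<gamma>_def ray_def)
        moreover have "x * (s + t) - s \<le> t" using x s t mult_right_mono[of x 1 "s + t"] by simp
        ultimately show ?thesis using 3 t w by fastforce
      qed
      then show "\<gamma> x \<in> star n r" using star_eq_rays[OF n] by blast
    qed
    show "pathstart \<gamma> = ray n v s" "pathfinish \<gamma> = ray n w t"
      using s t by (auto simp: pathstart_def pathfinish_def \<gamma>_def ray_def)
  qed
  also have "\<dots> \<le> ennreal ?d"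
  proof (rule path_length_le_Lipschitz)
    show "0 \<le> ?d" using s t by auto
    fix x y :: real
    show "dist (\<gamma> x) (\<gamma> y) \<le> ?d * \<bar>x - y\<bar>"
    proof (cases "v = w")
      case True
      have "dist (\<gamma> x) (\<gamma> y) = \<bar>(x - y) * (t - s)\<bar>"
        using True by (simp add: \<gamma>_def algebra_simps)
      then show ?thesis using True by (simp add: abs_mult abs_minus_commute mult.commute)
    next
      case False
      have "dist (\<gamma> x) (\<gamma> y) \<le> \<bar>max 0 (s - x * (s + t)) - max 0 (s - y * (s + t))\<bar>
          + \<bar>max 0 (x * (s + t) - s) - max 0 (y * (s + t) - s)\<bar>"
        using False dist_triangle_add[of "ray n v (max 0 (s - x * (s + t)))" "ray n w (max 0 (x * (s + t) - s))"
            "ray n v (max 0 (s - y * (s + t)))" "ray n w (max 0 (y * (s + t) - s))"]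
        unfolding \<gamma>_def by (simp only: if_False dist_ray_same)
      also have "\<dots> = \<bar>x * (s + t) - y * (s + t)\<bar>" by linarith
      also have "\<dots> = (s + t) * \<bar>x - y\<bar>"
        using s t by (simp add: left_diff_distrib[symmetric] abs_mult mult.commute)
      finally show ?thesis using False by simp
    qed
  qed
  finally show "path_metric (star n r) (ray n v s) (ray n w t) \<le> ennreal ?d" .
next
  let ?d = "if v = w then \<bar>s - t\<bar> else s + t"
  show "ennreal ?d \<le> path_metric (star n r) (ray n v s) (ray n w t)"
    unfolding path_metric_def
  proof (rule INF_greatest, clarsimp)
    fix \<gamma> assume \<gamma>: "path \<gamma>" "path_image \<gamma> \<subseteq> star n r" "pathstart \<gamma> = ray n v s" "pathfinish \<gamma> = ray n w t"
    have "\<exists>u\<in>{0..1}. ?d \<le> dist (\<gamma> 0) (\<gamma> u) + dist (\<gamma> u) (\<gamma> 1)"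
    proof (cases "v = w \<or> s = 0 \<or> t = 0")
      case True
      have "?d \<le> dist (\<gamma> 0) (\<gamma> 1)"
      proof (cases "v = w")
        case False
        then have "s = 0 \<or> t = 0" using True by simp
        then show ?thesis
          using \<gamma> s t False norm_ray[of n v s] norm_ray[of n w t]
          by (auto simp: pathstart_def pathfinish_def dist_norm ray_def norm_mult)
      qed (use \<gamma> in \<open>simp add: pathstart_def pathfinish_def\<close>)
      then show ?thesis by (intro bexI[of _ 0]) auto
    next
      case False
      then have "0 \<in> path_image \<gamma>"
        using n v w s t \<gamma> by (intro path_between_rays_through_centre[of n v w s t \<gamma> r]) auto
      then obtain u where u: "u \<in> {0..1}" "\<gamma> u = 0" by (auto simp: path_image_def)
      have "dist (\<gamma> 0) (\<gamma> u) = s" "dist (\<gamma> u) (\<gamma> 1) = t"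
        using \<gamma> u s t by (auto simp: pathstart_def pathfinish_def)
      then show ?thesis using u False by (intro bexI[of _ u]) auto
    qed
    then obtain u where u: "u \<in> {0..1}" "?d \<le> dist (\<gamma> 0) (\<gamma> u) + dist (\<gamma> u) (\<gamma> 1)" by blast
    have "ennreal ?d \<le> path_length \<gamma>"
      using path_length_ge_via[OF u(1), of \<gamma>] ennreal_leI[OF u(2)] by (rule order_trans[rotated])
    then show "(v = w \<longrightarrow> ennreal \<bar>s - t\<bar> \<le> path_length \<gamma>) \<and> (v \<noteq> w \<longrightarrow> ennreal (s + t) \<le> path_length \<gamma>)"
      by auto
  qed
qed

section \<open>Rays and outflow at a point\<close>

text \<open>The content of a chart at \<open>p\<close>, with the radius shrunk so that the rays fill a whole ball of
  \<open>\<Gamma>\<close>. A chart itself may be larger than its neighbourhood of \<open>p\<close>: one of its rays can run through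
  a branch point of \<open>\<Gamma>\<close> far from \<open>p\<close>.\<close>
definition star_radius :: "'a::metric_space set \<Rightarrow> 'a \<Rightarrow> real \<Rightarrow> bool" where
  "star_radius \<Gamma> p \<rho> \<longleftrightarrow> 0 < \<rho> \<and> 1 \<le> valence \<Gamma> p \<and>
     (\<forall>v<valence \<Gamma> p. move \<Gamma> p v 0 = p) \<and>
     (\<forall>v<valence \<Gamma> p. \<forall>t\<in>{0..<\<rho>}. move \<Gamma> p v t \<in> \<Gamma>) \<and>
     (\<forall>v<valence \<Gamma> p. \<forall>w<valence \<Gamma> p. \<forall>s\<in>{0..<\<rho>}. \<forall>t\<in>{0..<\<rho>}.
        dist (move \<Gamma> p v s) (move \<Gamma> p w t) = (if v = w then \<bar>s - t\<bar> else s + t)) \<and>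
     (\<forall>x\<in>\<Gamma>. dist p x < \<rho> \<longrightarrow> (\<exists>v<valence \<Gamma> p. x = move \<Gamma> p v (dist p x)))"

lemma star_radius_exists:
  assumes "metrized_graph \<Gamma>" "p \<in> \<Gamma>"
  shows "\<exists>\<rho>. star_radius \<Gamma> p \<rho>"
proof -
  obtain n r \<phi> where c: "chosen_chart \<Gamma> p = (n, r, \<phi>)" by (metis prod_cases3)
  have "\<exists>z. case z of (n, r, \<phi>) \<Rightarrow> star_chart \<Gamma> p n r \<phi>"
    using assms unfolding metrized_graph_def by blast
  then have "case chosen_chart \<Gamma> p of (n, r, \<phi>) \<Rightarrow> star_chart \<Gamma> p n r \<phi>"
    unfolding chosen_chart_def by (rule someI_ex)
  then have ch: "star_chart \<Gamma> p n r \<phi>" by (simp add: c)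
  have val: "valence \<Gamma> p = n" and mv: "move \<Gamma> p v t = \<phi> (ray n v t)" for v t
    by (simp_all add: valence_def move_def c ray_def)
  have n: "1 \<le> n" and r: "0 < r" and \<phi>0: "\<phi> 0 = p" and im: "\<phi> ` star n r \<subseteq> \<Gamma>"
    using ch unfolding star_chart_def by auto
  obtain e where e: "0 < e" "ball p e \<inter> \<Gamma> \<subseteq> \<phi> ` star n r"
    using ch unfolding star_chart_def by auto
  have iso: "dist (\<phi> z) (\<phi> w) = d" if "z \<in> star n r" "w \<in> star n r"
    "path_metric (star n r) z w = ennreal d" "0 \<le> d" for z w d
    using ch that unfolding star_chart_def by (metis ennreal_inj zero_le_dist)
  have mem: "ray n v t \<in> star n r" if "v < n" "0 \<le> t" "t < r" for v t
    using that star_eq_rays[OF n] by blast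
  have d: "dist (\<phi> (ray n v s)) (\<phi> (ray n w t)) = (if v = w then \<bar>s - t\<bar> else s + t)"
    if "v < n" "w < n" "0 \<le> s" "s < r" "0 \<le> t" "t < r" for v w s t
    using that n by (intro iso mem path_metric_star) auto
  have r0: "ray n v 0 = 0" for v by (simp add: ray_def)
  have "star_radius \<Gamma> p (min e r)"
    unfolding star_radius_def val mv
  proof (intro conjI allI impI ballI)
    fix x assume x: "x \<in> \<Gamma>" "dist p x < min e r"
    then have "x \<in> \<phi> ` star n r" using e by auto
    then obtain v t where vt: "x = \<phi> (ray n v t)" "v < n" "0 \<le> t" "t < r"
      by (auto elim!: star_cases[OF n])
    then have "dist p x = t" using d[of v v 0 t] r by (simp add: r0 \<phi>0)
    then show "\<exists>v<n. x = \<phi> (ray n v (dist p x))" using vt by blast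
  next
    fix v t assume "v < n" "t \<in> {0..<min e r}"
    then have "ray n v t \<in> star n r" by (intro mem) auto
    then show "\<phi> (ray n v t) \<in> \<Gamma>" using im by auto
  qed (use e r n d in \<open>auto simp: r0 \<phi>0\<close>)
  then show ?thesis by blast
qed

lemma star_radius_mono:
  assumes "star_radius \<Gamma> p \<rho>" "0 < \<epsilon>" "\<epsilon> \<le> \<rho>"
  shows "star_radius \<Gamma> p \<epsilon>"
  using assms unfolding star_radius_def by (auto 4 4)

lemma dist_move:
  assumes "star_radius \<Gamma> p \<rho>" "v < valence \<Gamma> p" "w < valence \<Gamma> p" "s \<in> {0..<\<rho>}" "t \<in> {0..<\<rho>}"
  shows "dist (move \<Gamma> p v s) (move \<Gamma> p w t) = (if v = w then \<bar>s - t\<bar> else s + t)"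
  using assms unfolding star_radius_def by blast

lemma move_0: "star_radius \<Gamma> p \<rho> \<Longrightarrow> v < valence \<Gamma> p \<Longrightarrow> move \<Gamma> p v 0 = p"
  unfolding star_radius_def by blast

lemma move_in: "star_radius \<Gamma> p \<rho> \<Longrightarrow> v < valence \<Gamma> p \<Longrightarrow> t \<in> {0..<\<rho>} \<Longrightarrow> move \<Gamma> p v t \<in> \<Gamma>"
  unfolding star_radius_def by blast

lemma dist_centre_move:
  assumes "star_radius \<Gamma> p \<rho>" "v < valence \<Gamma> p" "t \<in> {0..<\<rho>}"
  shows "dist p (move \<Gamma> p v t) = t"
  using dist_move[OF assms(1,2,2) _ assms(3), of 0] move_0[OF assms(1,2)] assms(3) by simp

lemma near_move:
  assumes "star_radius \<Gamma> p \<rho>" "x \<in> \<Gamma>" "dist p x < \<rho>"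
  obtains v where "v < valence \<Gamma> p" "x = move \<Gamma> p v (dist p x)"
  using assms unfolding star_radius_def by blast

text \<open>The dictionary between unit vectors at \<open>p\<close> and points of \<open>\<Gamma>\<close> near \<open>p\<close>.\<close>
lemma move_bij_sphere:
  assumes "star_radius \<Gamma> p \<rho>" "0 < s" "s < \<rho>"
  shows "bij_betw (\<lambda>v. move \<Gamma> p v s) {..<valence \<Gamma> p} {x \<in> \<Gamma>. dist p x = s}"
  unfolding bij_betw_def
proof
  have s: "s \<in> {0..<\<rho>}" using assms by simp
  show "inj_on (\<lambda>v. move \<Gamma> p v s) {..<valence \<Gamma> p}"
  proof (rule inj_onI)
    fix v w assume "v \<in> {..<valence \<Gamma> p}" "w \<in> {..<valence \<Gamma> p}" "move \<Gamma> p v s = move \<Gamma> p w s"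
    then show "v = w" using dist_move[OF assms(1) _ _ s s, of v w] \<open>0 < s\<close> by (auto split: if_splits)
  qed
  show "(\<lambda>v. move \<Gamma> p v s) ` {..<valence \<Gamma> p} = {x \<in> \<Gamma>. dist p x = s}"
    using move_in[OF assms(1) _ s] dist_centre_move[OF assms(1) _ s] near_move[OF assms(1)] assms
    by (auto simp: image_iff) (metis lessThan_iff)
qed

definition affine_germ :: "'a::metric_space set \<Rightarrow> 'a \<Rightarrow> ('a \<Rightarrow> complex) \<Rightarrow> real \<Rightarrow> (nat \<Rightarrow> complex) \<Rightarrow> bool" where
  "affine_germ \<Gamma> p f \<epsilon> b \<longleftrightarrow> star_radius \<Gamma> p \<epsilon> \<and>
     (\<forall>v<valence \<Gamma> p. \<forall>t\<in>{0..<\<epsilon>}. f (move \<Gamma> p v t) = f p + b v * of_real t)"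

lemma affine_on_segment_compact: "affine_on_segment f S \<Longrightarrow> compact S"
proof -
  assume "affine_on_segment f S"
  then obtain \<gamma> L where S: "S = \<gamma> ` {0..L}"
    and iso: "\<And>s t. s \<in> {0..L} \<Longrightarrow> t \<in> {0..L} \<Longrightarrow> dist (\<gamma> s) (\<gamma> t) = \<bar>s - t\<bar>"
    unfolding affine_on_segment_def by metis
  have "continuous_on {0..L} \<gamma>"
    unfolding continuous_on_iff by (metis iso dist_real_def)
  then show "compact S" unfolding S by (intro compact_continuous_image) auto
qed

text \<open>The segments on which \<open>f\<close> is affine may overlap, and they are positioned arbitrarily with
  respect to the rays at \<open>p\<close>. If a segment contains \<open>p\<close> and \<open>x\<close>, then \<open>f x - f p\<close> is plus or
  minus the slope times \<open>dist p x\<close>. So along a ray the difference quotient takes finitely many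
  values, and being continuous it is constant.\<close>
lemma CPA_affine_germ:
  assumes "metrized_graph \<Gamma>" and f: "f \<in> CPA \<Gamma>" and p: "p \<in> \<Gamma>"
  obtains \<epsilon> b where "affine_germ \<Gamma> p f \<epsilon> b"
proof -
  obtain \<rho> where \<rho>: "star_radius \<Gamma> p \<rho>" using star_radius_exists assms by blast
  obtain F where F: "finite F" "\<Union>F = \<Gamma>" "\<And>S. S \<in> F \<Longrightarrow> affine_on_segment f S"
    and cont: "continuous_on \<Gamma> f"
    using f unfolding CPA_def by blast
  \<comment> \<open>segments that miss \<open>p\<close> stay at a positive distance from it\<close>
  define F' where "F' = {S\<in>F. p \<notin> S}"
  have "closed (\<Union>F')"
    using F affine_on_segment_compact compact_imp_closed unfolding F'_def by (intro closed_Union) auto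
  then obtain \<delta> where \<delta>: "0 < \<delta>" "ball p \<delta> \<inter> \<Union>F' = {}"
    by (metis (no_types, lifting) F'_def mem_Collect_eq Union_iff ComplI open_Compl open_contains_ball
        disjoint_eq_subset_Compl)
  have "\<exists>b. \<forall>x\<in>S. f x - f p = b * of_real (dist p x) \<or> f x - f p = - b * of_real (dist p x)"
    if S: "S \<in> F" "p \<in> S" for S
  proof -
    obtain \<gamma> L a b where \<gamma>: "S = \<gamma> ` {0..L}"
      "\<And>s t. s \<in> {0..L} \<Longrightarrow> t \<in> {0..L} \<Longrightarrow> dist (\<gamma> s) (\<gamma> t) = \<bar>s - t\<bar>"
      "\<And>t. t \<in> {0..L} \<Longrightarrow> f (\<gamma> t) = a + b * of_real t"
      using F(3)[OF S(1)] unfolding affine_on_segment_def by metis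
    then obtain \<tau> where \<tau>: "\<tau> \<in> {0..L}" "p = \<gamma> \<tau>" using S by auto
    have "f x - f p = b * of_real (dist p x) \<or> f x - f p = - b * of_real (dist p x)" if "x \<in> S" for x
    proof -
      obtain t where t: "t \<in> {0..L}" "x = \<gamma> t" using \<gamma>(1) \<open>x \<in> S\<close> by blast
      have "f x - f p = b * of_real (t - \<tau>)" using \<gamma>(3) t \<tau> by (simp add: algebra_simps)
      moreover have "dist p x = \<bar>\<tau> - t\<bar>" using \<gamma>(2) t \<tau> by simp
      ultimately show ?thesis by (cases "\<tau> \<le> t") (auto simp: algebra_simps)
    qed
    then show ?thesis by blast
  qed
  then obtain B where B: "\<And>S x. S \<in> F \<Longrightarrow> p \<in> S \<Longrightarrow> x \<in> S \<Longrightarrow>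
      f x - f p = B S * of_real (dist p x) \<or> f x - f p = - B S * of_real (dist p x)"
    by metis
  define \<epsilon> where "\<epsilon> = min \<rho> \<delta>"
  have \<epsilon>: "0 < \<epsilon>" "\<epsilon> \<le> \<rho>" "\<epsilon> \<le> \<delta>" using \<rho> \<delta> by (auto simp: \<epsilon>_def star_radius_def)
  have \<rho>\<epsilon>: "star_radius \<Gamma> p \<epsilon>" by (rule star_radius_mono[OF \<rho> \<epsilon>(1,2)])
  have "\<exists>b. \<forall>t\<in>{0..<\<epsilon>}. f (move \<Gamma> p v t) = f p + b * of_real t" if v: "v < valence \<Gamma> p" for v
  proof -
    define q where "q t = (f (move \<Gamma> p v t) - f p) / of_real t" for t
    have cm: "continuous_on {0<..<\<epsilon>} (move \<Gamma> p v)"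
      unfolding continuous_on_iff using dist_move[OF \<rho>\<epsilon> v v]
      by (metis atLeastLessThan_iff dist_real_def greaterThanLessThan_iff less_eq_real_def)
    have "continuous_on {0<..<\<epsilon>} q"
      unfolding q_def using move_in[OF \<rho>\<epsilon> v]
      by (intro continuous_intros continuous_on_compose2[OF cont cm]) auto
    moreover have "q ` {0<..<\<epsilon>} \<subseteq> B ` F \<union> (\<lambda>S. - B S) ` F"
    proof (clarify, rule ccontr)
      fix t assume t: "t \<in> {0<..<\<epsilon>}" and n: "q t \<notin> (\<lambda>S. - B S) ` F" "q t \<notin> B ` F"
      have d: "dist p (move \<Gamma> p v t) = t" using dist_centre_move[OF \<rho>\<epsilon> v] t by simp
      have "move \<Gamma> p v t \<in> \<Gamma>" using move_in[OF \<rho>\<epsilon> v] t by simp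
      then obtain S where S: "S \<in> F" "move \<Gamma> p v t \<in> S" using F by blast
      have "move \<Gamma> p v t \<in> ball p \<delta>" using d t \<epsilon> by simp
      then have "p \<in> S" using S \<delta>(2) unfolding F'_def by blast
      from B[OF S(1) this S(2)] have "q t = B S \<or> q t = - B S"
        unfolding d q_def using t by (auto simp: field_simps)
      then show False using n S by blast
    qed
    ultimately have "q constant_on {0<..<\<epsilon>}"
      using F(1) by (intro continuous_finite_range_constant)
        (auto intro: finite_subset)
    then obtain b where b: "\<And>t. t \<in> {0<..<\<epsilon>} \<Longrightarrow> q t = b" unfolding constant_on_def by blast
    have "f (move \<Gamma> p v t) = f p + b * of_real t" if "t \<in> {0..<\<epsilon>}" for t
      using b[of t] that move_0[OF \<rho> v] by (cases "t = 0") (auto simp: q_def field_simps)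
    then show ?thesis by blast
  qed
  then obtain b where "\<And>v t. v < valence \<Gamma> p \<Longrightarrow> t \<in> {0..<\<epsilon>} \<Longrightarrow> f (move \<Gamma> p v t) = f p + b v * of_real t"
    by metis
  then show ?thesis using that \<rho>\<epsilon> unfolding affine_germ_def by blast
qed

definition outflow :: "'a::metric_space set \<Rightarrow> ('a \<Rightarrow> complex) \<Rightarrow> 'a \<Rightarrow> complex" where
  "outflow \<Gamma> f p = (\<Sum>v\<in>Vec \<Gamma> p. dir_deriv \<Gamma> p v f)"

lemma outflow_affine_germ:
  assumes "affine_germ \<Gamma> p f \<epsilon> b"
  shows "outflow \<Gamma> f p = (\<Sum>v<valence \<Gamma> p. b v)"
proof -
  have \<epsilon>: "0 < \<epsilon>" using assms by (auto simp: affine_germ_def star_radius_def)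
  have "dir_deriv \<Gamma> p v f = b v" if v: "v < valence \<Gamma> p" for v
    unfolding dir_deriv_def
  proof (rule tendsto_Lim)
    have "\<forall>\<^sub>F t in at_right 0. (f (move \<Gamma> p v t) - f p) / of_real t = b v"
      using eventually_at_right_less[of "0::real"] eventually_at_right_real[OF \<epsilon>]
      by eventually_elim (use assms v in \<open>auto simp: affine_germ_def\<close>)
    then show "((\<lambda>t. (f (move \<Gamma> p v t) - f p) / of_real t) \<longlongrightarrow> b v) (at_right 0)"
      by (rule tendsto_eventually)
  qed simp
  then show ?thesis unfolding outflow_def Vec_def by simp
qed

text \<open>Frees the Laplacian from charts: only the metric of \<open>\<Gamma>\<close> enters on the right.\<close>
lemma outflow_eq_sphere_sum:
  assumes "affine_germ \<Gamma> p f \<epsilon> b" "0 < s" "s < \<epsilon>"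
  shows "of_real s * outflow \<Gamma> f p = (\<Sum>x | x \<in> \<Gamma> \<and> dist p x = s. f x - f p)"
proof -
  have "(\<Sum>x | x \<in> \<Gamma> \<and> dist p x = s. f x - f p) = (\<Sum>v<valence \<Gamma> p. f (move \<Gamma> p v s) - f p)"
    using assms by (intro sum.reindex_bij_betw[symmetric] move_bij_sphere) (auto simp: affine_germ_def)
  also have "\<dots> = (\<Sum>v<valence \<Gamma> p. of_real s * b v)"
    using assms by (intro sum.cong) (auto simp: affine_germ_def)
  finally show ?thesis
    unfolding outflow_affine_germ[OF assms(1)] by (simp add: sum_distrib_left)
qed

text \<open>Maximum principle: at a point where \<open>h\<close> is maximal all outgoing slopes are at most \<open>0\<close>, and
  they add up to \<open>0\<close>, so \<open>h\<close> is constant nearby. Hence the set of maximal points is open and closed.\<close>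
lemma harmonic_constant:
  fixes h :: "'a::metric_space \<Rightarrow> real"
  assumes \<Gamma>: "compact \<Gamma>" "connected \<Gamma>" and h: "continuous_on \<Gamma> h"
    and harm: "\<And>p. p \<in> \<Gamma> \<Longrightarrow> \<exists>\<epsilon> b. star_radius \<Gamma> p \<epsilon> \<and> (\<Sum>v<valence \<Gamma> p. b v) = 0 \<and>
      (\<forall>v<valence \<Gamma> p. \<forall>t\<in>{0..<\<epsilon>}. h (move \<Gamma> p v t) = h p + b v * t)"
    and xy: "x \<in> \<Gamma>" "y \<in> \<Gamma>"
  shows "h x = h y"
proof -
  obtain m where m: "m \<in> \<Gamma>" "\<And>x. x \<in> \<Gamma> \<Longrightarrow> h x \<le> h m"
    using continuous_attains_sup[OF \<Gamma>(1) _ h] xy by blast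
  define M where "M = {x\<in>\<Gamma>. h x = h m}"
  have "closedin (top_of_set \<Gamma>) M"
    using continuous_closedin_preimage_constant[OF h] unfolding M_def .
  moreover have "openin (top_of_set \<Gamma>) M"
    unfolding openin_contains_ball
  proof (intro conjI ballI)
    show "M \<subseteq> \<Gamma>" by (auto simp: M_def)
    fix p assume "p \<in> M"
    then have p: "p \<in> \<Gamma>" "h p = h m" by (auto simp: M_def)
    obtain \<epsilon> b where \<epsilon>: "star_radius \<Gamma> p \<epsilon>" and b0: "(\<Sum>v<valence \<Gamma> p. b v) = 0"
      and b: "\<And>v t. v < valence \<Gamma> p \<Longrightarrow> t \<in> {0..<\<epsilon>} \<Longrightarrow> h (move \<Gamma> p v t) = h p + b v * t"
      using harm[OF p(1)] by blast
    have \<epsilon>0: "0 < \<epsilon>" using \<epsilon> by (simp add: star_radius_def)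
    have "b v \<le> 0" if "v < valence \<Gamma> p" for v
    proof -
      have "h p + b v * (\<epsilon>/2) \<le> h p"
        using b[OF that, of "\<epsilon>/2"] m(2)[OF move_in[OF \<epsilon> that, of "\<epsilon>/2"]] \<epsilon>0 p by simp
      then show ?thesis using \<epsilon>0 by (simp add: mult_le_0_iff)
    qed
    then have bz: "b v = 0" if "v < valence \<Gamma> p" for v
      using b0 that sum_nonneg_eq_0_iff[of "{..<valence \<Gamma> p}" "\<lambda>v. - b v"]
      by (simp add: sum_negf)
    have "ball p \<epsilon> \<inter> \<Gamma> \<subseteq> M"
    proof
      fix x assume x: "x \<in> ball p \<epsilon> \<inter> \<Gamma>"
      then obtain v where v: "v < valence \<Gamma> p" "x = move \<Gamma> p v (dist p x)"
        using near_move[OF \<epsilon>, of x] by auto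
      have "h x = h p" using b[OF v(1), of "dist p x"] v(2)[symmetric] bz[OF v(1)] x by simp
      then show "x \<in> M" using x p by (simp add: M_def)
    qed
    then show "\<exists>e>0. ball p e \<inter> \<Gamma> \<subseteq> M" using \<epsilon>0 by blast
  qed
  moreover have "M \<noteq> {}" using m by (auto simp: M_def)
  ultimately have "M = \<Gamma>" using \<Gamma>(2) unfolding connected_clopen by blast
  then have "x \<in> M" "y \<in> M" using xy by auto
  then show ?thesis by (simp add: M_def)
qed

text \<open>The maximum principle is applied to the real and the imaginary part of \<open>f - g\<close>. Since \<open>f\<close>
  and \<open>g\<close> may be affine on unrelated families of segments, only their germs are subtracted.\<close>
lemma CPA_eqI:
  assumes \<Gamma>: "metrized_graph \<Gamma>" and f: "f \<in> CPA \<Gamma>" and g: "g \<in> CPA \<Gamma>"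
    and eq: "\<And>p. p \<in> \<Gamma> \<Longrightarrow> outflow \<Gamma> f p = outflow \<Gamma> g p"
    and \<zeta>: "\<zeta> \<in> \<Gamma>" "f \<zeta> = g \<zeta>"
  shows "f = g"
proof (rule extensionalityI)
  show "f \<in> extensional \<Gamma>" "g \<in> extensional \<Gamma>" using f g by (auto simp: CPA_def)
  fix x assume x: "x \<in> \<Gamma>"
  have cont: "continuous_on \<Gamma> f" "continuous_on \<Gamma> g" using f g by (auto simp: CPA_def)
  \<comment> \<open>\<open>c = 1\<close> gives the real part and \<open>c = - \<i>\<close> the imaginary part\<close>
  have part: "Re (c * (f x - g x)) = 0" for c
  proof -
    have "Re (c * (f x - g x)) = Re (c * (f \<zeta> - g \<zeta>))"
    proof (rule harmonic_constant[where \<Gamma> = \<Gamma> and h = "\<lambda>x. Re (c * (f x - g x))"])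
      show "compact \<Gamma>" "connected \<Gamma>" using \<Gamma> by (auto simp: metrized_graph_def)
      show "continuous_on \<Gamma> (\<lambda>x. Re (c * (f x - g x)))" by (intro continuous_intros cont)
      fix p assume p: "p \<in> \<Gamma>"
      obtain \<epsilon>1 b1 where 1: "affine_germ \<Gamma> p f \<epsilon>1 b1" using CPA_affine_germ[OF \<Gamma> f p] .
      obtain \<epsilon>2 b2 where 2: "affine_germ \<Gamma> p g \<epsilon>2 b2" using CPA_affine_germ[OF \<Gamma> g p] .
      let ?b = "\<lambda>v. Re (c * (b1 v - b2 v))"
      have sr: "star_radius \<Gamma> p (min \<epsilon>1 \<epsilon>2)"
        using 1 2 by (auto simp: affine_germ_def min_def)
      have "(\<Sum>v<valence \<Gamma> p. ?b v) = Re (c * ((\<Sum>v<valence \<Gamma> p. b1 v) - (\<Sum>v<valence \<Gamma> p. b2 v)))"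
        by (simp add: sum_subtractf Re_sum sum_distrib_left right_diff_distrib)
      then have b0: "(\<Sum>v<valence \<Gamma> p. ?b v) = 0"
        using eq[OF p] unfolding outflow_affine_germ[OF 1] outflow_affine_germ[OF 2] by simp
      have "Re (c * (f (move \<Gamma> p v t) - g (move \<Gamma> p v t))) = Re (c * (f p - g p)) + ?b v * t"
        if "v < valence \<Gamma> p" "t \<in> {0..<min \<epsilon>1 \<epsilon>2}" for v t
      proof -
        have "c * (f (move \<Gamma> p v t) - g (move \<Gamma> p v t)) = c * (f p - g p) + (c * (b1 v - b2 v)) * of_real t"
          using 1 2 that by (simp add: affine_germ_def algebra_simps)
        then show ?thesis by simp
      qed
      with sr b0 show "\<exists>\<epsilon> b. star_radius \<Gamma> p \<epsilon> \<and> (\<Sum>v<valence \<Gamma> p. b v) = 0 \<and>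
        (\<forall>v<valence \<Gamma> p. \<forall>t\<in>{0..<\<epsilon>}. Re (c * (f (move \<Gamma> p v t) - g (move \<Gamma> p v t)))
            = Re (c * (f p - g p)) + b v * t)"
        by blast
    qed (use x \<zeta> in auto)
    then show ?thesis using \<zeta> by simp
  qed
  show "f x = g x" using part[of 1] part[of "-\<i>"] by (simp add: complex_eq_iff)
qed

text \<open>Equality of the measures is tested on single points in one direction; in the other one the sum
  that defines the Laplacian has at most two nonzero terms.\<close>
lemma laplacian_eq_outflow:
  assumes "y \<in> \<Gamma>" "\<zeta> \<in> \<Gamma>"
  shows "(\<forall>A\<in>sets (borel_on \<Gamma>). laplacian \<Gamma> f A = indicator A y - indicator A \<zeta>) \<longleftrightarrow>
    (\<forall>p\<in>\<Gamma>. outflow \<Gamma> f p = of_bool (p = \<zeta>) - of_bool (p = y))"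
proof (intro iffI ballI)
  fix p assume L: "\<forall>A\<in>sets (borel_on \<Gamma>). laplacian \<Gamma> f A = indicator A y - indicator A \<zeta>" and p: "p \<in> \<Gamma>"
  have "{p} \<in> sets (borel_on \<Gamma>)" using p by (auto simp: sets_restrict_space image_iff intro!: bexI[of _ "{p}"])
  with L have "laplacian \<Gamma> f {p} = indicator {p} y - indicator {p} \<zeta>" by blast
  then show "outflow \<Gamma> f p = of_bool (p = \<zeta>) - of_bool (p = y)"
    unfolding laplacian_def outflow_def[symmetric]
    by (auto simp: indicator_def algebra_simps split: if_splits)
next
  fix A assume L: "\<forall>p\<in>\<Gamma>. outflow \<Gamma> f p = of_bool (p = \<zeta>) - of_bool (p = y)" and "A \<in> sets (borel_on \<Gamma>)"
  then have A: "A \<subseteq> \<Gamma>" using sets.sets_into_space[of A "borel_on \<Gamma>"] by (simp add: space_restrict_space)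
  have "infsum (outflow \<Gamma> f) A = infsum (\<lambda>p. of_bool (p = \<zeta>) - of_bool (p = y)) (A \<inter> {y, \<zeta>})"
    by (rule infsum_cong_neutral) (use A L in auto)
  also have "\<dots> = (\<Sum>p\<in>A \<inter> {y, \<zeta>}. of_bool (p = \<zeta>) - of_bool (p = y))" by simp
  also have "\<dots> = indicator A \<zeta> - indicator A y"
    by (cases "y = \<zeta>"; cases "y \<in> A"; cases "\<zeta> \<in> A") (auto simp: Int_insert_right)
  finally show "laplacian \<Gamma> f A = indicator A y - indicator A \<zeta>"
    unfolding laplacian_def outflow_def by simp
qed

lemma j_kernel_eqI:
  assumes \<Gamma>: "metrized_graph \<Gamma>" and y: "y \<in> \<Gamma>" and \<zeta>: "\<zeta> \<in> \<Gamma>" and f: "f \<in> CPA \<Gamma>"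
    and out: "\<And>p. p \<in> \<Gamma> \<Longrightarrow> outflow \<Gamma> f p = of_bool (p = \<zeta>) - of_bool (p = y)"
    and z: "f \<zeta> = 0"
  shows "j_kernel \<Gamma> \<zeta> x y = f x"
proof -
  have "(THE f. f \<in> CPA \<Gamma> \<and> (\<forall>A\<in>sets (borel_on \<Gamma>). laplacian \<Gamma> f A = indicator A y - indicator A \<zeta>) \<and>
        f \<zeta> = 0) = f"
    unfolding laplacian_eq_outflow[OF y \<zeta>]
  proof (rule the_equality)
    fix g assume g: "g \<in> CPA \<Gamma> \<and> (\<forall>p\<in>\<Gamma>. outflow \<Gamma> g p = of_bool (p = \<zeta>) - of_bool (p = y)) \<and> g \<zeta> = 0"
    show "g = f" using g f out z by (intro CPA_eqI[OF \<Gamma> _ f _ \<zeta>]) auto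
  qed (use assms in auto)
  then show ?thesis by (simp add: j_kernel_def)
qed

section \<open>Decomposition into edges\<close>

text \<open>Closed edges, and not only their interiors, are isometric to intervals. This excludes loops: the
  two ends of an edge are different points, at distance \<open>len e\<close>.\<close>
locale edge_decomposition =
  fixes \<Gamma> V :: "'a::metric_space set" and E :: "'e set" and \<gamma> :: "'e \<Rightarrow> real \<Rightarrow> 'a" and len :: "'e \<Rightarrow> real"
  assumes finite_V: "finite V" and V_subset: "V \<subseteq> \<Gamma>" and finite_E: "finite E"
    and len_pos: "e \<in> E \<Longrightarrow> 0 < len e"
    and isometric: "e \<in> E \<Longrightarrow> s \<in> {0..len e} \<Longrightarrow> t \<in> {0..len e} \<Longrightarrow> dist (\<gamma> e s) (\<gamma> e t) = \<bar>s - t\<bar>"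
    and ends_in_V: "e \<in> E \<Longrightarrow> \<gamma> e 0 \<in> V" "e \<in> E \<Longrightarrow> \<gamma> e (len e) \<in> V"
    and interior_avoids_V: "e \<in> E \<Longrightarrow> t \<in> {0<..<len e} \<Longrightarrow> \<gamma> e t \<notin> V"
    and interiors_disjoint: "e \<in> E \<Longrightarrow> e' \<in> E \<Longrightarrow> s \<in> {0<..<len e} \<Longrightarrow> t \<in> {0<..<len e'} \<Longrightarrow>
      \<gamma> e s = \<gamma> e' t \<Longrightarrow> e = e'"
    and edges_cover: "\<Gamma> = (\<Union>e\<in>E. \<gamma> e ` {0..len e})"

lemma consecutive_points:
  fixes t :: real
  assumes "finite T" "0 \<in> T" "R \<in> T" "0 < R" "t \<in> {0..R}"
  obtains a b where "a \<in> T" "b \<in> T" "a < b" "{a<..<b} \<inter> T = {}" "t \<in> {a..b}"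
proof -
  \<comment> \<open>the largest node \<open>< R\<close> that is at most \<open>t\<close>, then its successor\<close>
  define A where "A = {x\<in>T. x \<le> t \<and> x < R}"
  have A: "finite A" "A \<noteq> {}" using assms by (auto simp: A_def)
  define a where "a = Max A"
  have a: "a \<in> A" "\<And>x. x \<in> A \<Longrightarrow> x \<le> a" using A by (auto simp: a_def)
  define B where "B = {x\<in>T. a < x}"
  have B: "finite B" "B \<noteq> {}" using assms a by (auto simp: A_def B_def)
  define b where "b = Min B"
  have b: "b \<in> B" "\<And>x. x \<in> B \<Longrightarrow> b \<le> x" using B by (auto simp: b_def)
  have "t \<le> b"
  proof (rule ccontr)
    assume "\<not> t \<le> b"
    then have "b \<in> A" using b(1) assms by (auto simp: A_def B_def)
    then show False using a(2) b(1) by (force simp: B_def)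
  qed
  moreover have "{a<..<b} \<inter> T = {}" using b by (force simp: B_def)
  ultimately show ?thesis using that[of a b] a b by (auto simp: A_def B_def)
qed

lemma isometric_continuous_on:
  fixes \<gamma> :: "real \<Rightarrow> 'a::metric_space"
  assumes "\<And>s t. s \<in> S \<Longrightarrow> t \<in> S \<Longrightarrow> dist (\<gamma> s) (\<gamma> t) = \<bar>s - t\<bar>"
  shows "continuous_on S \<gamma>"
  unfolding continuous_on_iff by (metis assms dist_real_def)

lemma dist_move_same:
  assumes "star_radius \<Gamma> p \<rho>" "v < valence \<Gamma> p" "s \<in> {0..<\<rho>}" "t \<in> {0..<\<rho>}"
  shows "dist (move \<Gamma> p v s) (move \<Gamma> p v t) = \<bar>s - t\<bar>"
  using dist_move[OF assms(1,2,2,3,4)] by simp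

text \<open>A point near \<open>move \<Gamma> p v t\<close> lies in the ball around \<open>p\<close> that the rays fill, and points of other
  rays are at distance at least \<open>t\<close>.\<close>
lemma open_arc:
  assumes \<rho>: "star_radius \<Gamma> p \<rho>" and v: "v < valence \<Gamma> p" and ab: "0 \<le> a" "b < \<rho>"
  shows "openin (top_of_set \<Gamma>) (move \<Gamma> p v ` {a<..<b})"
  unfolding openin_contains_ball
proof (intro conjI ballI)
  show "move \<Gamma> p v ` {a<..<b} \<subseteq> \<Gamma>" using move_in[OF \<rho> v] ab by auto
  fix x assume "x \<in> move \<Gamma> p v ` {a<..<b}"
  then obtain t where t: "a < t" "t < b" "x = move \<Gamma> p v t" by auto
  define \<delta> where "\<delta> = min (t - a) (b - t)"
  have "y \<in> move \<Gamma> p v ` {a<..<b}" if y: "y \<in> \<Gamma>" "dist x y < \<delta>" for y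
  proof -
    have "dist p x = t" using dist_centre_move[OF \<rho> v] t ab by simp
    then have "dist p y < \<rho>" using dist_triangle[of p y x] y ab by (simp add: \<delta>_def)
    then obtain w where w: "w < valence \<Gamma> p" "y = move \<Gamma> p w (dist p y)"
      using near_move[OF \<rho>] y by metis
    define s where "s = dist p y"
    have s: "s \<in> {0..<\<rho>}" "y = move \<Gamma> p w s" using w \<open>dist p y < \<rho>\<close> by (auto simp: s_def)
    have "dist x y = (if v = w then \<bar>t - s\<bar> else t + s)"
      using dist_move[OF \<rho> v w(1), of t s] s t ab by simp
    then have "v = w" "s \<in> {a<..<b}" using y s t ab by (auto simp: \<delta>_def split: if_splits)
    then show ?thesis using s by blast
  qed
  then have "ball x \<delta> \<inter> \<Gamma> \<subseteq> move \<Gamma> p v ` {a<..<b}" by auto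
  moreover have "0 < \<delta>" using t by (simp add: \<delta>_def)
  ultimately show "\<exists>e>0. ball x e \<inter> \<Gamma> \<subseteq> move \<Gamma> p v ` {a<..<b}" by blast
qed

text \<open>By compactness finitely many balls of half the star radius cover \<open>\<Gamma>\<close>. Let \<open>V\<close> be the set of all ends
  of the corresponding half rays, and cut each half ray at its points of \<open>V\<close>. The open arcs between
  consecutive cuts are connected, open in \<open>\<Gamma>\<close> and relatively closed in \<open>\<Gamma> - V\<close>. So two arcs,
  even from different rays, are equal or disjoint, and the arcs themselves can serve as the
  index set of the edges.\<close>
lemma edge_decomposition_exists:
  fixes \<Gamma> :: "'a::metric_space set"
  assumes "metrized_graph \<Gamma>"
  shows "\<exists>V (E :: 'a set set) \<gamma> len. edge_decomposition \<Gamma> V E \<gamma> len"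
proof -
  obtain \<rho> where \<rho>: "\<And>p. p \<in> \<Gamma> \<Longrightarrow> star_radius \<Gamma> p (\<rho> p)"
    using star_radius_exists[OF assms] by metis
  have \<rho>0: "0 < \<rho> p" if "p \<in> \<Gamma>" for p using \<rho>[OF that] by (simp add: star_radius_def)
  have "compact \<Gamma>" using assms by (simp add: metrized_graph_def)
  then obtain P where P: "P \<subseteq> \<Gamma>" "finite P" "\<Gamma> \<subseteq> (\<Union>p\<in>P. ball p (\<rho> p / 2))"
    by (rule compactE_image[of \<Gamma> \<Gamma> "\<lambda>p. ball p (\<rho> p / 2)"]) (use \<rho>0 in force)+
  define V where "V = (\<Union>p\<in>P. \<Union>v<valence \<Gamma> p. {move \<Gamma> p v 0, move \<Gamma> p v (\<rho> p / 2)})"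
  have finV: "finite V" using P by (auto simp: V_def)
  have dm: "dist (move \<Gamma> p v s) (move \<Gamma> p v t) = \<bar>s - t\<bar>"
    if "p \<in> P" "v < valence \<Gamma> p" "s \<in> {0..\<rho> p / 2}" "t \<in> {0..\<rho> p / 2}" for p v s t
    using that P \<rho>0[of p] by (intro dist_move_same[OF \<rho>]) auto
  have mi: "move \<Gamma> p v t \<in> \<Gamma>" if "p \<in> P" "v < valence \<Gamma> p" "t \<in> {0..\<rho> p / 2}" for p v t
    using that P \<rho>0[of p] by (intro move_in[OF \<rho>]) auto
  have VG: "V \<subseteq> \<Gamma>"
    unfolding V_def using mi \<rho>0 P(1) by (force intro!: mi)
  define T where "T p v = {t \<in> {0..\<rho> p / 2}. move \<Gamma> p v t \<in> V}" for p v
  have finT: "finite (T p v)" if "p \<in> P" "v < valence \<Gamma> p" for p v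
  proof (rule inj_on_finite[OF _ _ finV])
    show "inj_on (move \<Gamma> p v) (T p v)"
      using dm[OF that] by (intro inj_onI) (metis (no_types, lifting) T_def abs_eq_0 dist_self
          eq_iff_diff_eq_0 mem_Collect_eq)
  qed (auto simp: T_def)
  have T0: "0 \<in> T p v" "\<rho> p / 2 \<in> T p v" if "p \<in> P" "v < valence \<Gamma> p" for p v
    using that \<rho>0[of p] P by (auto simp: T_def V_def)
  define I where "I = (SIGMA p:P. SIGMA v:{..<valence \<Gamma> p}.
      {(a, b). a \<in> T p v \<and> b \<in> T p v \<and> a < b \<and> {a<..<b} \<inter> T p v = {}})"
  define E where "E = (\<lambda>(p, v, a, b). move \<Gamma> p v ` {a<..<b}) ` I"
  have "finite I"
    unfolding I_def
  proof (intro finite_SigmaI P finite_lessThan)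
    fix p v assume "p \<in> P" "v \<in> {..<valence \<Gamma> p}"
    then have "finite (T p v \<times> T p v)" using finT by simp
    then show "finite {(a, b). a \<in> T p v \<and> b \<in> T p v \<and> a < b \<and> {a<..<b} \<inter> T p v = {}}"
      by (rule rev_finite_subset) auto
  qed
  then have finE: "finite E" by (simp add: E_def)
  have arc: "\<exists>p v a b. C = move \<Gamma> p v ` {a<..<b} \<and> p \<in> P \<and> v < valence \<Gamma> p \<and> 0 \<le> a \<and> a < b \<and> b \<le> \<rho> p / 2 \<and>
      move \<Gamma> p v a \<in> V \<and> move \<Gamma> p v b \<in> V \<and> C \<inter> V = {}" if C: "C \<in> E" for C
  proof -
    obtain p v a b where 1: "C = move \<Gamma> p v ` {a<..<b}" "p \<in> P" "v < valence \<Gamma> p"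
      "a \<in> T p v" "b \<in> T p v" "a < b" "{a<..<b} \<inter> T p v = {}"
      using C unfolding E_def I_def by auto
    moreover have "C \<inter> V = {}" using 1 by (auto simp: T_def)
    ultimately show ?thesis unfolding T_def by (metis (no_types, lifting) atLeastAtMost_iff mem_Collect_eq)
  qed
  \<comment> \<open>\<open>C\<close> is connected and covered by two disjoint open sets: \<open>C'\<close>, and the complement of \<open>V\<close> and the closed arc of \<open>C'\<close>\<close>
  have sub: "C \<subseteq> C'" if C: "C \<in> E" and C': "C' \<in> E" and meet: "C \<inter> C' \<noteq> {}" for C C'
  proof -
    obtain p v a b where 1: "C = move \<Gamma> p v ` {a<..<b}" "p \<in> P" "v < valence \<Gamma> p" "0 \<le> a" "b \<le> \<rho> p / 2"
      "C \<inter> V = {}" using arc[OF C] by blast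
    obtain q w c d where 2: "C' = move \<Gamma> q w ` {c<..<d}" "q \<in> P" "w < valence \<Gamma> q" "0 \<le> c" "c < d"
      "d \<le> \<rho> q / 2" "move \<Gamma> q w c \<in> V" "move \<Gamma> q w d \<in> V" using arc[OF C'] by blast
    have "d < \<rho> q" using 2 \<rho>0[of q] P by auto
    then have "openin (top_of_set \<Gamma>) C'"
      unfolding 2(1) using 2 P by (intro open_arc[OF \<rho>]) auto
    then obtain U where U: "open U" "C' = \<Gamma> \<inter> U" by (auto simp: openin_open)
    define K where "K = move \<Gamma> q w ` {c..d}"
    have "continuous_on {c..d} (move \<Gamma> q w)"
      using 2 by (intro isometric_continuous_on dm) auto
    then have "closed K" unfolding K_def by (intro compact_imp_closed compact_continuous_image) auto
    then have oW: "open (- (K \<union> V))" using finV by (auto intro!: closed_Un finite_imp_closed)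
    have conn: "connected C"
      unfolding 1(1) using 1 by (intro connected_continuous_image isometric_continuous_on dm) auto
    have CG: "C \<subseteq> \<Gamma>" using 1 mi by auto
    have K: "K \<subseteq> C' \<union> V"
      unfolding K_def 2(1) using 2(7,8) by (auto simp: less_eq_real_def)
    have "C' \<subseteq> K" unfolding K_def 2(1) by auto
    have "C \<inter> - (K \<union> V) = {}"
      using connectedD[OF conn U(1) oW] U(2) CG K 1(6) \<open>C' \<subseteq> K\<close> meet by blast
    then show "C \<subseteq> C'" using K 1(6) by blast
  qed
  have "\<forall>C\<in>E. \<exists>\<gamma> L. 0 < L \<and> (\<forall>s\<in>{0..L}. \<forall>t\<in>{0..L}. dist (\<gamma> s) (\<gamma> t) = \<bar>s - t\<bar>) \<and>
      \<gamma> ` {0<..<L} = C \<and> \<gamma> 0 \<in> V \<and> \<gamma> L \<in> V"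
  proof
    fix C assume C: "C \<in> E"
    obtain p v a b where 1: "C = move \<Gamma> p v ` {a<..<b}" "p \<in> P" "v < valence \<Gamma> p" "0 \<le> a" "a < b" "b \<le> \<rho> p / 2"
      "move \<Gamma> p v a \<in> V" "move \<Gamma> p v b \<in> V" using arc[OF C] by blast
    have "{a<..<b} = (\<lambda>t. a + t) ` {0<..<b - a}"
    proof (intro equalityI subsetI)
      fix x assume "x \<in> {a<..<b}"
      then show "x \<in> (\<lambda>t. a + t) ` {0<..<b - a}" by (intro image_eqI[of _ _ "x - a"]) auto
    qed auto
    then have "(\<lambda>t. move \<Gamma> p v (a + t)) ` {0<..<b - a} = C"
      by (simp only: 1(1) image_image)
    moreover have "dist (move \<Gamma> p v (a + s)) (move \<Gamma> p v (a + t)) = \<bar>s - t\<bar>"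
      if "s \<in> {0..b - a}" "t \<in> {0..b - a}" for s t
      using dm[OF 1(2,3), of "a + s" "a + t"] 1 that by simp
    ultimately show "\<exists>\<gamma> L. 0 < L \<and> (\<forall>s\<in>{0..L}. \<forall>t\<in>{0..L}. dist (\<gamma> s) (\<gamma> t) = \<bar>s - t\<bar>) \<and>
      \<gamma> ` {0<..<L} = C \<and> \<gamma> 0 \<in> V \<and> \<gamma> L \<in> V"
      using 1 by (intro exI[of _ "\<lambda>t. move \<Gamma> p v (a + t)"] exI[of _ "b - a"]) auto
  qed
  then obtain \<gamma> where "\<forall>C\<in>E. \<exists>L. 0 < L \<and> (\<forall>s\<in>{0..L}. \<forall>t\<in>{0..L}. dist (\<gamma> C s) (\<gamma> C t) = \<bar>s - t\<bar>) \<and>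
      \<gamma> C ` {0<..<L} = C \<and> \<gamma> C 0 \<in> V \<and> \<gamma> C L \<in> V"
    by (rule bchoice[THEN exE])
  then obtain len where "\<forall>C\<in>E. 0 < len C \<and>
      (\<forall>s\<in>{0..len C}. \<forall>t\<in>{0..len C}. dist (\<gamma> C s) (\<gamma> C t) = \<bar>s - t\<bar>) \<and>
      \<gamma> C ` {0<..<len C} = C \<and> \<gamma> C 0 \<in> V \<and> \<gamma> C (len C) \<in> V"
    by (rule bchoice[THEN exE])
  then have g: "\<And>C. C \<in> E \<Longrightarrow> 0 < len C"
    "\<And>C s t. C \<in> E \<Longrightarrow> s \<in> {0..len C} \<Longrightarrow> t \<in> {0..len C} \<Longrightarrow> dist (\<gamma> C s) (\<gamma> C t) = \<bar>s - t\<bar>"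
    "\<And>C. C \<in> E \<Longrightarrow> \<gamma> C ` {0<..<len C} = C" "\<And>C. C \<in> E \<Longrightarrow> \<gamma> C 0 \<in> V" "\<And>C. C \<in> E \<Longrightarrow> \<gamma> C (len C) \<in> V"
    by blast+
  have "edge_decomposition \<Gamma> V E \<gamma> len"
  proof
    show "finite V" "V \<subseteq> \<Gamma>" "finite E" by fact+
    show "\<gamma> C t \<notin> V" if "C \<in> E" "t \<in> {0<..<len C}" for C t
      using g(3)[OF that(1)] arc[OF that(1)] that(2) by blast
    show "C = C'" if "C \<in> E" "C' \<in> E" "s \<in> {0<..<len C}" "t \<in> {0<..<len C'}" "\<gamma> C s = \<gamma> C' t" for C C' s t
    proof -
      have "\<gamma> C s \<in> C \<inter> C'" using that g(3)[of C] g(3)[of C'] by (metis IntI imageI)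
      then show ?thesis using sub that by blast
    qed
    show "\<Gamma> = (\<Union>C\<in>E. \<gamma> C ` {0..len C})"
    proof (intro equalityI subsetI)
      fix x assume x: "x \<in> \<Gamma>"
      then obtain p where p: "p \<in> P" "dist p x < \<rho> p / 2" using P by auto
      then obtain v where v: "v < valence \<Gamma> p" "x = move \<Gamma> p v (dist p x)"
        using near_move[OF \<rho>, of p x] x P \<rho>0[of p] by force
      obtain a b where ab: "a \<in> T p v" "b \<in> T p v" "a < b" "{a<..<b} \<inter> T p v = {}" "dist p x \<in> {a..b}"
        using consecutive_points[OF finT[OF p(1) v(1)] T0[OF p(1) v(1)], of "dist p x"] p \<rho>0[of p] P
        by auto
      define C where "C = move \<Gamma> p v ` {a<..<b}"
      have C: "C \<in> E" unfolding C_def E_def I_def using p v ab by (auto intro!: image_eqI[where x = "(p, v, a, b)"])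
      have "closed (\<gamma> C ` {0..len C})"
        using g(2)[OF C] by (intro compact_imp_closed compact_continuous_image isometric_continuous_on) auto
      moreover have "continuous_on (closure {a<..<b}) (move \<Gamma> p v)"
        using ab by (intro isometric_continuous_on dm p v) (auto simp: T_def)
      moreover have "move \<Gamma> p v ` {a<..<b} \<subseteq> \<gamma> C ` {0..len C}"
        using g(3)[OF C] unfolding C_def[symmetric] by force
      ultimately have "move \<Gamma> p v ` closure {a<..<b} \<subseteq> \<gamma> C ` {0..len C}"
        by (intro image_closure_subset)
      moreover have "x \<in> move \<Gamma> p v ` closure {a<..<b}" using v(2) ab by auto
      ultimately show "x \<in> (\<Union>C\<in>E. \<gamma> C ` {0..len C})" using C by blast
    next
      fix x assume "x \<in> (\<Union>C\<in>E. \<gamma> C ` {0..len C})"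
      then obtain C t where C: "C \<in> E" "t \<in> {0..len C}" "x = \<gamma> C t" by blast
      have "C \<subseteq> \<Gamma>" using arc[OF C(1)] mi by force
      then have "\<gamma> C t \<in> \<Gamma>" if "t \<in> {0<..<len C}" using g(3)[OF C(1)] that by blast
      then show "x \<in> \<Gamma>" using C g(4,5)[OF C(1)] VG by (cases "t = 0 \<or> t = len C") auto
    qed
  qed (use g in auto)
  then show ?thesis by blast
qed

section \<open>Positive definite systems and the Brownian bridge covariance\<close>

text \<open>Gaussian elimination: induction on the index set, with a Schur complement as the new pivot.\<close>
lemma pos_definite_solvable:
  fixes A :: "'b \<Rightarrow> 'b \<Rightarrow> real"
  assumes "finite V"
    and "\<And>u. (\<exists>a\<in>V. u a \<noteq> 0) \<Longrightarrow> 0 < (\<Sum>a\<in>V. u a * (\<Sum>b\<in>V. A a b * u b))"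
  shows "\<exists>u. \<forall>a\<in>V. (\<Sum>b\<in>V. A a b * u b) = w a"
  using assms
proof (induction V arbitrary: w rule: finite_induct)
  case (insert v V)
  have "0 < (\<Sum>a\<in>V. u a * (\<Sum>b\<in>V. A a b * u b))" if u: "\<exists>a\<in>V. u a \<noteq> 0" for u
  proof -
    let ?u = "u(v := 0)"
    have "0 < (\<Sum>a\<in>insert v V. ?u a * (\<Sum>b\<in>insert v V. A a b * ?u b))"
      using u insert.hyps by (intro insert.prems) auto
    also have "\<dots> = (\<Sum>a\<in>V. u a * (\<Sum>b\<in>V. A a b * u b))"
      using insert.hyps by (auto intro!: sum.cong arg_cong[where f = "\<lambda>x. u _ * x"])
    finally show ?thesis .
  qed
  note IH = insert.IH[OF this]
  obtain u where u: "\<And>a. a \<in> V \<Longrightarrow> (\<Sum>b\<in>V. A a b * u b) = w a" using IH by metis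
  obtain z where z: "\<And>a. a \<in> V \<Longrightarrow> (\<Sum>b\<in>V. A a b * z b) = A a v" using IH[of "\<lambda>a. A a v"] by metis
  define q where "q = A v v - (\<Sum>b\<in>V. A v b * z b)"
  have drop: "(\<Sum>b\<in>V. A a b * (if b = v then c else g b)) = (\<Sum>b\<in>V. A a b * g b)" for a c g
    using insert.hyps by (intro sum.cong) auto
  \<comment> \<open>the Schur complement is the value of the form at a vector whose entry at \<open>v\<close> is \<open>1\<close>\<close>
  have "0 < (\<Sum>a\<in>insert v V. (if a = v then 1 else - z a) *
      (\<Sum>b\<in>insert v V. A a b * (if b = v then 1 else - z b)))"
    by (rule insert.prems) auto
  also have "\<dots> = q"
    using insert.hyps z by (simp add: drop sum_negf q_def)
  finally have q: "0 < q" .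
  define t where "t = (w v - (\<Sum>b\<in>V. A v b * u b)) / q"
  have row: "(\<Sum>b\<in>insert v V. A a b * (if b = v then t else u b - t * z b))
      = A a v * t + (\<Sum>b\<in>V. A a b * u b) - t * (\<Sum>b\<in>V. A a b * z b)" for a
    using insert.hyps by (simp add: drop right_diff_distrib sum_subtractf sum_distrib_left mult.left_commute)
  show ?case
  proof (intro exI ballI)
    fix a assume "a \<in> insert v V"
    then show "(\<Sum>b\<in>insert v V. A a b * (if b = v then t else u b - t * z b)) = w a"
    proof
      assume "a = v"
      have "A v v * t - t * (\<Sum>b\<in>V. A v b * z b) = t * q"
        by (simp add: q_def algebra_simps)
      also have "\<dots> = w v - (\<Sum>b\<in>V. A v b * u b)"
        using q by (simp add: t_def)
      finally have "A v v * t - t * (\<Sum>b\<in>V. A v b * z b) = w v - (\<Sum>b\<in>V. A v b * u b)" .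
      then show ?thesis unfolding row \<open>a = v\<close> by simp
    next
      assume "a \<in> V"
      then show ?thesis unfolding row using u z by simp
    qed
  qed
qed simp

text \<open>The Green function of the interval \<open>[0, L]\<close> with zero boundary values, and the covariance
  of a Brownian bridge of length \<open>L\<close>.\<close>
definition bridge :: "real \<Rightarrow> real \<Rightarrow> real \<Rightarrow> real" where
  "bridge L s t = min s t - s * t / L"

lemma bridge_commute: "bridge L s t = bridge L t s"
  by (simp add: bridge_def min.commute mult.commute)

lemma bridge_ends [simp]:
  assumes "0 < L" "t \<in> {0..L}"
  shows "bridge L 0 t = 0" "bridge L L t = 0"
  using assms by (auto simp: bridge_def)

text \<open>The covariance is a Gram matrix in \<open>L\<^sup>2\<close>: the feature vector of \<open>s\<close> is the indicator function
  of \<open>[0, s]\<close> minus its mean.\<close>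
lemma bridge_integral:
  assumes "0 < L" and s: "s \<in> {0..L}" and t: "t \<in> {0..L}"
  shows "((\<lambda>u. (of_bool (u \<le> s) - s / L) * (of_bool (u \<le> t) - t / L)) has_integral bridge L s t) {0..L}"
proof -
  have ind: "((\<lambda>u. of_bool (u \<le> r)) has_integral r) {0..L}" if "r \<in> {0..L}" for r :: real
  proof -
    have "((\<lambda>u. 1) has_integral r) {0..r}" using has_integral_const_real[of "1::real" 0 r] that by simp
    then have "((\<lambda>u. if u \<in> {0..r} then 1 else 0) has_integral r) {0..L}"
      using that by (subst has_integral_restrict) auto
    then show ?thesis by (rule has_integral_eq[rotated]) auto
  qed
  have "((\<lambda>u. of_bool (u \<le> min s t) - t / L * of_bool (u \<le> s) - s / L * of_bool (u \<le> t) + s / L * (t / L))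
      has_integral (min s t - t / L * s - s / L * t + L * (s / L * (t / L)))) {0..L}"
    using has_integral_const_real[of "s / L * (t / L)" 0 L] assms
    by (intro has_integral_add has_integral_diff has_integral_mult_right ind) auto
  moreover have "min s t - t / L * s - s / L * t + L * (s / L * (t / L)) = bridge L s t"
    using assms by (simp add: bridge_def field_simps)
  ultimately show ?thesis
    by (auto intro: has_integral_eq[rotated] simp: algebra_simps of_bool_def min_def)
qed

lemma bridge_psd:
  fixes s :: "'b \<Rightarrow> real"
  assumes "0 < L" "finite I" "\<And>i. i \<in> I \<Longrightarrow> s i \<in> {0..L}"
  shows "0 \<le> (\<Sum>i\<in>I. \<Sum>j\<in>I. c i * c j * bridge L (s i) (s j))"
proof -
  let ?\<phi> = "\<lambda>i u. of_bool (u \<le> s i) - s i / L"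
  have "((\<lambda>u. \<Sum>i\<in>I. \<Sum>j\<in>I. c i * c j * (?\<phi> i u * ?\<phi> j u)) has_integral
      (\<Sum>i\<in>I. \<Sum>j\<in>I. c i * c j * bridge L (s i) (s j))) {0..L}"
    using assms by (intro has_integral_sum has_integral_mult_right bridge_integral) auto
  moreover have "(\<Sum>i\<in>I. \<Sum>j\<in>I. c i * c j * (?\<phi> i u * ?\<phi> j u)) = (\<Sum>i\<in>I. c i * ?\<phi> i u)\<^sup>2" for u
    unfolding power2_eq_square sum_product by (intro sum.cong refl) (simp add: mult_ac)
  ultimately show ?thesis using has_integral_nonneg by (metis (no_types, lifting) zero_le_power2)
qed

section \<open>Functions on a decomposed graph\<close>

context edge_decomposition
begin

text \<open>A point of \<open>V\<close> may lie on several edges, and one of its positions is chosen.\<close>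
definition loc :: "'a \<Rightarrow> 'e \<times> real" where
  "loc x = (SOME (e, t). e \<in> E \<and> t \<in> {0..len e} \<and> x = \<gamma> e t)"

lemma loc_cases:
  assumes "x \<in> \<Gamma>"
  obtains e t where "loc x = (e, t)" "e \<in> E" "t \<in> {0..len e}" "x = \<gamma> e t"
proof -
  have "\<exists>z. case z of (e, t) \<Rightarrow> e \<in> E \<and> t \<in> {0..len e} \<and> x = \<gamma> e t"
    using assms edges_cover by fastforce
  then have "case loc x of (e, t) \<Rightarrow> e \<in> E \<and> t \<in> {0..len e} \<and> x = \<gamma> e t"
    unfolding loc_def by (rule someI_ex)
  then show ?thesis using that by (auto split: prod.splits)
qed

lemma edge_in: "e \<in> E \<Longrightarrow> t \<in> {0..len e} \<Longrightarrow> \<gamma> e t \<in> \<Gamma>"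
  using edges_cover by blast

lemma len_in [simp]: "e \<in> E \<Longrightarrow> len e \<in> {0..len e}"
  using len_pos[of e] by auto

lemma edge_inj:
  assumes "e \<in> E" "s \<in> {0..len e}" "t \<in> {0..len e}" "\<gamma> e s = \<gamma> e t"
  shows "s = t"
  using isometric[OF assms(1-3)] assms(4) by simp

lemma ends_differ: "e \<in> E \<Longrightarrow> \<gamma> e 0 \<noteq> \<gamma> e (len e)"
  using edge_inj[of e 0 "len e"] len_pos[of e] by auto

lemma in_V_iff:
  assumes "e \<in> E" "t \<in> {0..len e}"
  shows "\<gamma> e t \<in> V \<longleftrightarrow> t = 0 \<or> t = len e"
  using assms interior_avoids_V[of e t] ends_in_V[of e] by force

text \<open>A function given edge by edge is well defined as soon as it depends only on the point at the
  ends of the edges.\<close>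
lemma overlap_cases:
  assumes "e \<in> E" "e' \<in> E" "s \<in> {0..len e}" "t \<in> {0..len e'}" "\<gamma> e s = \<gamma> e' t"
  obtains "e = e'" "s = t" | "s = 0 \<or> s = len e" "t = 0 \<or> t = len e'"
proof (cases "\<gamma> e s \<in> V")
  case True
  then show ?thesis using that(2) assms in_V_iff by metis
next
  case False
  then have "\<gamma> e' t \<notin> V" using assms by simp
  then have "s \<in> {0<..<len e}" "t \<in> {0<..<len e'}"
    using False assms(3,4) in_V_iff[OF assms(1,3)] in_V_iff[OF assms(2,4)] by auto
  then have "e = e'" using interiors_disjoint assms by blast
  then show ?thesis using that(1) assms edge_inj by blast
qed

lemma closed_edge: "e \<in> E \<Longrightarrow> closed (\<gamma> e ` {0..len e})"
  using isometric by (intro compact_imp_closed compact_continuous_image isometric_continuous_on) auto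

text \<open>The products of two closed edges form a finite closed cover of \<open>\<Gamma> \<times> \<Gamma>\<close>. The two-variable form
  provides joint continuity of kernels.\<close>
lemma continuous_on_glued:
  fixes k :: "'a \<Rightarrow> 'a \<Rightarrow> real"
  assumes k: "\<And>e e' s t. e \<in> E \<Longrightarrow> e' \<in> E \<Longrightarrow> s \<in> {0..len e} \<Longrightarrow> t \<in> {0..len e'} \<Longrightarrow>
      k (\<gamma> e s) (\<gamma> e' t) = \<Phi> e e' (s, t)"
    and \<Phi>: "\<And>e e'. e \<in> E \<Longrightarrow> e' \<in> E \<Longrightarrow> continuous_on ({0..len e} \<times> {0..len e'}) (\<Phi> e e')"
  shows "continuous_on (\<Gamma> \<times> \<Gamma>) (\<lambda>z. k (fst z) (snd z))"
proof -
  define \<kappa> where "\<kappa> e = inv_into {0..len e} (\<gamma> e)" for e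
  have inj: "inj_on (\<gamma> e) {0..len e}" if "e \<in> E" for e
    using edge_inj[OF that] by (intro inj_onI)
  have \<kappa>: "\<kappa> e (\<gamma> e t) = t" if "e \<in> E" "t \<in> {0..len e}" for e t
    unfolding \<kappa>_def using inj that by (intro inv_into_f_f)
  have \<kappa>_cont: "continuous_on (\<gamma> e ` {0..len e}) (\<kappa> e)" if "e \<in> E" for e
    unfolding continuous_on_iff
    using \<kappa>[OF that] isometric[OF that] by (auto simp: dist_real_def)
  have "continuous_on (\<Union>p\<in>E \<times> E. \<gamma> (fst p) ` {0..len (fst p)} \<times> \<gamma> (snd p) ` {0..len (snd p)})
      (\<lambda>z. k (fst z) (snd z))"
  proof (rule continuous_on_closed_Union)
    show "finite (E \<times> E)" using finite_E by simp
    fix p assume "p \<in> E \<times> E"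
    then obtain e e' where p: "p = (e, e')" "e \<in> E" "e' \<in> E" by auto
    show "closed (\<gamma> (fst p) ` {0..len (fst p)} \<times> \<gamma> (snd p) ` {0..len (snd p)})"
      using p closed_edge by (auto intro: closed_Times)
    have "continuous_on (\<gamma> e ` {0..len e} \<times> \<gamma> e' ` {0..len e'}) (\<lambda>z. \<Phi> e e' (\<kappa> e (fst z), \<kappa> e' (snd z)))"
      using p \<kappa> by (intro continuous_on_compose2[OF \<Phi>[OF p(2,3)]] continuous_on_Pair
          continuous_on_compose2[OF \<kappa>_cont] continuous_intros) auto
    then show "continuous_on (\<gamma> (fst p) ` {0..len (fst p)} \<times> \<gamma> (snd p) ` {0..len (snd p)}) (\<lambda>z. k (fst z) (snd z))"
      unfolding p fst_conv snd_conv by (rule continuous_on_eq) (use p in \<open>auto simp: k \<kappa>\<close>)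
  qed
  moreover have "(\<Union>p\<in>E \<times> E. \<gamma> (fst p) ` {0..len (fst p)} \<times> \<gamma> (snd p) ` {0..len (snd p)}) = \<Gamma> \<times> \<Gamma>"
    by (subst edges_cover, subst edges_cover) fastforce
  ultimately show ?thesis by simp
qed

text \<open>Allowing nodes inside the edges makes the criterion stable under linear combinations: the sets
  of nodes are united.\<close>
lemma CPA_I:
  assumes ext: "f \<in> extensional \<Gamma>" and cont: "continuous_on \<Gamma> f" and T: "finite T"
    and aff: "\<And>e a b. e \<in> E \<Longrightarrow> 0 \<le> a \<Longrightarrow> a < b \<Longrightarrow> b \<le> len e \<Longrightarrow> {a<..<b} \<inter> T = {} \<Longrightarrow>
      \<exists>\<alpha> \<beta>. \<forall>t\<in>{a..b}. f (\<gamma> e t) = \<alpha> + \<beta> * of_real t"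
  shows "f \<in> CPA \<Gamma>"
proof -
  define T' where "T' e = {0, len e} \<union> (T \<inter> {0..len e})" for e
  have T': "finite (T' e)" "0 \<in> T' e" "len e \<in> T' e" for e using T by (auto simp: T'_def)
  have T'_sub: "T' e \<subseteq> {0..len e}" if "e \<in> E" for e using len_pos[OF that] by (auto simp: T'_def)
  define I where "I = (SIGMA e:E. {(a, b). a \<in> T' e \<and> b \<in> T' e \<and> a < b \<and> {a<..<b} \<inter> T' e = {}})"
  define F where "F = (\<lambda>(e, a, b). \<gamma> e ` {a..b}) ` I"
  have "finite I"
    unfolding I_def
  proof (intro finite_SigmaI finite_E)
    fix e
    have "finite (T' e \<times> T' e)" using T' by simp
    then show "finite {(a, b). a \<in> T' e \<and> b \<in> T' e \<and> a < b \<and> {a<..<b} \<inter> T' e = {}}"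
      by (rule rev_finite_subset) auto
  qed
  then have "finite F" by (simp add: F_def)
  moreover have "\<Union>F = \<Gamma>"
  proof (intro equalityI subsetI)
    fix x assume "x \<in> \<Union>F"
    then obtain e a b t where "e \<in> E" "a \<in> T' e" "b \<in> T' e" "t \<in> {a..b}" "x = \<gamma> e t"
      unfolding F_def I_def by auto
    moreover have "t \<in> {0..len e}" using calculation T'_sub[of e] by force
    ultimately show "x \<in> \<Gamma>" using edge_in by blast
  next
    fix x assume "x \<in> \<Gamma>"
    then obtain e t where et: "e \<in> E" "t \<in> {0..len e}" "x = \<gamma> e t" using edges_cover by blast
    obtain a b where "a \<in> T' e" "b \<in> T' e" "a < b" "{a<..<b} \<inter> T' e = {}" "t \<in> {a..b}"
      using consecutive_points[OF T' len_pos[OF et(1)] et(2)] by blast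
    then show "x \<in> \<Union>F" using et unfolding F_def I_def
      by (intro UnionI[of "\<gamma> e ` {a..b}"]) (auto intro!: image_eqI[where x = "(e, a, b)"])
  qed
  moreover have "affine_on_segment f S" if S: "S \<in> F" for S
  proof -
    obtain e a b where ab: "e \<in> E" "a \<in> T' e" "b \<in> T' e" "a < b" "{a<..<b} \<inter> T' e = {}" "S = \<gamma> e ` {a..b}"
      using S unfolding F_def I_def by auto
    have ab': "0 \<le> a" "b \<le> len e" using T'_sub[OF ab(1)] ab(2,3) by auto
    have "{a<..<b} \<inter> T = {}" using ab(5) ab' by (fastforce simp: T'_def)
    then obtain \<alpha> \<beta> where \<alpha>: "\<And>t. t \<in> {a..b} \<Longrightarrow> f (\<gamma> e t) = \<alpha> + \<beta> * of_real t"
      using aff[OF ab(1) ab'(1) ab(4) ab'(2)] by blast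
    have "(\<lambda>t. \<gamma> e (a + t)) ` {0..b - a} = \<gamma> e ` (\<lambda>t. a + t) ` {0..b - a}" by (simp only: image_image)
    also have "(\<lambda>t. a + t) ` {0..b - a} = {a..b}" by (simp add: image_add_atLeastAtMost)
    finally have "S = (\<lambda>t. \<gamma> e (a + t)) ` {0..b - a}" using ab by simp
    moreover have "dist (\<gamma> e (a + s)) (\<gamma> e (a + t)) = \<bar>s - t\<bar>" if "s \<in> {0..b - a}" "t \<in> {0..b - a}" for s t
      using isometric[OF ab(1), of "a + s" "a + t"] that ab' by simp
    moreover have "f (\<gamma> e (a + t)) = (\<alpha> + \<beta> * of_real a) + \<beta> * of_real t" if "t \<in> {0..b - a}" for t
      using \<alpha>[of "a + t"] that by (simp add: algebra_simps)
    ultimately show ?thesis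
      unfolding affine_on_segment_def using ab(4)
      by (intro exI[of _ "\<lambda>t. \<gamma> e (a + t)"] exI[of _ "b - a"] exI[of _ "\<alpha> + \<beta> * of_real a"] exI[of _ \<beta>]) auto
  qed
  ultimately show ?thesis unfolding CPA_def using ext cont by blast
qed

lemma eventually_sphere_avoids:
  assumes "closed S" "p \<notin> S"
  shows "\<forall>\<^sub>F s in at_right 0. \<forall>x\<in>S. dist p x \<noteq> s"
proof -
  obtain \<delta> where \<delta>: "0 < \<delta>" "ball p \<delta> \<inter> S = {}"
    using assms by (metis ComplI disjoint_eq_subset_Compl open_Compl open_contains_ball)
  have "\<forall>\<^sub>F s in at_right 0. s \<in> {0<..<\<delta>}" by (rule eventually_at_right_real[OF \<delta>(1)])
  then show ?thesis by eventually_elim (use \<delta> in force)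
qed

text \<open>For small \<open>s\<close> the sphere around a vertex \<open>p\<close> contains no vertex and meets only edges that
  end in \<open>p\<close>, each of them in one point.\<close>
lemma sphere_sum_vertex:
  assumes p: "p \<in> V"
  shows "\<forall>\<^sub>F s in at_right 0. \<forall>h :: 'a \<Rightarrow> real. (\<Sum>x | x \<in> \<Gamma> \<and> dist p x = s. h x) =
    (\<Sum>e\<in>E. of_bool (\<gamma> e 0 = p) * h (\<gamma> e s) + of_bool (\<gamma> e (len e) = p) * h (\<gamma> e (len e - s)))"
proof -
  \<comment> \<open>a closed set without \<open>p\<close>, which small spheres around \<open>p\<close> avoid\<close>
  define S where "S = (V - {p}) \<union> (\<Union>e\<in>{e\<in>E. p \<notin> \<gamma> e ` {0..len e}}. \<gamma> e ` {0..len e})"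
  have "closed S"
    unfolding S_def using finite_V finite_E closed_edge
    by (intro closed_Un closed_UN finite_imp_closed) auto
  then have "\<forall>\<^sub>F s in at_right 0. \<forall>x\<in>S. dist p x \<noteq> s"
    by (rule eventually_sphere_avoids) (auto simp: S_def)
  moreover have "\<forall>\<^sub>F s in at_right 0. \<forall>e\<in>E. s < len e"
    using finite_E len_pos by (intro eventually_ball_finite ballI eventually_at_right_real
        [THEN eventually_mono, of 0 "len _"]) auto
  ultimately show ?thesis using eventually_at_right_less[of "0::real"]
  proof eventually_elim
    case (elim s)
    note away = elim(1) and short = elim(2) and s = \<open>0 < s\<close>
    define R where "R e = {x. dist p x = s \<and> x \<in> \<gamma> e ` {0<..<len e}}" for e
    have "{x. x \<in> \<Gamma> \<and> dist p x = s} = (\<Union>e\<in>E. R e)"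
    proof (intro equalityI subsetI)
      fix x assume x: "x \<in> {x. x \<in> \<Gamma> \<and> dist p x = s}"
      then obtain e t where et: "e \<in> E" "t \<in> {0..len e}" "x = \<gamma> e t" using edges_cover by blast
      have "x \<notin> S" using away x by auto
      then have "x \<notin> V - {p}" by (auto simp: S_def)
      then have "x \<notin> V" using x s by auto
      then have "t \<noteq> 0" "t \<noteq> len e" using in_V_iff[OF et(1,2)] et by auto
      then show "x \<in> (\<Union>e\<in>E. R e)" using et x by (force simp: R_def)
    next
      fix x assume "x \<in> (\<Union>e\<in>E. R e)"
      then show "x \<in> {x. x \<in> \<Gamma> \<and> dist p x = s}" using edge_in by (force simp: R_def)
    qed
    moreover have R: "R e = (if \<gamma> e 0 = p then {\<gamma> e s} else if \<gamma> e (len e) = p then {\<gamma> e (len e - s)} else {})"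
      if e: "e \<in> E" for e
    proof -
      have s': "s < len e" using short e by blast
      have "x = (if \<gamma> e 0 = p then \<gamma> e s else \<gamma> e (len e - s)) \<and> (\<gamma> e 0 = p \<or> \<gamma> e (len e) = p)"
        if x: "x \<in> R e" for x
      proof -
        obtain t where t: "t \<in> {0<..<len e}" "x = \<gamma> e t" "dist p x = s" using x by (auto simp: R_def)
        have "p \<in> \<gamma> e ` {0..len e}"
        proof (rule ccontr)
          assume "p \<notin> \<gamma> e ` {0..len e}"
          then have "x \<in> S" using e t unfolding S_def by force
          then show False using away t by blast
        qed
        then obtain r where r: "r \<in> {0..len e}" "p = \<gamma> e r" by auto
        then have r': "r = 0 \<or> r = len e" using in_V_iff[OF e] p by auto
        have "\<bar>r - t\<bar> = s" using isometric[OF e r(1), of t] t r by auto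
        then have "t = (if r = 0 then s else len e - s)" using r' t r by (auto split: if_splits)
        then show ?thesis using r r' t ends_differ[OF e] by auto
      qed
      moreover have "\<gamma> e s \<in> R e" if "\<gamma> e 0 = p"
        using isometric[OF e, of 0 s] s s' that by (auto simp: R_def)
      moreover have "\<gamma> e (len e - s) \<in> R e" if "\<gamma> e (len e) = p"
        using isometric[OF e, of "len e" "len e - s"] s s' that by (auto simp: R_def)
      ultimately show ?thesis using ends_differ[OF e] by (auto split: if_splits)
    qed
    moreover have "R e \<inter> R e' = {}" if "e \<in> E" "e' \<in> E" "e \<noteq> e'" for e e'
      using interiors_disjoint that unfolding R_def by blast
    ultimately show ?case
    proof (intro allI)
      fix h :: "'a \<Rightarrow> real"
      have "(\<Sum>x | x \<in> \<Gamma> \<and> dist p x = s. h x) = (\<Sum>e\<in>E. \<Sum>x\<in>R e. h x)"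
        unfolding \<open>{x. x \<in> \<Gamma> \<and> dist p x = s} = (\<Union>e\<in>E. R e)\<close>
        using finite_E R \<open>\<And>e e'. e \<in> E \<Longrightarrow> e' \<in> E \<Longrightarrow> e \<noteq> e' \<Longrightarrow> R e \<inter> R e' = {}\<close>
        by (intro sum.UNION_disjoint) auto
      also have "\<dots> = (\<Sum>e\<in>E. of_bool (\<gamma> e 0 = p) * h (\<gamma> e s) + of_bool (\<gamma> e (len e) = p) * h (\<gamma> e (len e - s)))"
        using R ends_differ by (intro sum.cong) auto
      finally show "(\<Sum>x | x \<in> \<Gamma> \<and> dist p x = s. h x) = (\<Sum>e\<in>E. of_bool (\<gamma> e 0 = p) * h (\<gamma> e s)
          + of_bool (\<gamma> e (len e) = p) * h (\<gamma> e (len e - s)))" .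
    qed
  qed
qed

lemma sphere_sum_interior:
  assumes e: "e \<in> E" and t: "t \<in> {0<..<len e}"
  shows "\<forall>\<^sub>F s in at_right 0. \<forall>h :: 'a \<Rightarrow> real.
    (\<Sum>x | x \<in> \<Gamma> \<and> dist (\<gamma> e t) x = s. h x) = h (\<gamma> e (t + s)) + h (\<gamma> e (t - s))"
proof -
  have t': "t \<in> {0..len e}" using t by auto
  define S where "S = (\<Union>e'\<in>E - {e}. \<gamma> e' ` {0..len e'})"
  have "closed S" unfolding S_def using finite_E closed_edge by (intro closed_UN) auto
  moreover have "\<gamma> e t \<notin> S"
  proof
    assume "\<gamma> e t \<in> S"
    then obtain e' r where "e' \<in> E" "e' \<noteq> e" "r \<in> {0..len e'}" "\<gamma> e t = \<gamma> e' r"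
      unfolding S_def by blast
    then show False using overlap_cases[OF e _ t', of e' r] t by auto
  qed
  ultimately have "\<forall>\<^sub>F s in at_right 0. \<forall>x\<in>S. dist (\<gamma> e t) x \<noteq> s" by (rule eventually_sphere_avoids)
  moreover have "\<forall>\<^sub>F s in at_right 0. s \<in> {0<..<min t (len e - t)}"
    using t by (intro eventually_at_right_real) auto
  ultimately show ?thesis
  proof eventually_elim
    case (elim s)
    have "{x. x \<in> \<Gamma> \<and> dist (\<gamma> e t) x = s} = {\<gamma> e (t + s), \<gamma> e (t - s)}"
    proof (intro equalityI subsetI)
      fix x assume x: "x \<in> {x. x \<in> \<Gamma> \<and> dist (\<gamma> e t) x = s}"
      then have "x \<notin> S" using elim by blast
      moreover have "x \<in> (\<Union>e\<in>E. \<gamma> e ` {0..len e})" using x edges_cover by blast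
      ultimately obtain r where r: "r \<in> {0..len e}" "x = \<gamma> e r" unfolding S_def by blast
      then have "\<bar>t - r\<bar> = s" using isometric[OF e t' r(1)] x by simp
      then have "r = t + s \<or> r = t - s" by linarith
      then show "x \<in> {\<gamma> e (t + s), \<gamma> e (t - s)}" using r by auto
    next
      fix x assume "x \<in> {\<gamma> e (t + s), \<gamma> e (t - s)}"
      moreover have "dist (\<gamma> e t) (\<gamma> e (t + s)) = s" "dist (\<gamma> e t) (\<gamma> e (t - s)) = s"
        using isometric[OF e t', of "t + s"] isometric[OF e t', of "t - s"] elim by auto
      moreover have "\<gamma> e (t + s) \<in> \<Gamma>" "\<gamma> e (t - s) \<in> \<Gamma>" using elim by (auto intro!: edge_in e)
      ultimately show "x \<in> {x. x \<in> \<Gamma> \<and> dist (\<gamma> e t) x = s}" by auto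
    qed
    moreover have "\<gamma> e (t + s) \<noteq> \<gamma> e (t - s)"
      using edge_inj[OF e, of "t + s" "t - s"] elim by auto
    ultimately show ?case by simp
  qed
qed

end

section \<open>The Laplace matrix on the vertices and its inverse\<close>

locale metric_network = edge_decomposition \<Gamma> V E \<gamma> len
  for \<Gamma> V :: "'a::metric_space set" and E :: "'e set" and \<gamma> len +
  assumes connected: "connected \<Gamma>" and nonempty: "\<Gamma> \<noteq> {}"
begin

lemma V_nonempty: "V \<noteq> {}"
proof -
  obtain x where x: "x \<in> \<Gamma>" using nonempty by auto
  obtain e t where "e \<in> E" by (rule loc_cases[OF x])
  then have "\<gamma> e 0 \<in> V" by (rule ends_in_V)
  then show ?thesis by (rule ex_in_conv[THEN iffD1, OF exI])
qed

lemma card_V_pos: "0 < card V"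
  unfolding card_gt_0_iff by (intro conjI V_nonempty finite_V)

text \<open>Giving each edge the common value of \<open>u\<close> at its ends defines a continuous function on \<open>\<Gamma>\<close> with
  finitely many values. Since \<open>\<Gamma>\<close> is connected, it is constant.\<close>
lemma constant_on_V_if_equal_ends:
  assumes "\<And>e. e \<in> E \<Longrightarrow> u (\<gamma> e 0) = u (\<gamma> e (len e))" and ab: "a \<in> V" "b \<in> V"
  shows "(u a :: real) = u b"
proof -
  define k where "k x y = u (\<gamma> (fst (loc x)) 0)" for x y :: 'a
  have k: "k (\<gamma> e s) y = u (\<gamma> e 0)" if e: "e \<in> E" "s \<in> {0..len e}" for e s y
  proof -
    obtain e' t where t: "loc (\<gamma> e s) = (e', t)" "e' \<in> E" "t \<in> {0..len e'}" "\<gamma> e s = \<gamma> e' t"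
      using loc_cases[OF edge_in[OF e]] by metis
    have "u (\<gamma> e 0) = u (\<gamma> e' 0)"
    proof (rule overlap_cases[OF e(1) t(2) e(2) t(3,4)])
      assume "s = 0 \<or> s = len e" "t = 0 \<or> t = len e'"
      then have "u (\<gamma> e s) = u (\<gamma> e 0)" "u (\<gamma> e' t) = u (\<gamma> e' 0)"
        using assms(1)[OF e(1)] assms(1)[OF t(2)] by auto
      then show ?thesis using t(4) by simp
    qed simp
    then show ?thesis unfolding k_def t(1) by simp
  qed
  have "continuous_on (\<Gamma> \<times> \<Gamma>) (\<lambda>z. k (fst z) (snd z))"
    by (rule continuous_on_glued[where \<Phi> = "\<lambda>e e' z. u (\<gamma> e 0)"]) (use k in auto)
  then have "continuous_on \<Gamma> (\<lambda>x. k x x)"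
    by (rule continuous_on_compose2[where g = "\<lambda>z. k (fst z) (snd z)" and f = "\<lambda>x. (x, x)", simplified])
      (auto intro!: continuous_intros)
  moreover have "(\<lambda>x. k x x) ` \<Gamma> \<subseteq> (\<lambda>e. u (\<gamma> e 0)) ` E"
    using k edges_cover by fastforce
  ultimately have "(\<lambda>x. k x x) constant_on \<Gamma>"
    using connected finite_E by (intro continuous_finite_range_constant) (auto intro: finite_surj)
  then obtain c where c: "\<And>x. x \<in> \<Gamma> \<Longrightarrow> k x x = c" unfolding constant_on_def by blast
  have "u a = c" if a: "a \<in> V" for a
  proof -
    obtain e s where e: "e \<in> E" "s \<in> {0..len e}" "a = \<gamma> e s" using a V_subset edges_cover by blast
    then have "s = 0 \<or> s = len e" using in_V_iff a by blast
    then have "u a = u (\<gamma> e 0)" using e assms(1)[OF e(1)] by auto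
    then show ?thesis using k[OF e(1,2)] c[OF edge_in[OF e(1,2)]] e(3) by simp
  qed
  then show ?thesis using ab by metis
qed

text \<open>The signed incidence matrix of the graph, with edges directed from \<open>len e\<close> to \<open>0\<close>.\<close>
definition orient :: "'e \<Rightarrow> 'a \<Rightarrow> real" where
  "orient e a = of_bool (\<gamma> e 0 = a) - of_bool (\<gamma> e (len e) = a)"

text \<open>The Laplace matrix of the graph with edge weights \<open>1 / len e\<close>, plus the
  orthogonal projection onto the constants. As \<open>\<Gamma>\<close> is connected, the constants are the kernel of the
  Laplace matrix, and the sum is invertible.\<close>
definition reg_lap :: "'a \<Rightarrow> 'a \<Rightarrow> real" where
  "reg_lap a b = (\<Sum>e\<in>E. orient e a * orient e b / len e) + 1 / card V"

lemma sum_orient: "e \<in> E \<Longrightarrow> (\<Sum>a\<in>V. orient e a * u a) = u (\<gamma> e 0) - u (\<gamma> e (len e))"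
  using finite_V ends_in_V by (simp add: orient_def left_diff_distrib sum_subtractf)

lemma reg_lap_apply:
  "(\<Sum>b\<in>V. reg_lap a b * u b) = (\<Sum>e\<in>E. orient e a * (u (\<gamma> e 0) - u (\<gamma> e (len e))) / len e) + (\<Sum>b\<in>V. u b) / card V"
proof -
  have "(\<Sum>b\<in>V. reg_lap a b * u b) = (\<Sum>b\<in>V. \<Sum>e\<in>E. orient e a * orient e b / len e * u b) + (\<Sum>b\<in>V. u b / card V)"
    by (simp add: reg_lap_def distrib_right sum.distrib sum_distrib_right)
  also have "(\<Sum>b\<in>V. \<Sum>e\<in>E. orient e a * orient e b / len e * u b)
      = (\<Sum>e\<in>E. orient e a / len e * (\<Sum>b\<in>V. orient e b * u b))"
    by (subst sum.swap) (simp add: sum_distrib_left mult_ac)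
  also have "\<dots> = (\<Sum>e\<in>E. orient e a * (u (\<gamma> e 0) - u (\<gamma> e (len e))) / len e)"
    by (intro sum.cong) (simp_all add: sum_orient)
  finally show ?thesis by (simp add: sum_divide_distrib)
qed

text \<open>The Dirichlet energy of \<open>u\<close>, plus a term that sees the constants.\<close>
lemma reg_lap_form:
  "(\<Sum>a\<in>V. u a * (\<Sum>b\<in>V. reg_lap a b * u b))
    = (\<Sum>e\<in>E. (u (\<gamma> e 0) - u (\<gamma> e (len e)))\<^sup>2 / len e) + (\<Sum>b\<in>V. u b)\<^sup>2 / card V"
proof -
  let ?d = "\<lambda>e. u (\<gamma> e 0) - u (\<gamma> e (len e))"
  have "(\<Sum>a\<in>V. u a * (\<Sum>b\<in>V. reg_lap a b * u b))
      = (\<Sum>a\<in>V. \<Sum>e\<in>E. u a * (orient e a * ?d e / len e)) + (\<Sum>a\<in>V. u a * ((\<Sum>b\<in>V. u b) / card V))"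
    unfolding reg_lap_apply by (simp add: distrib_left sum.distrib sum_distrib_left)
  also have "(\<Sum>a\<in>V. \<Sum>e\<in>E. u a * (orient e a * ?d e / len e)) = (\<Sum>e\<in>E. ?d e / len e * (\<Sum>a\<in>V. orient e a * u a))"
    unfolding sum_distrib_left by (subst sum.swap) (simp add: field_simps)
  also have "\<dots> = (\<Sum>e\<in>E. (?d e)\<^sup>2 / len e)"
    by (intro sum.cong) (simp_all add: sum_orient power2_eq_square)
  also have "(\<Sum>a\<in>V. u a * ((\<Sum>b\<in>V. u b) / card V)) = (\<Sum>b\<in>V. u b)\<^sup>2 / card V"
    by (simp only: power2_eq_square sum_distrib_right[symmetric]) simp
  finally show ?thesis .
qed

lemma reg_lap_form_nonneg: "0 \<le> (\<Sum>a\<in>V. u a * (\<Sum>b\<in>V. reg_lap a b * u b))"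
  unfolding reg_lap_form using len_pos
  by (intro add_nonneg_nonneg sum_nonneg divide_nonneg_nonneg) (auto simp: less_imp_le)

lemma reg_lap_form_pos:
  assumes "\<exists>a\<in>V. u a \<noteq> 0"
  shows "0 < (\<Sum>a\<in>V. u a * (\<Sum>b\<in>V. reg_lap a b * u b))"
proof (rule ccontr)
  let ?D = "\<Sum>e\<in>E. (u (\<gamma> e 0) - u (\<gamma> e (len e)))\<^sup>2 / len e"
  assume "\<not> ?thesis"
  moreover have D: "0 \<le> ?D" using len_pos by (intro sum_nonneg) (auto simp: less_imp_le)
  moreover have "0 \<le> (\<Sum>b\<in>V. u b)\<^sup>2 / card V" by simp
  ultimately have "?D = 0" and s: "(\<Sum>b\<in>V. u b)\<^sup>2 / card V = 0"
    unfolding reg_lap_form by linarith+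
  then have "\<forall>e\<in>E. (u (\<gamma> e 0) - u (\<gamma> e (len e)))\<^sup>2 / len e = 0"
    using len_pos finite_E by (subst (asm) sum_nonneg_eq_0_iff) (auto simp: less_imp_le)
  then have "u (\<gamma> e 0) = u (\<gamma> e (len e))" if "e \<in> E" for e
    using that len_pos by force
  then have const: "u a = u b" if "a \<in> V" "b \<in> V" for a b using constant_on_V_if_equal_ends that by blast
  obtain a where a: "a \<in> V" "u a \<noteq> 0" using assms by blast
  have "(\<Sum>b\<in>V. u b) = (\<Sum>b\<in>V. u a)" by (intro sum.cong refl const a(1))
  then show False using s a card_V_pos by simp
qed

text \<open>The inverse of \<open>reg_lap\<close>. On vectors with sum \<open>0\<close> it inverts the Laplace matrix.\<close>
definition green_matrix :: "'a \<Rightarrow> 'a \<Rightarrow> real" where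
  "green_matrix = (SOME G. \<forall>b\<in>V. \<forall>a\<in>V. (\<Sum>c\<in>V. reg_lap a c * G c b) = of_bool (a = b))"

lemma reg_lap_green_matrix: "a \<in> V \<Longrightarrow> b \<in> V \<Longrightarrow> (\<Sum>c\<in>V. reg_lap a c * green_matrix c b) = of_bool (a = b)"
proof -
  have "\<exists>u. \<forall>a\<in>V. (\<Sum>c\<in>V. reg_lap a c * u c) = of_bool (a = b)" for b
    using pos_definite_solvable[OF finite_V reg_lap_form_pos] .
  then have "\<exists>g. \<forall>b. \<forall>a\<in>V. (\<Sum>c\<in>V. reg_lap a c * g b c) = of_bool (a = b)"
    by (intro choice allI)
  then obtain g where "\<forall>b. \<forall>a\<in>V. (\<Sum>c\<in>V. reg_lap a c * g b c) = of_bool (a = b)" by blast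
  then have "\<exists>G. \<forall>b\<in>V. \<forall>a\<in>V. (\<Sum>c\<in>V. reg_lap a c * G c b) = of_bool (a = b)"
    by (intro exI[of _ "\<lambda>c b. g b c"]) auto
  then have "\<forall>b\<in>V. \<forall>a\<in>V. (\<Sum>c\<in>V. reg_lap a c * green_matrix c b) = of_bool (a = b)"
    unfolding green_matrix_def by (rule someI_ex)
  then show "a \<in> V \<Longrightarrow> b \<in> V \<Longrightarrow> ?thesis" by blast
qed

lemma reg_lap_commute: "reg_lap a b = reg_lap b a"
  by (simp add: reg_lap_def mult.commute)

lemma reg_lap_column_sum:
  shows "(\<Sum>a\<in>V. reg_lap a c) = 1"
proof -
  have "(\<Sum>a\<in>V. orient e a) = 0" if "e \<in> E" for e
    using sum_orient[OF that, of "\<lambda>_. 1"] by simp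
  then have "(\<Sum>e\<in>E. \<Sum>a\<in>V. orient e a * (orient e c / len e)) = 0"
    by (simp add: sum_distrib_right[symmetric] del: times_divide_eq_right)
  then have "(\<Sum>a\<in>V. \<Sum>e\<in>E. orient e a * orient e c / len e) = 0"
    by (subst sum.swap) simp
  then show ?thesis
    unfolding reg_lap_def sum.distrib using card_V_pos by simp
qed

lemma green_matrix_column_sum:
  assumes b: "b \<in> V"
  shows "(\<Sum>c\<in>V. green_matrix c b) = 1"
proof -
  have "(\<Sum>c\<in>V. green_matrix c b) = (\<Sum>c\<in>V. (\<Sum>a\<in>V. reg_lap a c) * green_matrix c b)"
    by (intro sum.cong) (simp_all add: reg_lap_column_sum)
  also have "\<dots> = (\<Sum>a\<in>V. \<Sum>c\<in>V. reg_lap a c * green_matrix c b)"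
    by (subst sum.swap) (simp add: sum_distrib_right)
  also have "\<dots> = (\<Sum>a\<in>V. of_bool (a = b))" using b by (intro sum.cong) (simp_all add: reg_lap_green_matrix)
  also have "\<dots> = 1" using b finite_V by simp
  finally show ?thesis .
qed

text \<open>Writes the inverse \<open>G\<close> of \<open>A = reg_lap\<close> as \<open>G\<^sup>T A G\<close>, from which \<open>G\<close> inherits its symmetry.\<close>
lemma green_matrix_form:
  assumes a: "a \<in> V" and b: "b \<in> V"
  shows "(\<Sum>c\<in>V. green_matrix c a * (\<Sum>d\<in>V. reg_lap c d * green_matrix d b)) = green_matrix b a"
proof -
  have "(\<Sum>c\<in>V. green_matrix c a * (\<Sum>d\<in>V. reg_lap c d * green_matrix d b)) = (\<Sum>c\<in>V. if c = b then green_matrix c a else 0)"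
    by (rule sum.cong[OF refl]) (simp add: reg_lap_green_matrix[OF _ b])
  also have "\<dots> = green_matrix b a" using b finite_V by simp
  finally show ?thesis .
qed

lemma green_matrix_commute:
  assumes a: "a \<in> V" and b: "b \<in> V"
  shows "green_matrix a b = green_matrix b a"
proof -
  have "green_matrix b a = (\<Sum>c\<in>V. \<Sum>d\<in>V. green_matrix c a * (reg_lap c d * green_matrix d b))"
    using green_matrix_form[OF a b] unfolding sum_distrib_left by (rule sym)
  also have "\<dots> = (\<Sum>d\<in>V. \<Sum>c\<in>V. green_matrix c a * (reg_lap c d * green_matrix d b))"
    by (rule sum.swap)
  also have "\<dots> = (\<Sum>d\<in>V. \<Sum>c\<in>V. green_matrix d b * (reg_lap d c * green_matrix c a))"
  proof (intro sum.cong refl)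
    fix c d
    show "green_matrix c a * (reg_lap c d * green_matrix d b) = green_matrix d b * (reg_lap d c * green_matrix c a)"
      by (subst reg_lap_commute) (simp only: mult_ac)
  qed
  also have "\<dots> = green_matrix a b"
    using green_matrix_form[OF b a] unfolding sum_distrib_left .
  finally show ?thesis by simp
qed

text \<open>With \<open>g = G w\<close> the form of \<open>G\<close> at \<open>w\<close> is the form of its inverse \<open>reg_lap\<close> at \<open>g\<close>.\<close>
lemma green_matrix_psd: "0 \<le> (\<Sum>a\<in>V. \<Sum>b\<in>V. w a * w b * green_matrix a b)"
proof -
  define g where "g c = (\<Sum>b\<in>V. green_matrix c b * w b)" for c
  have lg: "(\<Sum>c\<in>V. reg_lap a c * g c) = w a" if "a \<in> V" for a
  proof -
    have "(\<Sum>c\<in>V. reg_lap a c * g c) = (\<Sum>b\<in>V. (\<Sum>c\<in>V. reg_lap a c * green_matrix c b) * w b)"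
      unfolding g_def sum_distrib_left sum_distrib_right by (subst sum.swap) (simp add: mult_ac)
    also have "\<dots> = (\<Sum>b\<in>V. of_bool (a = b) * w b)"
      using that by (intro sum.cong) (simp_all add: reg_lap_green_matrix)
    finally show ?thesis using that finite_V by simp
  qed
  have "0 \<le> (\<Sum>a\<in>V. g a * (\<Sum>c\<in>V. reg_lap a c * g c))" by (rule reg_lap_form_nonneg)
  also have "\<dots> = (\<Sum>a\<in>V. g a * w a)" using lg by (intro sum.cong) simp_all
  also have "\<dots> = (\<Sum>a\<in>V. \<Sum>b\<in>V. w a * w b * green_matrix a b)"
    unfolding g_def by (simp add: sum_distrib_left mult_ac)
  finally show ?thesis .
qed

section \<open>Kernel with Laplacian a point mass minus a fixed measure\<close>

text \<open>The piecewise affine function that is \<open>1\<close> at \<open>a\<close> and \<open>0\<close> at the other vertices, in the coordinate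
  of the edge \<open>e\<close>.\<close>
definition hat :: "'a \<Rightarrow> 'e \<Rightarrow> real \<Rightarrow> real" where
  "hat a e t = (1 - t / len e) * of_bool (\<gamma> e 0 = a) + t / len e * of_bool (\<gamma> e (len e) = a)"

definition edge_kernel :: "'e \<Rightarrow> real \<Rightarrow> 'e \<Rightarrow> real \<Rightarrow> real" where
  "edge_kernel e s e' t =
     (\<Sum>a\<in>V. \<Sum>b\<in>V. hat a e s * hat b e' t * green_matrix a b) + of_bool (e = e') * bridge (len e) s t"

definition green_kernel :: "'a \<Rightarrow> 'a \<Rightarrow> real" where
  "green_kernel x y = (case loc x of (e, s) \<Rightarrow> case loc y of (e', t) \<Rightarrow> edge_kernel e s e' t)"

lemma hat_end:
  assumes "e \<in> E" "t = 0 \<or> t = len e"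
  shows "hat a e t = of_bool (\<gamma> e t = a)"
  using assms len_pos[of e] by (auto simp: hat_def)

text \<open>The right-hand side is written as value plus position times slope, which is the form needed
  for the outflow.\<close>
lemma sum_hat:
  assumes "e \<in> E"
  shows "(\<Sum>a\<in>V. hat a e t * u a) = u (\<gamma> e 0) + t * ((u (\<gamma> e (len e)) - u (\<gamma> e 0)) / len e)"
proof -
  have "(\<Sum>a\<in>V. hat a e t * u a) = (1 - t / len e) * u (\<gamma> e 0) + t / len e * u (\<gamma> e (len e))"
  proof -
    have 1: "(\<Sum>a\<in>V. of_bool (c = a) * u a) = u c" if "c \<in> V" for c
      using that finite_V by simp
    have "(\<Sum>a\<in>V. hat a e t * u a) = (1 - t / len e) * (\<Sum>a\<in>V. of_bool (\<gamma> e 0 = a) * u a)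
        + t / len e * (\<Sum>a\<in>V. of_bool (\<gamma> e (len e) = a) * u a)"
      unfolding sum_distrib_left sum.distrib[symmetric] by (simp only: hat_def distrib_right mult.assoc)
    then show ?thesis by (simp only: 1 ends_in_V[OF assms])
  qed
  also have "\<dots> = u (\<gamma> e 0) + t * ((u (\<gamma> e (len e)) - u (\<gamma> e 0)) / len e)"
    using len_pos[OF assms] by (simp add: field_simps)
  finally show ?thesis .
qed

lemma edge_kernel_commute: "edge_kernel e s e' t = edge_kernel e' t e s"
proof -
  have "(\<Sum>a\<in>V. \<Sum>b\<in>V. hat a e s * hat b e' t * green_matrix a b) = (\<Sum>b\<in>V. \<Sum>a\<in>V. hat a e s * hat b e' t * green_matrix a b)"
    by (rule sum.swap)
  also have "\<dots> = (\<Sum>b\<in>V. \<Sum>a\<in>V. hat b e' t * hat a e s * green_matrix b a)"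
    by (intro sum.cong refl) (simp add: green_matrix_commute)
  finally show ?thesis
    unfolding edge_kernel_def by (auto simp: bridge_commute)
qed

text \<open>Independence of the position chosen for a vertex: the bridge vanishes at the ends of its interval,
  and \<open>hat\<close> at an end depends only on the vertex.\<close>
lemma edge_kernel_cong:
  assumes e: "e \<in> E" "s \<in> {0..len e}" and e1: "e1 \<in> E" "s1 \<in> {0..len e1}"
    and eq: "\<gamma> e s = \<gamma> e1 s1" and e': "e' \<in> E" "t \<in> {0..len e'}"
  shows "edge_kernel e s e' t = edge_kernel e1 s1 e' t"
proof (rule overlap_cases[OF e(1) e1(1) e(2) e1(2) eq])
  assume end': "s = 0 \<or> s = len e" "s1 = 0 \<or> s1 = len e1"
  have "of_bool (e = e') * bridge (len e) s t = 0" "of_bool (e1 = e') * bridge (len e1) s1 t = 0"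
    using end' e' len_pos by auto
  moreover have "hat a e s = hat a e1 s1" for a
    using end' eq by (simp add: hat_end e e1)
  ultimately show ?thesis unfolding edge_kernel_def by simp
qed simp

lemma green_kernel_eq:
  assumes e: "e \<in> E" "s \<in> {0..len e}" and e': "e' \<in> E" "t \<in> {0..len e'}"
  shows "green_kernel (\<gamma> e s) (\<gamma> e' t) = edge_kernel e s e' t"
proof -
  obtain e1 s1 where 1: "loc (\<gamma> e s) = (e1, s1)" "e1 \<in> E" "s1 \<in> {0..len e1}" "\<gamma> e s = \<gamma> e1 s1"
    using loc_cases[OF edge_in[OF e]] .
  obtain e2 t2 where 2: "loc (\<gamma> e' t) = (e2, t2)" "e2 \<in> E" "t2 \<in> {0..len e2}" "\<gamma> e' t = \<gamma> e2 t2"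
    using loc_cases[OF edge_in[OF e']] .
  have "edge_kernel e s e' t = edge_kernel e1 s1 e' t" by (rule edge_kernel_cong[OF e 1(2-4) e'])
  also have "\<dots> = edge_kernel e' t e1 s1" by (rule edge_kernel_commute)
  also have "\<dots> = edge_kernel e2 t2 e1 s1" by (rule edge_kernel_cong[OF e' 2(2-4) 1(2,3)])
  also have "\<dots> = edge_kernel e1 s1 e2 t2" by (rule edge_kernel_commute)
  finally show ?thesis unfolding green_kernel_def 1(1) 2(1) by simp
qed

lemma green_kernel_commute: "green_kernel x y = green_kernel y x"
  unfolding green_kernel_def using edge_kernel_commute by (auto split: prod.splits)

lemma green_kernel_continuous: "continuous_on (\<Gamma> \<times> \<Gamma>) (\<lambda>z. green_kernel (fst z) (snd z))"
proof (rule continuous_on_glued[where \<Phi> = "\<lambda>e e' z. edge_kernel e (fst z) e' (snd z)"])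
  fix e e' assume "e \<in> E" "e' \<in> E"
  then have "len e \<noteq> 0" "len e' \<noteq> 0" using len_pos by force+
  then show "continuous_on ({0..len e} \<times> {0..len e'}) (\<lambda>z. edge_kernel e (fst z) e' (snd z))"
    unfolding edge_kernel_def hat_def bridge_def by (intro continuous_intros) blast+
qed (simp only: green_kernel_eq fst_conv snd_conv)

text \<open>The form splits into the form of \<open>green_matrix\<close> at the vector of interpolation weights, and one
  form of a Brownian bridge for every edge.\<close>
lemma green_kernel_psd:
  assumes Z: "finite Z" "Z \<subseteq> \<Gamma>"
  shows "0 \<le> (\<Sum>x\<in>Z. \<Sum>y\<in>Z. w x * w y * green_kernel x y)"
proof -
  define ed where "ed x = fst (loc x)" for x
  define po where "po x = snd (loc x)" for x
  have ed: "ed x \<in> E" "po x \<in> {0..len (ed x)}" if "x \<in> Z" for x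
    using loc_cases[of x] that Z(2) unfolding ed_def po_def by (metis fst_conv snd_conv subsetD)+
  define H where "H a = (\<Sum>x\<in>Z. w x * hat a (ed x) (po x))" for a
  have "green_kernel x y = edge_kernel (ed x) (po x) (ed y) (po y)" for x y
    by (simp add: green_kernel_def ed_def po_def split_beta)
  then have "(\<Sum>x\<in>Z. \<Sum>y\<in>Z. w x * w y * green_kernel x y) =
      (\<Sum>x\<in>Z. \<Sum>y\<in>Z. \<Sum>a\<in>V. \<Sum>b\<in>V. w x * w y * (hat a (ed x) (po x) * hat b (ed y) (po y) * green_matrix a b))
      + (\<Sum>x\<in>Z. \<Sum>y\<in>Z. w x * w y * (of_bool (ed x = ed y) * bridge (len (ed x)) (po x) (po y)))"
    by (simp add: edge_kernel_def distrib_left sum.distrib sum_distrib_left)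
  moreover have "(\<Sum>x\<in>Z. \<Sum>y\<in>Z. \<Sum>a\<in>V. \<Sum>b\<in>V. w x * w y * (hat a (ed x) (po x) * hat b (ed y) (po y) * green_matrix a b))
      = (\<Sum>a\<in>V. \<Sum>b\<in>V. H a * H b * green_matrix a b)"
  proof -
    have "(\<Sum>x\<in>Z. \<Sum>y\<in>Z. \<Sum>a\<in>V. \<Sum>b\<in>V. w x * w y * (hat a (ed x) (po x) * hat b (ed y) (po y) * green_matrix a b))
      = (\<Sum>x\<in>Z. \<Sum>a\<in>V. \<Sum>y\<in>Z. \<Sum>b\<in>V. w x * w y * (hat a (ed x) (po x) * hat b (ed y) (po y) * green_matrix a b))"
      by (intro sum.cong refl sum.swap)
    also have "\<dots> = (\<Sum>a\<in>V. \<Sum>x\<in>Z. \<Sum>b\<in>V. \<Sum>y\<in>Z. w x * w y * (hat a (ed x) (po x) * hat b (ed y) (po y) * green_matrix a b))"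
      by (subst sum.swap) (intro sum.cong refl sum.swap)
    also have "\<dots> = (\<Sum>a\<in>V. \<Sum>b\<in>V. \<Sum>x\<in>Z. \<Sum>y\<in>Z. w x * w y * (hat a (ed x) (po x) * hat b (ed y) (po y) * green_matrix a b))"
      by (intro sum.cong refl sum.swap)
    also have "\<dots> = (\<Sum>a\<in>V. \<Sum>b\<in>V. H a * H b * green_matrix a b)"
      unfolding H_def sum_product sum_distrib_right by (intro sum.cong refl) (simp add: sum_distrib_left mult_ac)
    finally show ?thesis .
  qed
  moreover have "(\<Sum>x\<in>Z. \<Sum>y\<in>Z. w x * w y * (of_bool (ed x = ed y) * bridge (len (ed x)) (po x) (po y)))
      = (\<Sum>e\<in>E. \<Sum>x\<in>{x\<in>Z. ed x = e}. \<Sum>y\<in>{y\<in>Z. ed y = e}. w x * w y * bridge (len e) (po x) (po y))"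
  proof -
    have "(\<Sum>x\<in>Z. \<Sum>y\<in>Z. w x * w y * (of_bool (ed x = ed y) * bridge (len (ed x)) (po x) (po y)))
      = (\<Sum>e\<in>E. \<Sum>x\<in>{x\<in>Z. ed x = e}. \<Sum>y\<in>Z. w x * w y * (of_bool (ed x = ed y) * bridge (len (ed x)) (po x) (po y)))"
      using ed Z finite_E by (intro sum.group[symmetric]) auto
    also have "\<dots> = (\<Sum>e\<in>E. \<Sum>x\<in>{x\<in>Z. ed x = e}. \<Sum>y\<in>{y\<in>Z. ed y = e}. w x * w y * bridge (len e) (po x) (po y))"
      using Z by (intro sum.cong refl sum.mono_neutral_cong_right) auto
    finally show ?thesis .
  qed
  moreover have "0 \<le> (\<Sum>e\<in>E. \<Sum>x\<in>{x\<in>Z. ed x = e}. \<Sum>y\<in>{y\<in>Z. ed y = e}. w x * w y * bridge (len e) (po x) (po y))"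
    using ed Z len_pos by (intro sum_nonneg bridge_psd) auto
  moreover have "0 \<le> (\<Sum>a\<in>V. \<Sum>b\<in>V. H a * H b * green_matrix a b)" by (rule green_matrix_psd)
  ultimately show ?thesis by simp
qed

lemma green_kernel_along_edge:
  assumes "e \<in> E" "s \<in> {0..len e}" "e0 \<in> E" "t0 \<in> {0..len e0}"
    and u: "\<And>a. a \<in> V \<Longrightarrow> u a = (\<Sum>b\<in>V. hat b e0 t0 * green_matrix a b)"
  shows "green_kernel (\<gamma> e s) (\<gamma> e0 t0) = u (\<gamma> e 0) + s * ((u (\<gamma> e (len e)) - u (\<gamma> e 0)) / len e)
    + of_bool (e = e0) * bridge (len e) s t0"
proof -
  have "(\<Sum>a\<in>V. \<Sum>b\<in>V. hat a e s * hat b e0 t0 * green_matrix a b) = (\<Sum>a\<in>V. hat a e s * u a)"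
    by (intro sum.cong refl) (simp add: u sum_distrib_left mult.assoc)
  then show ?thesis
    unfolding green_kernel_eq[OF assms(1-4)] edge_kernel_def sum_hat[OF assms(1)] by simp
qed

lemma bridge_affine_between:
  assumes "0 < L" "a < b" "t0 \<notin> {a<..<b}"
  shows "\<exists>\<alpha> \<beta>. \<forall>t\<in>{a..b}. bridge L t t0 = \<alpha> + \<beta> * t"
proof (cases "t0 \<le> a")
  case True
  then show ?thesis
    by (intro exI[of _ t0] exI[of _ "- t0 / L"]) (auto simp: bridge_def)
next
  case False
  then have "b \<le> t0" using assms by auto
  then show ?thesis
    by (intro exI[of _ 0] exI[of _ "1 - t0 / L"]) (auto simp: bridge_def algebra_simps)
qed

lemma green_kernel_piecewise_affine:
  assumes y: "y \<in> \<Gamma>"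
  obtains t0 where "\<And>e a b. e \<in> E \<Longrightarrow> 0 \<le> a \<Longrightarrow> a < b \<Longrightarrow> b \<le> len e \<Longrightarrow> t0 \<notin> {a<..<b} \<Longrightarrow>
      \<exists>\<alpha> \<beta>. \<forall>t\<in>{a..b}. green_kernel (\<gamma> e t) y = \<alpha> + \<beta> * t"
proof -
  obtain e0 t0 where y': "e0 \<in> E" "t0 \<in> {0..len e0}" "y = \<gamma> e0 t0"
    using loc_cases[OF y] by metis
  define u where "u a = (\<Sum>b\<in>V. hat b e0 t0 * green_matrix a b)" for a
  have "\<exists>\<alpha> \<beta>. \<forall>t\<in>{a..b}. green_kernel (\<gamma> e t) y = \<alpha> + \<beta> * t"
    if e: "e \<in> E" and ab: "0 \<le> a" "a < b" "b \<le> len e" "t0 \<notin> {a<..<b}" for e a b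
  proof -
    obtain \<alpha> \<beta> where \<alpha>: "\<And>t. t \<in> {a..b} \<Longrightarrow> bridge (len e) t t0 = \<alpha> + \<beta> * t"
      using bridge_affine_between[OF len_pos[OF e] ab(2,4)] by blast
    define d where "d = (u (\<gamma> e (len e)) - u (\<gamma> e 0)) / len e"
    have "green_kernel (\<gamma> e t) y = (u (\<gamma> e 0) + of_bool (e = e0) * \<alpha>) +
        (d + of_bool (e = e0) * \<beta>) * t" if t: "t \<in> {a..b}" for t
    proof -
      have "t \<in> {0..len e}" using t ab by auto
      from green_kernel_along_edge[OF e this y'(1,2) u_def, folded y'(3) d_def] show ?thesis
        unfolding \<alpha>[OF t] by (simp add: algebra_simps)
    qed
    then show ?thesis by blast
  qed
  then show ?thesis by (rule that)
qed

text \<open>The Laplacian of \<open>K(-, y)\<close> is the point mass at \<open>y\<close> minus the uniform distribution on \<open>V\<close>.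
  Let \<open>y\<close> be at position \<open>t0\<close> on the edge \<open>e0\<close>.
  At a vertex \<open>p\<close> the interpolated part contributes \<open>1 / |V|\<close> minus the weight of \<open>p\<close> in \<open>y\<close>. The slopes
  of the bridge at the ends of \<open>e0\<close> cancel this weight, except when \<open>y = p\<close>: then the bridge is zero.
  Inside an edge the interpolated part contributes nothing, and the bridge has a kink of size \<open>- 1\<close>
  at \<open>t0\<close>.\<close>
lemma green_kernel_sphere_sum:
  assumes y: "y \<in> \<Gamma>" and p: "p \<in> \<Gamma>"
  shows "\<forall>\<^sub>F s in at_right 0. (\<Sum>x | x \<in> \<Gamma> \<and> dist p x = s. green_kernel x y - green_kernel p y)
    = s * (of_bool (p \<in> V) / card V - of_bool (p = y))"
proof -
  obtain e0 t0 where y': "e0 \<in> E" "t0 \<in> {0..len e0}" "y = \<gamma> e0 t0"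
    using loc_cases[OF y] by metis
  define u where "u a = (\<Sum>b\<in>V. hat b e0 t0 * green_matrix a b)" for a
  define d where "d e = (u (\<gamma> e (len e)) - u (\<gamma> e 0)) / len e" for e
  note along = green_kernel_along_edge[OF _ _ y'(1,2) u_def, folded y'(3) d_def]
  have L0: "0 < len e0" by (rule len_pos[OF y'(1)])
  have small: "\<forall>\<^sub>F s in at_right 0. s \<in> {0<..<c}" if "0 < c" for c :: real
    using that by (rule eventually_at_right_real)
  show ?thesis
  proof (cases "p \<in> V")
    case True
    \<comment> \<open>the slopes of the bridge at the two ends of \<open>e0\<close>, pointing inwards\<close>
    define A where "A = of_bool (0 < t0) - t0 / len e0"
    define B where "B = of_bool (t0 < len e0) - (1 - t0 / len e0)"
    have "\<forall>\<^sub>F s in at_right 0. \<forall>e\<in>E. s \<in> {0<..<len e}"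
      using finite_E len_pos small by (intro eventually_ball_finite ballI) auto
    moreover have "\<forall>\<^sub>F s in at_right 0. s \<in> {0<..<(if 0 < t0 then t0 else 1)}" by (rule small) simp
    moreover have "\<forall>\<^sub>F s in at_right 0. s \<in> {0<..<(if t0 < len e0 then len e0 - t0 else 1)}" by (rule small) simp
    ultimately show ?thesis using sphere_sum_vertex[OF True]
    proof eventually_elim
      case (elim s)
      have s: "s \<in> {0<..<len e}" if "e \<in> E" for e using elim(1) that by blast
      have s0: "0 < t0 \<Longrightarrow> s < t0" "t0 < len e0 \<Longrightarrow> s < len e0 - t0" "0 < s"
        using elim(2,3) by auto
      have start: "green_kernel (\<gamma> e s) y - green_kernel p y = s * (d e + of_bool (e = e0) * A)"
        if e: "e \<in> E" "\<gamma> e 0 = p" for e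
      proof -
        have "bridge (len e0) s t0 = s * A"
          using s0 y'(2) L0 by (cases "0 < t0") (auto simp: bridge_def A_def field_simps)
        moreover have "green_kernel p y = u p"
          using along[OF e(1), of 0] e(2) y'(2) len_pos[OF e(1)] L0 by auto
        moreover have "green_kernel (\<gamma> e s) y = u p + s * d e + of_bool (e = e0) * bridge (len e) s t0"
          using along[OF e(1), of s] s[OF e(1)] e(2) by simp
        ultimately show ?thesis
          by (cases "e = e0") (auto simp: algebra_simps)
      qed
      have finish: "green_kernel (\<gamma> e (len e - s)) y - green_kernel p y = s * (- d e + of_bool (e = e0) * B)"
        if e: "e \<in> E" "\<gamma> e (len e) = p" for e
      proof -
        have "bridge (len e0) (len e0 - s) t0 = s * B"
          using s0 y'(2) L0 by (cases "t0 < len e0") (auto simp: bridge_def B_def field_simps)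
        moreover have "green_kernel p y = u (\<gamma> e 0) + len e * d e"
          using along[OF e(1), of "len e"] e(2) y'(2) len_pos[OF e(1)] L0 by auto
        moreover have "green_kernel (\<gamma> e (len e - s)) y = u (\<gamma> e 0) + (len e - s) * d e
            + of_bool (e = e0) * bridge (len e) (len e - s) t0"
          using along[OF e(1), of "len e - s"] s[OF e(1)] by simp
        ultimately show ?thesis
          by (cases "e = e0") (auto simp: algebra_simps)
      qed
      have "(\<Sum>x | x \<in> \<Gamma> \<and> dist p x = s. green_kernel x y - green_kernel p y)
          = (\<Sum>e\<in>E. of_bool (\<gamma> e 0 = p) * (green_kernel (\<gamma> e s) y - green_kernel p y)
              + of_bool (\<gamma> e (len e) = p) * (green_kernel (\<gamma> e (len e - s)) y - green_kernel p y))"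
        using elim(4) by blast
      also have "\<dots> = (\<Sum>e\<in>E. s * (orient e p * d e)
          + (if e = e0 then s * (of_bool (\<gamma> e0 0 = p) * A + of_bool (\<gamma> e0 (len e0) = p) * B) else 0))"
      proof (rule sum.cong[OF refl])
        fix e assume e: "e \<in> E"
        consider "\<gamma> e 0 = p" "\<gamma> e (len e) \<noteq> p" | "\<gamma> e 0 \<noteq> p" "\<gamma> e (len e) = p"
          | "\<gamma> e 0 \<noteq> p" "\<gamma> e (len e) \<noteq> p"
          using ends_differ[OF e] by metis
        then show "of_bool (\<gamma> e 0 = p) * (green_kernel (\<gamma> e s) y - green_kernel p y)
              + of_bool (\<gamma> e (len e) = p) * (green_kernel (\<gamma> e (len e - s)) y - green_kernel p y)
          = s * (orient e p * d e)
          + (if e = e0 then s * (of_bool (\<gamma> e0 0 = p) * A + of_bool (\<gamma> e0 (len e0) = p) * B) else 0)"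
        proof cases
          case 1
          then show ?thesis using start[OF e 1(1)] by (cases "e = e0") (simp_all add: orient_def algebra_simps)
        next
          case 2
          then show ?thesis using finish[OF e 2(2)] by (cases "e = e0") (simp_all add: orient_def algebra_simps)
        qed (auto simp: orient_def)
      qed
      also have "\<dots> = s * ((\<Sum>e\<in>E. orient e p * d e)
          + (of_bool (\<gamma> e0 0 = p) * A + of_bool (\<gamma> e0 (len e0) = p) * B))"
        using finite_E y'(1) by (simp add: sum.distrib sum_distrib_left distrib_left)
      also have "(\<Sum>e\<in>E. orient e p * d e) = 1 / card V - hat p e0 t0"
      proof -
        have su: "(\<Sum>b\<in>V. u b) = 1"
        proof -
          have "(\<Sum>b\<in>V. u b) = (\<Sum>b\<in>V. hat b e0 t0 * (\<Sum>c\<in>V. green_matrix c b))"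
            unfolding u_def sum_distrib_left by (rule sum.swap)
          also have "\<dots> = (\<Sum>b\<in>V. hat b e0 t0 * 1)" by (intro sum.cong refl) (simp add: green_matrix_column_sum)
          also have "\<dots> = 1" unfolding sum_hat[OF y'(1)] by simp
          finally show ?thesis .
        qed
        have "(\<Sum>b\<in>V. reg_lap p b * u b) = (\<Sum>b\<in>V. hat b e0 t0 * (\<Sum>c\<in>V. reg_lap p c * green_matrix c b))"
          unfolding u_def sum_distrib_left by (subst sum.swap) (intro sum.cong refl, simp add: mult_ac)
        also have "\<dots> = (\<Sum>b\<in>V. if b = p then hat b e0 t0 else 0)"
          using True by (intro sum.cong refl) (auto simp: reg_lap_green_matrix)
        also have "\<dots> = hat p e0 t0" using True finite_V by simp
        finally have "hat p e0 t0 = (\<Sum>e\<in>E. orient e p * (u (\<gamma> e 0) - u (\<gamma> e (len e))) / len e) + 1 / card V"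
          unfolding reg_lap_apply su by simp
        moreover have "(\<Sum>e\<in>E. orient e p * (u (\<gamma> e 0) - u (\<gamma> e (len e))) / len e) = - (\<Sum>e\<in>E. orient e p * d e)"
          unfolding sum_negf[symmetric] by (intro sum.cong refl) (simp add: d_def divide_simps algebra_simps)
        ultimately show ?thesis by simp
      qed
      also have "1 / card V - hat p e0 t0 + (of_bool (\<gamma> e0 0 = p) * A + of_bool (\<gamma> e0 (len e0) = p) * B)
          = of_bool (p \<in> V) / card V - of_bool (p = y)"
      proof -
        have "p = y \<longleftrightarrow> (t0 = 0 \<and> \<gamma> e0 0 = p) \<or> (t0 = len e0 \<and> \<gamma> e0 (len e0) = p)"
          using in_V_iff[OF y'(1,2)] y'(3) True by auto
        then show ?thesis
          using True y'(2) L0 ends_differ[OF y'(1)] by (auto simp: hat_def A_def B_def)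
      qed
      finally show ?case .
    qed
  next
    case False
    obtain e t where p': "e \<in> E" "t \<in> {0..len e}" "p = \<gamma> e t" using loc_cases[OF p] by metis
    then have t: "t \<in> {0<..<len e}" using False in_V_iff[OF p'(1,2)] by auto
    have py: "p = y \<longleftrightarrow> e = e0 \<and> t = t0"
      using overlap_cases[OF p'(1) y'(1) p'(2) y'(2)] p'(3) y'(3) t by auto
    have "\<forall>\<^sub>F s in at_right 0. s \<in> {0<..<(if t = t0 then 1 else \<bar>t - t0\<bar>)}" by (rule small) simp
    moreover have "\<forall>\<^sub>F s in at_right 0. s \<in> {0<..<min t (len e - t)}" by (rule small) (use t in auto)
    ultimately show ?thesis using sphere_sum_interior[OF p'(1) t]
    proof eventually_elim
      case (elim s)
      have "(\<Sum>x | x \<in> \<Gamma> \<and> dist p x = s. green_kernel x y - green_kernel p y)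
          = (green_kernel (\<gamma> e (t + s)) y - green_kernel p y) + (green_kernel (\<gamma> e (t - s)) y - green_kernel p y)"
        unfolding p'(3) using elim(3) by blast
      also have "\<dots> = of_bool (e = e0) * (bridge (len e) (t + s) t0 + bridge (len e) (t - s) t0 - 2 * bridge (len e) t t0)"
        using along[OF p'(1), of "t + s"] along[OF p'(1), of "t - s"] along[OF p'(1,2)] elim p'(3)
        by (simp add: algebra_simps)
      also have "bridge (len e) (t + s) t0 + bridge (len e) (t - s) t0 - 2 * bridge (len e) t t0
          = min (t + s) t0 + min (t - s) t0 - 2 * min t t0"
        by (simp add: bridge_def algebra_simps add_divide_distrib diff_divide_distrib)
      also have "\<dots> = - s * of_bool (t = t0)"
        using elim by (auto simp: min_def split: if_splits)
      finally show ?case using False py by auto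
    qed
  qed
qed

lemma green_kernel_slice_continuous:
  assumes "y \<in> \<Gamma>"
  shows "continuous_on \<Gamma> (\<lambda>x. green_kernel x y)"
proof -
  have "continuous_on \<Gamma> (\<lambda>x. (x, y))" by (intro continuous_intros)
  then have "continuous_on \<Gamma> (\<lambda>x. green_kernel (fst (x, y)) (snd (x, y)))"
    by (rule continuous_on_compose2[OF green_kernel_continuous]) (use assms in auto)
  then show ?thesis by simp
qed

text \<open>The terms without \<open>x\<close> have no Laplacian, and in the difference of \<open>K(-, y)\<close> and \<open>K(-, \<zeta>)\<close>
  the uniform distribution on \<open>V\<close> cancels. At \<open>x = \<zeta>\<close> the right-hand side vanishes by symmetry.\<close>
lemma j_kernel_eq_green_kernel:
  assumes \<Gamma>: "metrized_graph \<Gamma>" and \<zeta>: "\<zeta> \<in> \<Gamma>" and x: "x \<in> \<Gamma>" and y: "y \<in> \<Gamma>"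
  shows "j_kernel \<Gamma> \<zeta> x y = of_real (green_kernel x y - green_kernel x \<zeta> - green_kernel y \<zeta> + green_kernel \<zeta> \<zeta>)"
proof -
  define f where "f = restrict (\<lambda>x. complex_of_real (green_kernel x y - green_kernel x \<zeta> - green_kernel y \<zeta> + green_kernel \<zeta> \<zeta>)) \<Gamma>"
  have f: "f x = of_real (green_kernel x y - green_kernel x \<zeta> - green_kernel y \<zeta> + green_kernel \<zeta> \<zeta>)" if "x \<in> \<Gamma>" for x
    using that by (simp add: f_def)
  obtain t1 where t1: "\<And>e a b. e \<in> E \<Longrightarrow> 0 \<le> a \<Longrightarrow> a < b \<Longrightarrow> b \<le> len e \<Longrightarrow> t1 \<notin> {a<..<b} \<Longrightarrow>
      \<exists>\<alpha> \<beta>. \<forall>t\<in>{a..b}. green_kernel (\<gamma> e t) y = \<alpha> + \<beta> * t"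
    using green_kernel_piecewise_affine[OF y] by blast
  obtain t2 where t2: "\<And>e a b. e \<in> E \<Longrightarrow> 0 \<le> a \<Longrightarrow> a < b \<Longrightarrow> b \<le> len e \<Longrightarrow> t2 \<notin> {a<..<b} \<Longrightarrow>
      \<exists>\<alpha> \<beta>. \<forall>t\<in>{a..b}. green_kernel (\<gamma> e t) \<zeta> = \<alpha> + \<beta> * t"
    using green_kernel_piecewise_affine[OF \<zeta>] by blast
  have fCPA: "f \<in> CPA \<Gamma>"
  proof (rule CPA_I[where T = "{t1, t2}"])
    show "f \<in> extensional \<Gamma>" by (simp add: f_def)
    have "continuous_on \<Gamma> (\<lambda>x. complex_of_real (green_kernel x y - green_kernel x \<zeta> - green_kernel y \<zeta> + green_kernel \<zeta> \<zeta>))"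
      by (intro continuous_intros green_kernel_slice_continuous y \<zeta>)
    then show "continuous_on \<Gamma> f" by (rule continuous_on_eq) (simp add: f)
    fix e a b assume e: "e \<in> E" and ab: "0 \<le> a" "a < b" "b \<le> len e" and T: "{a<..<b} \<inter> {t1, t2} = {}"
    obtain \<alpha>1 \<beta>1 where 1: "\<And>t. t \<in> {a..b} \<Longrightarrow> green_kernel (\<gamma> e t) y = \<alpha>1 + \<beta>1 * t"
      using t1[OF e ab] T by blast
    obtain \<alpha>2 \<beta>2 where 2: "\<And>t. t \<in> {a..b} \<Longrightarrow> green_kernel (\<gamma> e t) \<zeta> = \<alpha>2 + \<beta>2 * t"
      using t2[OF e ab] T by blast
    have "f (\<gamma> e t) = of_real (\<alpha>1 - \<alpha>2 - green_kernel y \<zeta> + green_kernel \<zeta> \<zeta>) + of_real (\<beta>1 - \<beta>2) * of_real t"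
      if t: "t \<in> {a..b}" for t
    proof -
      have "\<gamma> e t \<in> \<Gamma>" using t ab e by (intro edge_in) auto
      then show ?thesis by (simp add: f 1[OF t] 2[OF t] algebra_simps)
    qed
    then show "\<exists>\<alpha> \<beta>. \<forall>t\<in>{a..b}. f (\<gamma> e t) = \<alpha> + \<beta> * of_real t" by blast
  qed simp
  have "outflow \<Gamma> f p = of_bool (p = \<zeta>) - of_bool (p = y)" if p: "p \<in> \<Gamma>" for p
  proof -
    obtain \<epsilon> b where g: "affine_germ \<Gamma> p f \<epsilon> b" using CPA_affine_germ[OF \<Gamma> fCPA p] .
    then have "0 < \<epsilon>" by (simp add: affine_germ_def star_radius_def)
    then have "\<forall>\<^sub>F s in at_right 0. s \<in> {0<..<\<epsilon>}" by (rule eventually_at_right_real)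
    then have "\<forall>\<^sub>F s::real in at_right 0. outflow \<Gamma> f p = of_bool (p = \<zeta>) - of_bool (p = y)"
      using green_kernel_sphere_sum[OF y p] green_kernel_sphere_sum[OF \<zeta> p]
    proof eventually_elim
      case (elim s)
      have "of_real s * outflow \<Gamma> f p = (\<Sum>x | x \<in> \<Gamma> \<and> dist p x = s. f x - f p)"
        using outflow_eq_sphere_sum[OF g] elim(1) by simp
      also have "\<dots> = (\<Sum>x | x \<in> \<Gamma> \<and> dist p x = s.
          of_real ((green_kernel x y - green_kernel p y) - (green_kernel x \<zeta> - green_kernel p \<zeta>)))"
        using p by (intro sum.cong) (auto simp: f)
      also have "\<dots> = of_real ((\<Sum>x | x \<in> \<Gamma> \<and> dist p x = s. green_kernel x y - green_kernel p y)
          - (\<Sum>x | x \<in> \<Gamma> \<and> dist p x = s. green_kernel x \<zeta> - green_kernel p \<zeta>))"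
        by (simp only: of_real_sum sum_subtractf of_real_diff)
      also have "\<dots> = of_real (s * (of_bool (p = \<zeta>) - of_bool (p = y)))"
        unfolding elim(2,3) by (simp add: algebra_simps)
      finally have "complex_of_real s * outflow \<Gamma> f p = of_real s * (of_bool (p = \<zeta>) - of_bool (p = y))"
        by (cases "p = \<zeta>"; cases "p = y") simp_all
      then show ?case using elim(1) by simp
    qed
    then show ?thesis by simp
  qed
  then have "j_kernel \<Gamma> \<zeta> x y = f x"
    by (intro j_kernel_eqI[OF \<Gamma> y \<zeta> fCPA]) (simp_all add: f[OF \<zeta>] green_kernel_commute[of \<zeta> y])
  then show ?thesis using f[OF x] by simp
qed

end

section \<open>Jordan decomposition of a signed measure\<close>

lemma signed_measure_minus: "signed_measure M \<mu> \<Longrightarrow> signed_measure M (\<lambda>A. - \<mu> A)"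
  unfolding signed_measure_def by (auto intro: sums_minus)

lemma signed_measure_Un:
  assumes \<mu>: "signed_measure M \<mu>" and "A \<in> sets M" "B \<in> sets M" "A \<inter> B = {}"
  shows "\<mu> (A \<union> B) = \<mu> A + \<mu> B"
proof -
  have "range (binaryset A B) \<subseteq> sets M" using assms by (simp add: range_binaryset_eq)
  moreover have "disjoint_family (binaryset A B)"
    using assms by (auto simp: disjoint_family_on_def binaryset_def)
  ultimately have "(\<lambda>n. \<mu> (binaryset A B n)) sums \<mu> (A \<union> B)"
    using \<mu> UN_binaryset_eq[of A B] unfolding signed_measure_def by metis
  moreover have "(\<lambda>n. \<mu> (binaryset A B n)) sums (\<mu> A + \<mu> B)"
    using \<mu> by (intro binaryset_sums) (simp add: signed_measure_def)
  ultimately show ?thesis by (rule sums_unique2)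
qed

text \<open>The map \<open>ennreal\<close> cuts off negative numbers, so on signed terms it is only subadditive.\<close>
lemma ennreal_sums_le:
  fixes a :: "nat \<Rightarrow> real"
  assumes "a sums s"
  shows "ennreal s \<le> (\<Sum>i. ennreal (a i))"
proof (rule LIMSEQ_le_const2)
  show "(\<lambda>n. ennreal (\<Sum>i<n. a i)) \<longlonglongrightarrow> ennreal s"
    using assms unfolding sums_def by (rule tendsto_ennrealI)
  have "ennreal (x + y) \<le> ennreal x + ennreal y" for x y
    by (cases "0 \<le> x"; cases "0 \<le> y")
      (auto simp: ennreal_plus[symmetric] ennreal_neg simp del: ennreal_plus intro: ennreal_leI)
  then have "ennreal (\<Sum>i<n. a i) \<le> (\<Sum>i<n. ennreal (a i))" for n
    by (induction n) (auto intro: order_trans[OF _ add_right_mono])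
  then show "\<exists>N. \<forall>n\<ge>N. ennreal (\<Sum>i<n. a i) \<le> (\<Sum>i. ennreal (a i))"
    by (meson order_trans sum_le_suminf summableI zero_le finite_lessThan)
qed

text \<open>The set function from which \<open>pos_variation\<close> is built. It has to be countably additive for
  \<open>measure_of\<close> to return it.\<close>
definition upper_variation :: "'a measure \<Rightarrow> ('a set \<Rightarrow> real) \<Rightarrow> 'a set \<Rightarrow> ennreal" where
  "upper_variation M \<mu> A = (SUP B\<in>{B\<in>sets M. B \<subseteq> A}. ennreal (\<mu> B))"

lemma upper_variation_mono: "A \<subseteq> A' \<Longrightarrow> upper_variation M \<mu> A \<le> upper_variation M \<mu> A'"
  unfolding upper_variation_def by (rule SUP_subset_mono) auto

lemma upper_variation_ge: "B \<in> sets M \<Longrightarrow> B \<subseteq> A \<Longrightarrow> ennreal (\<mu> B) \<le> upper_variation M \<mu> A"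
  unfolding upper_variation_def by (rule SUP_upper) simp

lemma upper_variation_superadditive:
  assumes \<mu>: "signed_measure M \<mu>" and AB: "A \<inter> A' = {}"
  shows "upper_variation M \<mu> A + upper_variation M \<mu> A' \<le> upper_variation M \<mu> (A \<union> A')"
proof -
  have "ennreal (\<mu> B) + ennreal (\<mu> B') \<le> upper_variation M \<mu> (A \<union> A')"
    if B: "B \<in> sets M" "B \<subseteq> A" and B': "B' \<in> sets M" "B' \<subseteq> A'" for B B'
  proof -
    have 1: "ennreal (\<mu> B) \<le> upper_variation M \<mu> (A \<union> A')" "ennreal (\<mu> B') \<le> upper_variation M \<mu> (A \<union> A')"
      using B B' by (auto intro!: upper_variation_ge)
    have "\<mu> (B \<union> B') = \<mu> B + \<mu> B'" using B B' AB by (intro signed_measure_Un[OF \<mu>]) auto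
    moreover have "ennreal (\<mu> (B \<union> B')) \<le> upper_variation M \<mu> (A \<union> A')"
      using B B' by (intro upper_variation_ge) auto
    ultimately show ?thesis
      using 1 by (cases "0 \<le> \<mu> B"; cases "0 \<le> \<mu> B'") (auto simp: ennreal_neg)
  qed
  then have "(SUP B\<in>{B\<in>sets M. B \<subseteq> A}. ennreal (\<mu> B) + ennreal (\<mu> B')) \<le> upper_variation M \<mu> (A \<union> A')"
    if "B' \<in> sets M" "B' \<subseteq> A'" for B' using that by (intro SUP_least) auto
  moreover have "(SUP B\<in>{B\<in>sets M. B \<subseteq> A}. ennreal (\<mu> B) + c) = upper_variation M \<mu> A + c" for c
    unfolding upper_variation_def by (rule ennreal_SUP_add_left) auto
  ultimately have "(SUP B'\<in>{B\<in>sets M. B \<subseteq> A'}. upper_variation M \<mu> A + ennreal (\<mu> B')) \<le> upper_variation M \<mu> (A \<union> A')"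
    by (intro SUP_least) auto
  moreover have "(SUP B'\<in>{B\<in>sets M. B \<subseteq> A'}. upper_variation M \<mu> A + ennreal (\<mu> B'))
      = upper_variation M \<mu> A + upper_variation M \<mu> A'"
    unfolding upper_variation_def[of M \<mu> A'] add.commute[of "upper_variation M \<mu> A"]
    by (rule ennreal_SUP_add_left) auto
  ultimately show ?thesis by simp
qed

lemma upper_variation_countably_additive:
  assumes \<mu>: "signed_measure M \<mu>"
  shows "countably_additive (sets M) (upper_variation M \<mu>)"
  unfolding countably_additive_def
proof (intro allI impI antisym)
  fix A :: "nat \<Rightarrow> 'a set"
  assume A: "range A \<subseteq> sets M" "disjoint_family A"
  show "upper_variation M \<mu> (\<Union> (range A)) \<le> (\<Sum>i. upper_variation M \<mu> (A i))"
    unfolding upper_variation_def[of M \<mu> "\<Union> (range A)"]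
  proof (rule SUP_least, clarify)
    fix B assume B: "B \<in> sets M" "B \<subseteq> \<Union> (range A)"
    have "range (\<lambda>i. B \<inter> A i) \<subseteq> sets M" using A B by auto
    moreover have "disjoint_family (\<lambda>i. B \<inter> A i)" using A by (auto simp: disjoint_family_on_def)
    moreover have "(\<Union>i. B \<inter> A i) = B" using B by auto
    ultimately have "(\<lambda>i. \<mu> (B \<inter> A i)) sums \<mu> B" using \<mu> unfolding signed_measure_def by metis
    then have "ennreal (\<mu> B) \<le> (\<Sum>i. ennreal (\<mu> (B \<inter> A i)))" by (rule ennreal_sums_le)
    also have "\<dots> \<le> (\<Sum>i. upper_variation M \<mu> (A i))"
      using A B by (intro suminf_le upper_variation_ge) auto
    finally show "ennreal (\<mu> B) \<le> (\<Sum>i. upper_variation M \<mu> (A i))" .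
  qed
  have "(\<Sum>i<n. upper_variation M \<mu> (A i)) \<le> upper_variation M \<mu> (\<Union>i<n. A i)" for n
  proof (induction n)
    case (Suc n)
    have "A n \<inter> A i = {}" if "i < n" for i
      using A(2) that by (intro disjoint_family_onD[OF A(2)]) auto
    then have "A n \<inter> (\<Union>i<n. A i) = {}" by blast
    then have "upper_variation M \<mu> (A n) + upper_variation M \<mu> (\<Union>i<n. A i) \<le> upper_variation M \<mu> (A n \<union> (\<Union>i<n. A i))"
      by (rule upper_variation_superadditive[OF \<mu>])
    then show ?case
      using Suc by (auto simp: lessThan_Suc add.commute intro: order_trans add_left_mono)
  qed simp
  then have "(\<Sum>i<n. upper_variation M \<mu> (A i)) \<le> upper_variation M \<mu> (\<Union> (range A))" for n
    by (rule order_trans) (rule upper_variation_mono, auto)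
  then show "(\<Sum>i. upper_variation M \<mu> (A i)) \<le> upper_variation M \<mu> (\<Union> (range A))"
    by (intro suminf_le_const summableI)
qed

lemma sets_pos_variation [simp]: "sets (pos_variation M \<mu>) = sets M"
  and space_pos_variation [simp]: "space (pos_variation M \<mu>) = space M"
  by (simp_all add: pos_variation_def sets.space_closed)

lemma emeasure_pos_variation:
  assumes \<mu>: "signed_measure M \<mu>" and A: "A \<in> sets M"
  shows "emeasure (pos_variation M \<mu>) A = upper_variation M \<mu> A"
proof (rule emeasure_measure_of[where M = "pos_variation M \<mu>"])
  show "pos_variation M \<mu> = measure_of (space M) (sets M) (upper_variation M \<mu>)"
    by (simp add: pos_variation_def upper_variation_def[abs_def])
  have "{B \<in> sets M. B \<subseteq> {}} = {{}}" by auto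
  then show "positive (sets (pos_variation M \<mu>)) (upper_variation M \<mu>)"
    using \<mu> by (simp add: positive_def upper_variation_def signed_measure_def)
qed (use A upper_variation_countably_additive[OF \<mu>] in \<open>auto dest: sets.sets_into_space\<close>)

text \<open>Pass to complements: \<open>\<mu> B = \<mu> (space M) - \<mu> (space M - B)\<close>, and \<open>- \<mu> (space M - B)\<close> is at most the
  total mass of \<open>neg_variation\<close>. Applied to \<open>- \<mu>\<close> it gives the reverse inequality.\<close>
lemma pos_variation_total_le:
  assumes \<mu>: "signed_measure M \<mu>"
    and fin: "emeasure (pos_variation M \<mu>) (space M) < \<infinity>" "emeasure (neg_variation M \<mu>) (space M) < \<infinity>"
  shows "measure (pos_variation M \<mu>) (space M) \<le> \<mu> (space M) + measure (neg_variation M \<mu>) (space M)"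
proof -
  let ?q = "measure (neg_variation M \<mu>) (space M)"
  have q: "upper_variation M (\<lambda>A. - \<mu> A) (space M) = ennreal ?q"
    using emeasure_pos_variation[OF signed_measure_minus[OF \<mu>], of "space M"] fin(2)
    by (simp add: neg_variation_def measure_def)
  have "\<mu> B \<le> \<mu> (space M) + ?q" if B: "B \<in> sets M" for B
  proof -
    have "\<mu> (B \<union> (space M - B)) = \<mu> B + \<mu> (space M - B)"
      using B by (intro signed_measure_Un[OF \<mu>]) auto
    moreover have "B \<union> (space M - B) = space M" using sets.sets_into_space[OF B] by auto
    moreover have "ennreal (- \<mu> (space M - B)) \<le> ennreal ?q"
      unfolding q[symmetric] using B by (intro upper_variation_ge[where \<mu> = "\<lambda>A. - \<mu> A"]) auto
    then have "- \<mu> (space M - B) \<le> ?q" by (cases "0 \<le> - \<mu> (space M - B)") auto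
    ultimately show ?thesis by simp
  qed
  then have "upper_variation M \<mu> (space M) \<le> ennreal (\<mu> (space M) + ?q)"
    unfolding upper_variation_def by (intro SUP_least ennreal_leI) auto
  moreover have "0 \<le> \<mu> (space M) + ?q"
    using \<open>\<And>B. B \<in> sets M \<Longrightarrow> \<mu> B \<le> \<mu> (space M) + ?q\<close>[of "{}"] \<mu> by (simp add: signed_measure_def)
  ultimately show ?thesis
    using emeasure_pos_variation[OF \<mu>, of "space M"]
    by (simp add: measure_def enn2real_leI)
qed

lemma Jordan_decomposition_total:
  assumes \<mu>: "signed_measure M \<mu>" and fin: "total_variation M \<mu> (space M) < \<infinity>"
  shows "finite_measure (pos_variation M \<mu>)" "finite_measure (neg_variation M \<mu>)"
    "measure (pos_variation M \<mu>) (space M) - measure (neg_variation M \<mu>) (space M) = \<mu> (space M)"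
proof -
  have f: "emeasure (pos_variation M \<mu>) (space M) < \<infinity>" "emeasure (neg_variation M \<mu>) (space M) < \<infinity>"
    using fin by (auto simp: total_variation_def)
  then show "finite_measure (pos_variation M \<mu>)" "finite_measure (neg_variation M \<mu>)"
    by (auto intro!: finite_measureI simp: neg_variation_def)
  show "measure (pos_variation M \<mu>) (space M) - measure (neg_variation M \<mu>) (space M) = \<mu> (space M)"
    using pos_variation_total_le[OF \<mu> f] pos_variation_total_le[OF signed_measure_minus[OF \<mu>]] f
    by (simp add: neg_variation_def)
qed

section \<open>Energy of a signed measure\<close>

lemma integrable_continuous_compact:
  fixes f :: "'a::metric_space \<Rightarrow> real"
  assumes "compact \<Gamma>" and f: "continuous_on \<Gamma> f" and "finite_measure P" and P: "sets P = sets (borel_on \<Gamma>)"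
  shows "integrable P f"
proof -
  interpret finite_measure P by fact
  have sp: "space P = \<Gamma>" using sets_eq_imp_space_eq[OF P] by (simp add: space_restrict_space)
  have "bounded (f ` \<Gamma>)" using assms by (intro compact_imp_bounded compact_continuous_image)
  then obtain B where "\<And>x. x \<in> \<Gamma> \<Longrightarrow> norm (f x) \<le> B" unfolding bounded_iff by blast
  moreover have "f \<in> borel_measurable P"
    using borel_measurable_continuous_on_restrict[OF f] measurable_cong_sets[OF P refl] by metis
  ultimately show ?thesis by (intro integrable_const_bound[where B = B]) (auto simp: sp)
qed

lemma small_borel_partition:
  fixes \<Gamma> :: "'a::metric_space set"
  assumes "compact \<Gamma>" "0 < \<delta>"
  obtains Z A where "finite Z" "Z \<subseteq> \<Gamma>" "\<forall>z\<in>Z. A z \<in> sets (borel_on \<Gamma>) \<and> A z \<subseteq> ball z \<delta>"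
    "disjoint_family_on A Z" "(\<Union>z\<in>Z. A z) = \<Gamma>"
proof -
  have part: "\<exists>A. (\<forall>z\<in>Z. A z \<in> sets (borel_on \<Gamma>) \<and> A z \<subseteq> ball z \<delta>) \<and> disjoint_family_on A Z \<and>
      (\<Union>z\<in>Z. A z) = \<Gamma> \<inter> (\<Union>z\<in>Z. ball z \<delta>)" if "finite Z" for Z
    using that
  proof (induction Z rule: finite_induct)
    case (insert z Z)
    obtain A where "(\<forall>z\<in>Z. A z \<in> sets (borel_on \<Gamma>) \<and> A z \<subseteq> ball z \<delta>) \<and> disjoint_family_on A Z \<and>
      (\<Union>z\<in>Z. A z) = \<Gamma> \<inter> (\<Union>z\<in>Z. ball z \<delta>)" using insert.IH by (rule exE)
    then have A: "\<And>z. z \<in> Z \<Longrightarrow> A z \<in> sets (borel_on \<Gamma>)" "\<And>z. z \<in> Z \<Longrightarrow> A z \<subseteq> ball z \<delta>"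
      "disjoint_family_on A Z" "(\<Union>z\<in>Z. A z) = \<Gamma> \<inter> (\<Union>z\<in>Z. ball z \<delta>)" by simp_all
    define A' where "A' = A(z := \<Gamma> \<inter> ball z \<delta> - (\<Union>z\<in>Z. A z))"
    have A'_eq: "A' y = A y" if "y \<in> Z" for y using that insert.hyps by (auto simp: A'_def)
    have A'_z: "A' z = \<Gamma> \<inter> ball z \<delta> - (\<Union>z\<in>Z. A z)" by (simp add: A'_def)
    have "\<Gamma> \<inter> ball z \<delta> \<in> sets (borel_on \<Gamma>)"
      by (auto simp: sets_restrict_space intro!: image_eqI[where x = "ball z \<delta>"])
    then have "A' z \<in> sets (borel_on \<Gamma>)"
      unfolding A'_z using A(1) insert.hyps by (intro sets.Diff sets.finite_UN) auto
    moreover have "disjoint_family_on A' (insert z Z)"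
      unfolding disjoint_family_on_insert[OF insert.hyps(2)]
    proof
      show "A' z \<inter> \<Union> (A' ` Z) = {}" unfolding A'_z using A'_eq by auto
      show "disjoint_family_on A' Z" using A(3) A'_eq by (auto simp: disjoint_family_on_def)
    qed
    moreover have "(\<Union>y\<in>insert z Z. A' y) = \<Gamma> \<inter> (\<Union>y\<in>insert z Z. ball y \<delta>)"
      using A(4) A'_eq A'_z by auto
    ultimately show ?case using A(1,2) A'_eq A'_z by (intro exI[of _ A']) auto
  qed (auto simp: disjoint_family_on_def)
  obtain Z where Z: "Z \<subseteq> \<Gamma>" "finite Z" "\<Gamma> \<subseteq> (\<Union>z\<in>Z. ball z \<delta>)"
    using compactE_image[OF assms(1), of \<Gamma> "\<lambda>z. ball z \<delta>"] assms(2) by force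
  obtain A where A: "\<forall>z\<in>Z. A z \<in> sets (borel_on \<Gamma>) \<and> A z \<subseteq> ball z \<delta>" "disjoint_family_on A Z"
      "(\<Union>z\<in>Z. A z) = \<Gamma> \<inter> (\<Union>z\<in>Z. ball z \<delta>)" using part[OF Z(2)] by blast
  show ?thesis
  proof (rule that[OF Z(2,1) A(1,2)])
    show "(\<Union>z\<in>Z. A z) = \<Gamma>" unfolding A(3) using Z(3) by (rule Int_absorb2)
  qed
qed

text \<open>A Riemann sum is the integral of the step function that equals \<open>f z\<close> on \<open>A z\<close>.\<close>
lemma quadrature_error:
  fixes f :: "'a::metric_space \<Rightarrow> real"
  assumes "compact \<Gamma>" and f: "continuous_on \<Gamma> f" and "finite_measure P" and P: "sets P = sets (borel_on \<Gamma>)"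
    and A: "finite Z" "\<And>z. z \<in> Z \<Longrightarrow> A z \<in> sets (borel_on \<Gamma>)" "disjoint_family_on A Z" "(\<Union>z\<in>Z. A z) = \<Gamma>"
    and osc: "\<And>z x. z \<in> Z \<Longrightarrow> x \<in> A z \<Longrightarrow> \<bar>f x - f z\<bar> \<le> \<epsilon>"
  shows "\<bar>integral\<^sup>L P f - (\<Sum>z\<in>Z. measure P (A z) * f z)\<bar> \<le> \<epsilon> * measure P \<Gamma>"
proof -
  interpret finite_measure P by fact
  have sp: "space P = \<Gamma>" using sets_eq_imp_space_eq[OF P] by (simp add: space_restrict_space)
  have AP: "A z \<in> sets P" if "z \<in> Z" for z using A(2)[OF that] P by simp
  define g where "g x = (\<Sum>z\<in>Z. indicator (A z) x * f z)" for x
  have g: "integrable P g" "integral\<^sup>L P g = (\<Sum>z\<in>Z. measure P (A z) * f z)"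
    unfolding g_def using AP by (auto simp: less_top[symmetric] intro!: sum.cong)
  have fi: "integrable P f" by (rule integrable_continuous_compact[OF assms(1-4)])
  have "\<bar>f x - g x\<bar> \<le> \<epsilon>" if x: "x \<in> \<Gamma>" for x
  proof -
    obtain z where z: "z \<in> Z" "x \<in> A z" using x A(4) by blast
    have "indicator (A y) x = (of_bool (y = z) :: real)" if "y \<in> Z" for y
      using disjoint_family_onD[OF A(3) that z(1)] z(2) by (auto simp: indicator_def)
    then have "g x = (\<Sum>y\<in>Z. of_bool (y = z) * f y)" unfolding g_def by (intro sum.cong) auto
    also have "\<dots> = f z" using z A(1) by simp
    finally show ?thesis using osc[OF z] by simp
  qed
  then have "(\<integral>x. \<bar>f x - g x\<bar> \<partial>P) \<le> (\<integral>x. \<epsilon> \<partial>P)"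
    using fi g by (intro integral_mono) (auto simp: sp)
  moreover have "\<bar>integral\<^sup>L P f - integral\<^sup>L P g\<bar> \<le> (\<integral>x. \<bar>f x - g x\<bar> \<partial>P)"
    using integral_abs_bound[of P "\<lambda>x. f x - g x"] fi g by simp
  ultimately show ?thesis using g(2) by (simp add: sp mult.commute)
qed

text \<open>A finite signed measure, presented as the difference of \<open>P\<close> and \<open>Q\<close>.\<close>
locale signed_pair =
  fixes \<Gamma> :: "'a::metric_space set" and P Q :: "'a measure"
  assumes compact: "compact \<Gamma>"
    and fin: "finite_measure P" "finite_measure Q"
    and sets: "sets P = sets (borel_on \<Gamma>)" "sets Q = sets (borel_on \<Gamma>)"
begin

definition J :: "('a \<Rightarrow> real) \<Rightarrow> real" where
  "J f = integral\<^sup>L P f - integral\<^sup>L Q f"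

text \<open>For the Jordan decomposition this is the total variation.\<close>
definition mass :: real where
  "mass = measure P \<Gamma> + measure Q \<Gamma>"

lemma space_eq: "space P = \<Gamma>" "space Q = \<Gamma>"
  using sets_eq_imp_space_eq[OF sets(1)] sets_eq_imp_space_eq[OF sets(2)] by (simp_all add: space_restrict_space)

lemma mass_nonneg: "0 \<le> mass" by (simp add: mass_def)

lemma integrable:
  fixes f :: "'a \<Rightarrow> real"
  assumes "continuous_on \<Gamma> f"
  shows "integrable P f" "integrable Q f"
  using integrable_continuous_compact[OF compact assms] fin sets by auto

lemma J_add: "continuous_on \<Gamma> f \<Longrightarrow> continuous_on \<Gamma> g \<Longrightarrow> J (\<lambda>x. f x + g x) = J f + J g"
  by (simp add: J_def integrable)

lemma J_diff: "continuous_on \<Gamma> f \<Longrightarrow> continuous_on \<Gamma> g \<Longrightarrow> J (\<lambda>x. f x - g x) = J f - J g"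
  by (simp add: J_def integrable)

lemma J_const: "J (\<lambda>x. c) = c * (measure P \<Gamma> - measure Q \<Gamma>)"
  by (simp add: J_def space_eq algebra_simps)

lemma J_bound:
  assumes f: "continuous_on \<Gamma> f" and b: "\<And>x. x \<in> \<Gamma> \<Longrightarrow> \<bar>f x\<bar> \<le> c"
  shows "\<bar>J f\<bar> \<le> c * mass"
proof -
  have "\<bar>integral\<^sup>L R f\<bar> \<le> c * measure R \<Gamma>" if R: "finite_measure R" "integrable R f" "space R = \<Gamma>" for R
  proof -
    interpret finite_measure R by fact
    have "\<bar>integral\<^sup>L R f\<bar> \<le> (\<integral>x. \<bar>f x\<bar> \<partial>R)" by (rule integral_abs_bound)
    also have "\<dots> \<le> (\<integral>x. c \<partial>R)" using R b by (intro integral_mono) auto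
    finally show ?thesis using R by (simp add: mult.commute)
  qed
  from this[OF fin(1) integrable(1)[OF f] space_eq(1)] this[OF fin(2) integrable(2)[OF f] space_eq(2)]
  show ?thesis by (simp add: J_def mass_def distrib_left)
qed

text \<open>One choice of points and weights serves all functions with the same modulus of continuity.
  This uniformity allows the approximation of the measure in both variables of a kernel.\<close>
lemma J_quadrature:
  assumes "0 < \<delta>"
  obtains Z m where "finite Z" "Z \<subseteq> \<Gamma>" "(\<Sum>z\<in>Z. \<bar>m z\<bar>) \<le> mass"
    "\<And>f \<epsilon>. continuous_on \<Gamma> f \<Longrightarrow> (\<And>x y. x \<in> \<Gamma> \<Longrightarrow> y \<in> \<Gamma> \<Longrightarrow> dist x y < \<delta> \<Longrightarrow> \<bar>f x - f y\<bar> \<le> \<epsilon>) \<Longrightarrow>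
       \<bar>J f - (\<Sum>z\<in>Z. m z * f z)\<bar> \<le> \<epsilon> * mass"
proof -
  obtain Z A where Z: "finite Z" "Z \<subseteq> \<Gamma>" and A': "\<forall>z\<in>Z. A z \<in> sets (borel_on \<Gamma>) \<and> A z \<subseteq> ball z \<delta>"
    and A'': "disjoint_family_on A Z" "(\<Union>z\<in>Z. A z) = \<Gamma>"
    using small_borel_partition[OF compact assms] .
  have A: "\<And>z. z \<in> Z \<Longrightarrow> A z \<in> sets (borel_on \<Gamma>)" "\<And>z. z \<in> Z \<Longrightarrow> A z \<subseteq> ball z \<delta>"
    "disjoint_family_on A Z" "(\<Union>z\<in>Z. A z) = \<Gamma>"
    using A' A'' by blast+
  define m where "m z = measure P (A z) - measure Q (A z)" for z
  have tot: "(\<Sum>z\<in>Z. measure R (A z)) = measure R \<Gamma>" if R: "finite_measure R" "sets R = sets (borel_on \<Gamma>)" for R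
  proof -
    have "A ` Z \<subseteq> sets R" using A(1) R(2) by blast
    from finite_measure.finite_measure_finite_Union[OF R(1) Z(1) this A(3)]
    show ?thesis unfolding A(4) by (rule sym)
  qed
  have "(\<Sum>z\<in>Z. \<bar>m z\<bar>) \<le> (\<Sum>z\<in>Z. measure P (A z) + measure Q (A z))"
  proof (rule sum_mono)
    fix z
    show "\<bar>m z\<bar> \<le> measure P (A z) + measure Q (A z)"
      using measure_nonneg[of P "A z"] measure_nonneg[of Q "A z"] unfolding m_def by linarith
  qed
  also have "\<dots> = mass" using tot[OF fin(1) sets(1)] tot[OF fin(2) sets(2)] by (simp add: sum.distrib mass_def)
  finally have m: "(\<Sum>z\<in>Z. \<bar>m z\<bar>) \<le> mass" .
  have "\<bar>J f - (\<Sum>z\<in>Z. m z * f z)\<bar> \<le> \<epsilon> * mass"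
    if f: "continuous_on \<Gamma> f" and osc: "\<And>x y. x \<in> \<Gamma> \<Longrightarrow> y \<in> \<Gamma> \<Longrightarrow> dist x y < \<delta> \<Longrightarrow> \<bar>f x - f y\<bar> \<le> \<epsilon>" for f \<epsilon>
  proof -
    have osc': "\<bar>f x - f z\<bar> \<le> \<epsilon>" if "z \<in> Z" "x \<in> A z" for z x
      using that Z A(2)[of z] A(4) by (intro osc) (auto simp: dist_commute)
    note q = quadrature_error[OF compact f _ _ Z(1) A(1,3,4) osc']
    have "(\<Sum>z\<in>Z. m z * f z) = (\<Sum>z\<in>Z. measure P (A z) * f z) - (\<Sum>z\<in>Z. measure Q (A z) * f z)"
      by (simp add: m_def left_diff_distrib sum_subtractf)
    then show ?thesis
      using q[OF fin(1) sets(1)] q[OF fin(2) sets(2)] by (simp add: J_def mass_def distrib_left)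
  qed
  then show ?thesis using that[of Z m] Z m by blast
qed

end

locale psd_kernel = signed_pair +
  fixes K :: "'a \<Rightarrow> 'a \<Rightarrow> real"
  assumes K_continuous: "continuous_on (\<Gamma> \<times> \<Gamma>) (\<lambda>z. K (fst z) (snd z))"
    and K_commute: "K x y = K y x"
    and K_psd: "finite Z \<Longrightarrow> Z \<subseteq> \<Gamma> \<Longrightarrow> 0 \<le> (\<Sum>x\<in>Z. \<Sum>y\<in>Z. w x * w y * K x y)"
begin

definition potential :: "'a \<Rightarrow> real" where "potential x = J (\<lambda>\<zeta>. K x \<zeta>)"

lemma K_slice: "x \<in> \<Gamma> \<Longrightarrow> continuous_on \<Gamma> (\<lambda>\<zeta>. K x \<zeta>)"
proof -
  assume "x \<in> \<Gamma>"
  have "continuous_on \<Gamma> (\<lambda>\<zeta>. (x, \<zeta>))" by (intro continuous_intros)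
  then have "continuous_on \<Gamma> (\<lambda>\<zeta>. K (fst (x, \<zeta>)) (snd (x, \<zeta>)))"
    by (rule continuous_on_compose2[OF K_continuous]) (use \<open>x \<in> \<Gamma>\<close> in auto)
  then show ?thesis by simp
qed

lemma K_diagonal: "continuous_on \<Gamma> (\<lambda>\<zeta>. K \<zeta> \<zeta>)"
proof -
  have "continuous_on \<Gamma> (\<lambda>\<zeta>. (\<zeta>, \<zeta>))" by (intro continuous_intros)
  then have "continuous_on \<Gamma> (\<lambda>\<zeta>. K (fst (\<zeta>, \<zeta>)) (snd (\<zeta>, \<zeta>)))"
    by (rule continuous_on_compose2[OF K_continuous]) auto
  then show ?thesis by simp
qed

lemma K_equicontinuous:
  assumes "0 < \<epsilon>"
  obtains \<delta> where "0 < \<delta>"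
    "\<And>x y y'. x \<in> \<Gamma> \<Longrightarrow> y \<in> \<Gamma> \<Longrightarrow> y' \<in> \<Gamma> \<Longrightarrow> dist y y' < \<delta> \<Longrightarrow> \<bar>K x y - K x y'\<bar> \<le> \<epsilon>"
proof -
  have "uniformly_continuous_on (\<Gamma> \<times> \<Gamma>) (\<lambda>z. K (fst z) (snd z))"
    by (intro compact_uniformly_continuous K_continuous compact_Times compact)
  then obtain \<delta> where \<delta>: "0 < \<delta>"
    "\<And>z z'. z \<in> \<Gamma> \<times> \<Gamma> \<Longrightarrow> z' \<in> \<Gamma> \<times> \<Gamma> \<Longrightarrow> dist z' z < \<delta> \<Longrightarrow> dist (K (fst z') (snd z')) (K (fst z) (snd z)) < \<epsilon>"
    unfolding uniformly_continuous_on_def using assms by metis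
  have "\<bar>K x y - K x y'\<bar> \<le> \<epsilon>" if "x \<in> \<Gamma>" "y \<in> \<Gamma>" "y' \<in> \<Gamma>" "dist y y' < \<delta>" for x y y'
    using \<delta>(2)[of "(x, y')" "(x, y)"] that by (simp add: dist_Pair_Pair dist_real_def)
  then show ?thesis using that \<delta>(1) by blast
qed

lemma potential_oscillation:
  assumes y: "y \<in> \<Gamma>" "y' \<in> \<Gamma>" and K: "\<And>x. x \<in> \<Gamma> \<Longrightarrow> \<bar>K x y - K x y'\<bar> \<le> \<epsilon>"
  shows "\<bar>potential y - potential y'\<bar> \<le> \<epsilon> * mass"
proof -
  have "potential y - potential y' = J (\<lambda>\<zeta>. K y \<zeta> - K y' \<zeta>)" unfolding potential_def using y by (simp add: J_diff K_slice)
  also have "\<bar>\<dots>\<bar> \<le> \<epsilon> * mass"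
    using y K by (intro J_bound continuous_intros K_slice) (auto simp: K_commute[of y] K_commute[of y'])
  finally show ?thesis .
qed

lemma potential_continuous: "continuous_on \<Gamma> potential"
  unfolding continuous_on_iff
proof (intro ballI allI impI)
  fix x and e :: real assume x: "x \<in> \<Gamma>" and e: "0 < e"
  define \<epsilon> where "\<epsilon> = e / (2 * (mass + 1))"
  have \<epsilon>: "0 < \<epsilon>" using e mass_nonneg by (simp add: \<epsilon>_def)
  obtain \<delta> where \<delta>: "0 < \<delta>" "\<And>x y y'. x \<in> \<Gamma> \<Longrightarrow> y \<in> \<Gamma> \<Longrightarrow> y' \<in> \<Gamma> \<Longrightarrow> dist y y' < \<delta> \<Longrightarrow> \<bar>K x y - K x y'\<bar> \<le> \<epsilon>"
    using K_equicontinuous[OF \<epsilon>] by blast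
  have "\<epsilon> * mass \<le> \<epsilon> * (mass + 1)" using \<epsilon> by simp
  also have "\<dots> = e / 2" using mass_nonneg by (simp add: \<epsilon>_def field_simps)
  also have "\<dots> < e" using e by simp
  finally have "dist (potential x') (potential x) < e" if "x' \<in> \<Gamma>" "dist x' x < \<delta>" for x'
    using potential_oscillation[OF that(1) x \<delta>(2)[OF _ that(1) x that(2)]] by (simp add: dist_real_def)
  then show "\<exists>d>0. \<forall>x'\<in>\<Gamma>. dist x' x < d \<longrightarrow> dist (potential x') (potential x) < e" using \<delta>(1) by blast
qed

text \<open>The right-hand side is the energy of the sum of the point masses at the \<open>x i\<close> minus \<open>c\<close> times the signed
  measure. Replacing the measure by a quadrature changes it by at most a multiple of \<open>\<epsilon>\<close>, and for finite
  combinations of point masses the energy is nonnegative by hypothesis.\<close>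
lemma energy_nonneg:
  fixes x :: "'i \<Rightarrow> 'a"
  assumes I: "finite I" "\<And>i. i \<in> I \<Longrightarrow> x i \<in> \<Gamma>"
  shows "0 \<le> (\<Sum>i\<in>I. \<Sum>j\<in>I. K (x i) (x j)) - 2 * c * (\<Sum>i\<in>I. potential (x i)) + c\<^sup>2 * J potential" (is "0 \<le> ?G")
proof -
  \<comment> \<open>the linear term costs \<open>\<epsilon> mass\<close> per point; the quadratic term is approximated twice, once in each variable\<close>
  define C where "C = 2 * \<bar>c\<bar> * card I * mass + 2 * c\<^sup>2 * mass\<^sup>2"
  have approx: "- (\<epsilon> * C) \<le> ?G" if \<epsilon>: "0 < \<epsilon>" for \<epsilon>
  proof -
    obtain \<delta> where \<delta>: "0 < \<delta>"
      "\<And>x y y'. x \<in> \<Gamma> \<Longrightarrow> y \<in> \<Gamma> \<Longrightarrow> y' \<in> \<Gamma> \<Longrightarrow> dist y y' < \<delta> \<Longrightarrow> \<bar>K x y - K x y'\<bar> \<le> \<epsilon>"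
      using K_equicontinuous[OF \<epsilon>] by blast
    obtain Z m where Z: "finite Z" "Z \<subseteq> \<Gamma>" and m: "(\<Sum>z\<in>Z. \<bar>m z\<bar>) \<le> mass"
      and quad: "\<And>f \<epsilon>. continuous_on \<Gamma> f \<Longrightarrow> (\<And>x y. x \<in> \<Gamma> \<Longrightarrow> y \<in> \<Gamma> \<Longrightarrow> dist x y < \<delta> \<Longrightarrow> \<bar>f x - f y\<bar> \<le> \<epsilon>) \<Longrightarrow>
       \<bar>J f - (\<Sum>z\<in>Z. m z * f z)\<bar> \<le> \<epsilon> * mass"
      using J_quadrature[OF \<delta>(1)] by blast
    define R where "R y = (\<Sum>z\<in>Z. m z * K y z)" for y
    have R: "\<bar>potential y - R y\<bar> \<le> \<epsilon> * mass" if "y \<in> \<Gamma>" for y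
      unfolding potential_def R_def using that \<delta>(2) by (intro quad K_slice) auto
    have JU: "\<bar>J potential - (\<Sum>z\<in>Z. m z * potential z)\<bar> \<le> \<epsilon> * mass * mass"
      using \<delta>(2) by (intro quad potential_continuous potential_oscillation) auto
    define Y where "Y = Z \<union> x ` I"
    have Y: "finite Y" "Y \<subseteq> \<Gamma>" using Z I by (auto simp: Y_def)
    \<comment> \<open>weights of the combination of point masses; the points \<open>x i\<close> may repeat and may lie in \<open>Z\<close>\<close>
    define w where "w y = (\<Sum>i\<in>I. of_bool (x i = y)) - c * (of_bool (y \<in> Z) * m y)" for y
    have test: "(\<Sum>y\<in>Y. w y * f y) = (\<Sum>i\<in>I. f (x i)) - c * (\<Sum>z\<in>Z. m z * f z)" for f
    proof -
      have "(\<Sum>y\<in>Y. (\<Sum>i\<in>I. of_bool (x i = y)) * f y) = (\<Sum>i\<in>I. \<Sum>y\<in>Y. of_bool (x i = y) * f y)"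
        unfolding sum_distrib_right by (rule sum.swap)
      also have "\<dots> = (\<Sum>i\<in>I. f (x i))"
      proof (rule sum.cong[OF refl])
        fix i assume "i \<in> I"
        then have "x i \<in> Y" by (simp add: Y_def)
        then show "(\<Sum>y\<in>Y. of_bool (x i = y) * f y) = f (x i)" using Y(1) by simp
      qed
      moreover have "(\<Sum>y\<in>Y. of_bool (y \<in> Z) * m y * f y) = (\<Sum>z\<in>Z. m z * f z)"
        using Y(1) by (intro sum.mono_neutral_cong_right) (auto simp: Y_def)
      moreover have "(\<Sum>y\<in>Y. w y * f y) = (\<Sum>y\<in>Y. (\<Sum>i\<in>I. of_bool (x i = y)) * f y)
          - c * (\<Sum>y\<in>Y. of_bool (y \<in> Z) * m y * f y)"
        unfolding w_def sum_distrib_left by (simp only: left_diff_distrib sum_subtractf mult.assoc)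
      ultimately show ?thesis by simp
    qed
    have "0 \<le> (\<Sum>y\<in>Y. w y * (\<Sum>y'\<in>Y. w y' * K y y'))"
      using K_psd[OF Y, of w] by (simp add: sum_distrib_left mult.assoc)
    also have "\<dots> = (\<Sum>i\<in>I. (\<Sum>j\<in>I. K (x i) (x j)) - c * R (x i))
        - c * (\<Sum>z\<in>Z. m z * ((\<Sum>j\<in>I. K z (x j)) - c * R z))"
      unfolding test R_def ..
    also have "(\<Sum>z\<in>Z. m z * ((\<Sum>j\<in>I. K z (x j)) - c * R z)) = (\<Sum>j\<in>I. R (x j)) - c * (\<Sum>z\<in>Z. m z * R z)"
    proof -
      have "(\<Sum>z\<in>Z. m z * (\<Sum>j\<in>I. K z (x j))) = (\<Sum>j\<in>I. R (x j))"
        unfolding R_def sum_distrib_left by (subst sum.swap) (simp only: K_commute)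
      then show ?thesis
        by (simp add: right_diff_distrib sum_subtractf sum_distrib_left mult.left_commute)
    qed
    finally have S: "0 \<le> (\<Sum>i\<in>I. \<Sum>j\<in>I. K (x i) (x j)) - 2 * c * (\<Sum>i\<in>I. R (x i)) + c\<^sup>2 * (\<Sum>z\<in>Z. m z * R z)"
      by (simp add: sum_subtractf algebra_simps power2_eq_square flip: sum_distrib_left)
    have 1: "\<bar>(\<Sum>i\<in>I. R (x i)) - (\<Sum>i\<in>I. potential (x i))\<bar> \<le> card I * (\<epsilon> * mass)"
    proof -
      have "\<bar>\<Sum>i\<in>I. R (x i) - potential (x i)\<bar> \<le> (\<Sum>i\<in>I. \<bar>R (x i) - potential (x i)\<bar>)" by (rule sum_abs)
      also have "\<dots> \<le> (\<Sum>i\<in>I. \<epsilon> * mass)"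
        using R I by (intro sum_mono) (simp add: abs_minus_commute)
      finally show ?thesis by (simp add: sum_subtractf)
    qed
    have 2: "\<bar>(\<Sum>z\<in>Z. m z * R z) - J potential\<bar> \<le> 2 * (\<epsilon> * mass * mass)"
    proof -
      have "\<bar>\<Sum>z\<in>Z. m z * (R z - potential z)\<bar> \<le> (\<Sum>z\<in>Z. \<bar>m z * (R z - potential z)\<bar>)" by (rule sum_abs)
      also have "\<dots> \<le> (\<Sum>z\<in>Z. \<bar>m z\<bar> * (\<epsilon> * mass))"
        using R Z(2) by (intro sum_mono) (auto simp: abs_mult abs_minus_commute intro!: mult_left_mono)
      also have "\<dots> \<le> mass * (\<epsilon> * mass)"
        unfolding sum_distrib_right[symmetric] using m \<epsilon> mass_nonneg by (intro mult_right_mono) auto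
      finally have "\<bar>(\<Sum>z\<in>Z. m z * R z) - (\<Sum>z\<in>Z. m z * potential z)\<bar> \<le> \<epsilon> * mass * mass"
        by (simp add: right_diff_distrib sum_subtractf mult.commute mult.left_commute)
      then show ?thesis using JU by linarith
    qed
    have "\<bar>c * ((\<Sum>i\<in>I. R (x i)) - (\<Sum>i\<in>I. potential (x i)))\<bar> \<le> \<bar>c\<bar> * (card I * (\<epsilon> * mass))"
      unfolding abs_mult by (rule mult_left_mono[OF 1]) simp
    moreover have "\<bar>c\<^sup>2 * ((\<Sum>z\<in>Z. m z * R z) - J potential)\<bar> \<le> c\<^sup>2 * (2 * (\<epsilon> * mass * mass))"
      unfolding abs_mult abs_power2 by (rule mult_left_mono[OF 2]) simp
    moreover have "\<epsilon> * C = 2 * (\<bar>c\<bar> * (card I * (\<epsilon> * mass))) + c\<^sup>2 * (2 * (\<epsilon> * mass * mass))"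
      by (simp add: C_def algebra_simps power2_eq_square)
    moreover have "?G = ((\<Sum>i\<in>I. \<Sum>j\<in>I. K (x i) (x j)) - 2 * c * (\<Sum>i\<in>I. R (x i)) + c\<^sup>2 * (\<Sum>z\<in>Z. m z * R z))
        + 2 * (c * ((\<Sum>i\<in>I. R (x i)) - (\<Sum>i\<in>I. potential (x i)))) - c\<^sup>2 * ((\<Sum>z\<in>Z. m z * R z) - J potential)"
      by (simp add: algebra_simps)
    ultimately show ?thesis using S by linarith
  qed
  have C0: "0 \<le> C" using mass_nonneg by (simp add: C_def)
  show ?thesis
  proof (rule field_le_epsilon)
    fix e :: real assume e: "0 < e"
    define \<epsilon> where "\<epsilon> = e / (C + 1)"
    have "0 < \<epsilon>" using e C0 by (simp add: \<epsilon>_def)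
    have "\<epsilon> * C \<le> \<epsilon> * (C + 1)" using \<open>0 < \<epsilon>\<close> by simp
    also have "\<dots> = e" using C0 by (simp add: \<epsilon>_def)
    finally show "0 \<le> ?G + e" using approx[OF \<open>0 < \<epsilon>\<close>] by linarith
  qed
qed

end

section \<open>The lower bound\<close>

lemma signed_integral_of_real:
  assumes "signed_pair \<Gamma> (pos_variation (borel_on \<Gamma>) \<mu>) (neg_variation (borel_on \<Gamma>) \<mu>)"
    and "\<And>x. x \<in> \<Gamma> \<Longrightarrow> f x = complex_of_real (h x)"
  shows "signed_integral (borel_on \<Gamma>) \<mu> f =
    complex_of_real (signed_pair.J (pos_variation (borel_on \<Gamma>) \<mu>) (neg_variation (borel_on \<Gamma>) \<mu>) h)"
proof -
  interpret signed_pair \<Gamma> "pos_variation (borel_on \<Gamma>) \<mu>" "neg_variation (borel_on \<Gamma>) \<mu>" by fact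
  have "integral\<^sup>L R f = complex_of_real (integral\<^sup>L R h)" if "space R = \<Gamma>" for R
  proof -
    have "integral\<^sup>L R f = integral\<^sup>L R (\<lambda>x. complex_of_real (h x))"
      using assms(2) that by (intro Bochner_Integration.integral_cong) auto
    then show ?thesis by simp
  qed
  from this[OF space_eq(1)] this[OF space_eq(2)] show ?thesis
    unfolding signed_integral_def J_def by simp
qed

text \<open>Both integrations against \<open>\<mu>\<close> are linear, and constants integrate to themselves since the total mass
  is \<open>1\<close>. In the second one \<open>\<integral> K(x, y) d\<mu>(x)\<close> cancels \<open>potential y\<close>, so the result does not depend on \<open>y\<close>.\<close>
lemma g_mu_eq:
  assumes S: "psd_kernel \<Gamma> (pos_variation (borel_on \<Gamma>) \<mu>) (neg_variation (borel_on \<Gamma>) \<mu>) K"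
    and unit: "measure (pos_variation (borel_on \<Gamma>) \<mu>) \<Gamma> - measure (neg_variation (borel_on \<Gamma>) \<mu>) \<Gamma> = 1"
    and j: "\<And>\<zeta> x y. \<zeta> \<in> \<Gamma> \<Longrightarrow> x \<in> \<Gamma> \<Longrightarrow> y \<in> \<Gamma> \<Longrightarrow>
      j_kernel \<Gamma> \<zeta> x y = complex_of_real (K x y - K x \<zeta> - K y \<zeta> + K \<zeta> \<zeta>)"
    and x: "x \<in> \<Gamma>" and y: "y \<in> \<Gamma>"
  defines "J' \<equiv> signed_pair.J (pos_variation (borel_on \<Gamma>) \<mu>) (neg_variation (borel_on \<Gamma>) \<mu>)"
    and "pot \<equiv> psd_kernel.potential (pos_variation (borel_on \<Gamma>) \<mu>) (neg_variation (borel_on \<Gamma>) \<mu>) K"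
  shows "g_mu \<Gamma> \<mu> x y = complex_of_real (K x y - pot x - pot y + J' pot)"
proof -
  interpret psd_kernel \<Gamma> "pos_variation (borel_on \<Gamma>) \<mu>" "neg_variation (borel_on \<Gamma>) \<mu>" K by (rule S)
  define D where "D = J (\<lambda>\<zeta>. K \<zeta> \<zeta>)"
  have const: "J (\<lambda>x. c) = c" for c by (simp add: J_const unit)
  have jmu: "j_mu \<Gamma> \<mu> x y = complex_of_real (K x y - potential x - potential y + D)"
    if x: "x \<in> \<Gamma>" and y: "y \<in> \<Gamma>" for x y
  proof -
    have "j_mu \<Gamma> \<mu> x y = complex_of_real (J (\<lambda>\<zeta>. K x y - K x \<zeta> - K y \<zeta> + K \<zeta> \<zeta>))"
      unfolding j_mu_def using j[OF _ x y] by (intro signed_integral_of_real signed_pair_axioms)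
    also have "J (\<lambda>\<zeta>. K x y - K x \<zeta> - K y \<zeta> + K \<zeta> \<zeta>) = K x y - potential x - potential y + D"
      unfolding D_def potential_def using x y
      by (simp add: J_add J_diff const continuous_intros K_slice K_diagonal)
    finally show ?thesis .
  qed
  have int: "signed_integral (borel_on \<Gamma>) \<mu> (\<lambda>x. j_mu \<Gamma> \<mu> x y) = complex_of_real (D - J potential)"
    if y: "y \<in> \<Gamma>" for y
  proof -
    have "signed_integral (borel_on \<Gamma>) \<mu> (\<lambda>x. j_mu \<Gamma> \<mu> x y)
        = complex_of_real (J (\<lambda>x. K y x - potential x + (D - potential y)))"
      using jmu[OF _ y] by (intro signed_integral_of_real signed_pair_axioms) (simp add: K_commute)
    also have "J (\<lambda>x. K y x - potential x + (D - potential y)) = D - J potential"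
      using y by (simp add: J_add J_diff const continuous_intros K_slice potential_continuous flip: potential_def)
    finally show ?thesis .
  qed
  have "c_mu \<Gamma> \<mu> = complex_of_real (D - J potential)"
    unfolding c_mu_def by (rule the_equality) (use int y in auto)
  then show ?thesis using jmu[OF x y] by (simp add: g_mu_def J'_def pot_def)
qed

theorem proposition1p7:
  fixes \<Gamma> :: "'a::metric_space set" and \<mu> :: "'a set \<Rightarrow> real"
  assumes "metrized_graph \<Gamma>"
    and "signed_measure (borel_on \<Gamma>) \<mu>"
    and "\<mu> \<Gamma> = 1"
    and "total_variation (borel_on \<Gamma>) \<mu> \<Gamma> < \<infinity>"
  shows "\<exists>C::real. C > 0 \<and>
    (\<forall>N\<ge>2. \<forall>x::nat \<Rightarrow> 'a. (\<forall>i\<in>{1..N}. x i \<in> \<Gamma>) \<longrightarrow>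
       1 / (of_nat N * (of_nat N - 1)) *
         (\<Sum>(i, j)\<in>{(i, j). i \<in> {1..N} \<and> j \<in> {1..N} \<and> i \<noteq> j}. g_mu \<Gamma> \<mu> (x i) (x j))
       \<ge> complex_of_real (- C / real N))"
proof -
  have space: "space (borel_on \<Gamma>) = \<Gamma>" by (simp add: space_restrict_space)
  let ?P = "pos_variation (borel_on \<Gamma>) \<mu>" and ?Q = "neg_variation (borel_on \<Gamma>) \<mu>"
  have "\<Gamma> \<noteq> {}" using assms(2,3) by (auto simp: signed_measure_def)
  have compact: "compact \<Gamma>" and connected: "connected \<Gamma>" using assms(1) by (auto simp: metrized_graph_def)
  obtain V and E :: "'a set set" and \<gamma> len where "edge_decomposition \<Gamma> V E \<gamma> len"
    using edge_decomposition_exists[OF assms(1)] by blast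
  then have "metric_network \<Gamma> V E \<gamma> len"
    using connected \<open>\<Gamma> \<noteq> {}\<close> by (simp add: metric_network_def metric_network_axioms_def)
  then interpret network: metric_network \<Gamma> V E \<gamma> len .
  have total: "total_variation (borel_on \<Gamma>) \<mu> (space (borel_on \<Gamma>)) < \<infinity>"
    using assms(4) by (simp only: space)
  note Jordan = Jordan_decomposition_total[OF assms(2) total, unfolded space assms(3)]
  have "sets ?P = sets (borel_on \<Gamma>)" "sets ?Q = sets (borel_on \<Gamma>)"
    by (simp_all add: neg_variation_def)
  then have "signed_pair \<Gamma> ?P ?Q"
    by (rule signed_pair.intro[OF compact Jordan(1,2)])
  moreover have "psd_kernel_axioms \<Gamma> network.green_kernel"
    by (rule psd_kernel_axioms.intro)
      (rule network.green_kernel_continuous network.green_kernel_commute network.green_kernel_psd; assumption)+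
  ultimately have S: "psd_kernel \<Gamma> ?P ?Q network.green_kernel"
    by (rule psd_kernel.intro)
  interpret psd_kernel \<Gamma> ?P ?Q network.green_kernel by (rule S)
  note g = g_mu_eq[OF S Jordan(3) network.j_kernel_eq_green_kernel[OF assms(1)]]
  have "continuous_on \<Gamma> (\<lambda>x. network.green_kernel x x - potential x - potential x + J potential)"
    by (intro continuous_intros K_diagonal potential_continuous)
  then have "bounded ((\<lambda>x. network.green_kernel x x - potential x - potential x + J potential) ` \<Gamma>)"
    using compact by (intro compact_imp_bounded compact_continuous_image)
  then obtain B where B: "0 < B" "\<And>x. x \<in> \<Gamma> \<Longrightarrow> \<bar>network.green_kernel x x - potential x - potential x + J potential\<bar> \<le> B"
    unfolding bounded_pos by auto
  show ?thesis
  proof (intro exI[of _ "2 * B"] conjI allI impI)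
    fix N :: nat and x :: "nat \<Rightarrow> 'a"
    assume N: "2 \<le> N" and x: "\<forall>i\<in>{1..N}. x i \<in> \<Gamma>"
    let ?I = "{1..N}" and ?T = "{(i, j). i \<in> {1..N} \<and> j \<in> {1..N} \<and> i \<noteq> j}"
    let ?h = "\<lambda>x y. network.green_kernel x y - potential x - potential y + J potential"
    \<comment> \<open>the sum over all pairs is an energy; only the diagonal has to be removed\<close>
    have split: "?I \<times> ?I = ?T \<union> (\<lambda>i. (i, i)) ` ?I" by auto
    have finT: "finite ?T" by (rule finite_subset[of _ "?I \<times> ?I"]) auto
    have "(\<Sum>i\<in>?I. \<Sum>j\<in>?I. ?h (x i) (x j)) = (\<Sum>(i, j)\<in>?T. ?h (x i) (x j)) + (\<Sum>(i, j)\<in>(\<lambda>i. (i, i)) ` ?I. ?h (x i) (x j))"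
      unfolding sum.cartesian_product split using finT by (intro sum.union_disjoint) auto
    also have "(\<Sum>(i, j)\<in>(\<lambda>i. (i, i)) ` ?I. ?h (x i) (x j)) = (\<Sum>i\<in>?I. ?h (x i) (x i))"
      by (subst sum.reindex) (auto simp: inj_on_def)
    finally have off: "(\<Sum>(i, j)\<in>?T. ?h (x i) (x j)) = (\<Sum>i\<in>?I. \<Sum>j\<in>?I. ?h (x i) (x j)) - (\<Sum>i\<in>?I. ?h (x i) (x i))"
      by simp
    have "(\<Sum>i\<in>?I. \<Sum>j\<in>?I. ?h (x i) (x j)) = (\<Sum>i\<in>?I. \<Sum>j\<in>?I. network.green_kernel (x i) (x j))
        - 2 * real N * (\<Sum>i\<in>?I. potential (x i)) + (real N)\<^sup>2 * J potential"
      by (simp add: sum.distrib sum_subtractf power2_eq_square flip: sum_distrib_left)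
    also have "\<dots> \<ge> 0" using x by (intro energy_nonneg) auto
    finally have pos: "0 \<le> (\<Sum>i\<in>?I. \<Sum>j\<in>?I. ?h (x i) (x j))" .
    have "(\<Sum>i\<in>?I. ?h (x i) (x i)) \<le> (\<Sum>i\<in>?I. B)"
      using x B(2) by (intro sum_mono) (auto simp: abs_le_iff)
    then have "- (real N * B) \<le> (\<Sum>(i, j)\<in>?T. ?h (x i) (x j))"
      unfolding off using pos by simp
    moreover have pos': "0 < real N * (real N - 1)" using N by simp
    ultimately have "- (real N * B) / (real N * (real N - 1)) \<le> (\<Sum>(i, j)\<in>?T. ?h (x i) (x j)) / (real N * (real N - 1))"
      by (intro divide_right_mono) auto
    \<comment> \<open>\<open>N \<le> 2 (N - 1)\<close> because \<open>N \<ge> 2\<close>\<close>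
    moreover have "- (2 * B) / real N \<le> - (real N * B) / (real N * (real N - 1))"
      using N B(1) by (simp add: field_simps)
    ultimately have "- (2 * B) / real N \<le> 1 / (real N * (real N - 1)) * (\<Sum>(i, j)\<in>?T. ?h (x i) (x j))"
      by simp
    moreover have "(\<Sum>(i, j)\<in>?T. g_mu \<Gamma> \<mu> (x i) (x j)) = complex_of_real (\<Sum>(i, j)\<in>?T. ?h (x i) (x j))"
      unfolding of_real_sum using x g by (intro sum.cong) auto
    ultimately show "complex_of_real (- (2 * B) / real N)
        \<le> 1 / (of_nat N * (of_nat N - 1)) * (\<Sum>(i, j)\<in>?T. g_mu \<Gamma> \<mu> (x i) (x j))"
      by (simp add: less_eq_complex_def)
  qed (use B in simp)
qed

end
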